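(* Let $q$ be a complex number such that $1/q\in\mathbb{Z}\setminus\{-1,1\}$, and let $A\geq 3$ be an odd integer. Then $$\dim_{\mathbb{Q}}\left(\mathbb{Q}+\mathbb{Q}\beta_q(2)+\mathbb{Q}\beta_q(4)+\dots+\mathbb{Q}\beta_q(A-1)\right)\geq f(A),$$ where $$f(A)=\max_{r\in\mathbb{N},\ 1\leq r<A/2} f(r;A),\qquad f(r;A):=\frac{4rA+A-4r^2}{\left(\frac{48}{\pi^2}+2\right)A+8r^2-\frac{16}{\pi^2}+\frac{16r}{3}}.$$ Moreover, $f(A)\sim \dfrac{\pi}{2\sqrt{\pi^2+24}}\sqrt{A}$ as $A\to+\infty$.
   Context: For a complex number $q$ with $|q|<1$ and a positive integer $s$, define $\beta_q(s):=\sum_{k\geq1}k^{s-1}\frac{q^k}{1+q^{2k}}$ (equivalently $\sum_{k\geq1}\sum_{d\mid k}\chi(k/d)d^{s-1}q^k$, where $\chi$ is the non-trivial Dirichlet character modulo $4$). *)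

theory Defs
  imports Complex_Main "HOL-Library.Landau_Symbols"
begin

text \<open>
  The sum over \<open>k \<ge> 1\<close> is indexed by \<open>Suc k\<close>. It converges absolutely for \<open>norm q < 1\<close>;
  the exponent \<open>s - 1\<close> is truncated only at \<open>s = 0\<close>, which is outside the intended domain.
\<close>

definition beta_q :: "complex \<Rightarrow> nat \<Rightarrow> complex" where
  "beta_q q s = (\<Sum>k. of_nat (Suc k) ^ (s - 1) * (q ^ Suc k / (1 + q ^ (2 * Suc k))))"

definition scaleQ :: "rat \<Rightarrow> complex \<Rightarrow> complex" where
  "scaleQ a z = of_rat a * z"

interpretation Q: vector_space scaleQ
  by unfold_locales (simp_all add: scaleQ_def algebra_simps of_rat_add of_rat_mult)

definition f_r :: "nat \<Rightarrow> nat \<Rightarrow> real" where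
  "f_r r A = (4 * real r * real A + real A - 4 * real r ^ 2) /
     ((48 / pi ^ 2 + 2) * real A + 8 * real r ^ 2 - 16 / pi ^ 2 + 16 * real r / 3)"

text \<open>The maximum is over a nonempty set exactly when \<open>A \<ge> 3\<close>.\<close>

definition f_max :: "nat \<Rightarrow> real" where
  "f_max A = Max {f_r r A | r. 1 \<le> r \<and> real r < real A / 2}"

end

(*
  Put p = 1/q, let n be even, and choose e so that the rational function

    R(X) = X^e (X - p^n) PROD_{i<rn} (X - p^(2n+2i+1)) PROD_{i<rn} (p^(2i+1) X - 1) / PROD_{i<=n} (X - p^(2i))^A

  satisfies R(p^(2n)/X) = R(X). Sum (-1)^i R(p^(2n+2i+1)) over i >= 0. The first rn terms vanish, so the
  sum is small, and its size is that of the first non-zero term. Expanding R into partial fractions turns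
  the sum into a linear form in 1 and the beta_q(t), and the symmetry kills the odd t. The denominators are
  products of values of cyclotomic polynomials at p: those of order at most N contribute
  (3/pi^2) N^2 ln|p| to the logarithm, those of odd order (2/pi^2) N^2 ln|p|. All sizes have logarithms
  quadratic in n, and Nesterenko's criterion yields the dimension bound f(r;A).

  For the asymptotics of f(A), the arithmetic-geometric mean inequality bounds f(r;A) from above, and
  r close to sqrt((48/pi^2 + 2) A / 8) attains the bound asymptotically.
*)
theory Submission
  imports Defs "HOL-Analysis.Analysis" "HOL-Real_Asymp.Real_Asymp"
    "HOL-Computational_Algebra.Computational_Algebra"
begin

text \<open>In units of ln |p| m^2, where n = 2 m, the forms cleared of denominators decay at rate
  \<alpha> and their coefficients grow at rate at most \<beta>; f(r;A) is exactly 1 + \<alpha> /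
  \<beta>. If \<alpha> \<le> 0 the criterion gives nothing, but then f(r;A) \<le> 1 and the bound is
  trivial. The criterion wants the exact order of decay, so the forms must be bounded from below
  too. This works because e \<ge> m: each later term of the sum is smaller than its predecessor by a
  factor of about |p|^(2 e), so the first non-zero term dominates. Two savings shape the denominator
  of f(r;A). Up to the allowed denominators, the expansions of the two numerator products at every
  pole share the divisor Yodd^(2 r), of rate 8 r / 3; dividing by it leaves 16 r / 3 in place of 8
  r. And the finite sums have denominators of odd order only, so one of the A common denominators
  costs 32 / pi^2 instead of 48 / pi^2, whence the term -16 / pi^2.\<close>

section \<open>Linear forms and dimension over the rationals\<close>

text \<open>
  Nesterenko's criterion in dimension \<open>k + 1\<close>. Dirichlet's theorem gives \<open>q \<le> N ^ k\<close> with all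
  \<open>q * \<theta> i\<close> within \<open>1 / N\<close> of integers. Substituting these integers into the form number \<open>n\<close> gives an
  integer \<open>\<Lambda>\<close> that differs from \<open>q * L n\<close> by at most \<open>k * H n / N\<close>. At the first \<open>n\<close> with
  \<open>q * \<bar>L n\<bar> < 1 / 2\<close> both \<open>\<Lambda> = 0\<close> and \<open>\<Lambda> \<noteq> 0\<close> force \<open>H n / N\<close> not to be small.
\<close>

lemma linear_forms_lower_bound:
  fixes \<theta> :: "nat \<Rightarrow> real" and P :: "nat \<Rightarrow> nat \<Rightarrow> int" and Pz :: "nat \<Rightarrow> int"
    and H L :: "nat \<Rightarrow> real" and k :: nat
  defines "L \<equiv> \<lambda>n. of_int (Pz n) + (\<Sum>i<k. of_int (P n i) * \<theta> i)"
  assumes a: "a > 0" and b: "b > 0"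
    and Lnz: "\<forall>\<^sub>F n in sequentially. L n \<noteq> 0"
    and Llim: "(\<lambda>n. ln \<bar>L n\<bar> / real n ^ 2) \<longlonglongrightarrow> - a"
    and Hpos: "\<And>n. H n > 0"
    and Hlim: "(\<lambda>n. ln (H n) / real n ^ 2) \<longlonglongrightarrow> b"
    and PH: "\<forall>\<^sub>F n in sequentially. \<forall>i<k. \<bar>of_int (P n i)\<bar> \<le> H n"
  shows "a \<le> real k * b"
proof (rule ccontr)
  assume "\<not> a \<le> real k * b"
  hence lt: "real k * b < a" by simp
  \<comment> \<open>The losses below add up to \<open>\<epsilon> * (1 + 3 * k)\<close>; this choice
    spends half of the gap a - k b on them.\<close>
  define \<epsilon> where "\<epsilon> = (a - k * b) / (2 * (1 + 3 * k))"
  have eps: "\<epsilon> > 0" using lt by (simp add: \<epsilon>_def)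
  have eps2: "\<epsilon> * (1 + 3 * k) = (a - k * b) / 2"
    unfolding \<epsilon>_def by (simp add: field_simps)
  define c1 where "c1 = (a - \<epsilon>) * (1 + k)"
  define c2 where "c2 = k * (a + b + 2 * \<epsilon>)"
  define \<delta> where "\<delta> = c1 - c2"
  have "\<delta> = (a - k * b) / 2" unfolding \<delta>_def c1_def c2_def using eps2 by (simp add: algebra_simps)
  hence \<delta>: "\<delta> > 0" using lt by simp
  define K where "K = ln 2 + k * ln (2 * (real k + 1))"
  have "filterlim (\<lambda>n::nat. \<delta> * real n ^ 2 - 2 * c1 * real n + c1) at_top sequentially"
    using \<delta> by real_asymp
  hence ev1: "\<forall>\<^sub>F n in sequentially. \<delta> * real n ^ 2 - 2 * c1 * real n + c1 > K"
    by (simp add: filterlim_at_top_dense)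
  have ev2: "\<forall>\<^sub>F n in sequentially. \<bar>ln \<bar>L n\<bar> / real n ^ 2 - (-a)\<bar> < \<epsilon>"
    using Llim eps by (auto simp: tendsto_iff dist_real_def)
  have ev3: "\<forall>\<^sub>F n in sequentially. \<bar>ln (H n) / real n ^ 2 - b\<bar> < \<epsilon>"
    using Hlim eps by (auto simp: tendsto_iff dist_real_def)
  have ev: "\<forall>\<^sub>F n in sequentially. n > 0 \<and> L n \<noteq> 0 \<and> (\<forall>i<k. \<bar>of_int (P n i)\<bar> \<le> H n) \<and>
      \<delta> * real n ^ 2 - 2 * c1 * real n + c1 > K \<and> \<bar>ln \<bar>L n\<bar> / real n ^ 2 - (-a)\<bar> < \<epsilon> \<and>
      \<bar>ln (H n) / real n ^ 2 - b\<bar> < \<epsilon>"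
    using Lnz PH ev1 ev2 ev3 eventually_gt_at_top[of 0] by eventually_elim auto
  then obtain N0 where N0: "\<And>n. n \<ge> N0 \<Longrightarrow> n > 0 \<and> L n \<noteq> 0 \<and> (\<forall>i<k. \<bar>of_int (P n i)\<bar> \<le> H n) \<and>
      \<delta> * real n ^ 2 - 2 * c1 * real n + c1 > K \<and> \<bar>ln \<bar>L n\<bar> / real n ^ 2 - (-a)\<bar> < \<epsilon> \<and>
      \<bar>ln (H n) / real n ^ 2 - b\<bar> < \<epsilon>"
    unfolding eventually_sequentially by blast
  have L_up: "\<bar>L n\<bar> \<le> exp (-(a - \<epsilon>) * real n ^ 2)" if "n \<ge> N0" for n
  proof -
    from N0[OF that] have "ln \<bar>L n\<bar> / real n ^ 2 < -(a - \<epsilon>)" "real n ^ 2 > 0" by (auto simp: abs_if split: if_splits)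
    hence "ln \<bar>L n\<bar> \<le> -(a - \<epsilon>) * real n ^ 2" by (simp add: divide_less_eq)
    thus ?thesis using N0[OF that] by (metis exp_le_cancel_iff exp_ln zero_less_abs_iff)
  qed
  have L_lo: "\<bar>L n\<bar> \<ge> exp (-(a + \<epsilon>) * real n ^ 2)" if "n \<ge> N0" for n
  proof -
    from N0[OF that] have "ln \<bar>L n\<bar> / real n ^ 2 > -(a + \<epsilon>)" "real n ^ 2 > 0" by (auto simp: abs_if split: if_splits)
    hence "ln \<bar>L n\<bar> \<ge> -(a + \<epsilon>) * real n ^ 2" by (simp add: less_divide_eq)
    thus ?thesis using N0[OF that] by (metis exp_le_cancel_iff exp_ln zero_less_abs_iff)
  qed
  have H_up: "H n \<le> exp ((b + \<epsilon>) * real n ^ 2)" if "n \<ge> N0" for n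
  proof -
    from N0[OF that] have "ln (H n) / real n ^ 2 < b + \<epsilon>" "real n ^ 2 > 0" by (auto simp: abs_if split: if_splits)
    hence "ln (H n) \<le> (b + \<epsilon>) * real n ^ 2" by (simp add: divide_less_eq)
    thus ?thesis using Hpos[of n] by (metis exp_le_cancel_iff exp_ln)
  qed
  have aeps: "a - \<epsilon> > 0"
  proof -
    have "real k * b \<ge> 0" using b by simp
    moreover have "\<epsilon> \<le> (a - k * b) / 2" unfolding \<epsilon>_def using lt
      by (intro divide_left_mono) auto
    moreover have "2 * \<epsilon> \<le> a" if "0 \<le> x" "\<epsilon> \<le> (a - x) / 2" for x :: real
      using that by (simp add: field_simps)
    ultimately have "2 * \<epsilon> \<le> a" by blast
    thus ?thesis using a eps by linarith
  qed
  \<comment> \<open>Depends on \<open>N0\<close> only and is large enough to contradict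
    \<open>key\<close> at \<open>N0\<close> itself, so the minimal index \<open>n1\<close> has a
    predecessor in the controlled range.\<close>
  define N :: nat where "N = nat \<lceil>(real k + 1) * H N0 / min (1/2) \<bar>L N0\<bar>\<rceil> + 1"
  have Npos: "N > 0" by (simp add: N_def)
  have Nbig: "(real k + 1) * H N0 / min (1/2) \<bar>L N0\<bar> < N" unfolding N_def by linarith
  obtain q p where q: "0 < q" "q \<le> int (N ^ k)"
    and qp: "\<And>i. i < k \<Longrightarrow> \<bar>of_int q * \<theta> i - of_int (p i)\<bar> < 1 / N"
    using Dirichlet_approx_simult[OF Npos, of k \<theta>] by blast
  define y where "y = real_of_int q"
  have y1: "y \<ge> 1" using q by (simp add: y_def)
  have yN: "y \<le> real N ^ k" unfolding y_def using q(2)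
    by (metis of_int_le_iff of_int_of_nat_eq of_nat_power)
  have L0: "L \<longlonglongrightarrow> 0"
  proof (rule tendsto_rabs_zero_cancel, rule tendsto_sandwich[of "\<lambda>_. 0" _ _ "\<lambda>n. exp (-(a - \<epsilon>) * real n ^ 2)"])
    show "\<forall>\<^sub>F n in sequentially. \<bar>L n\<bar> \<le> exp (-(a - \<epsilon>) * real n ^ 2)"
      using L_up eventually_ge_at_top[of N0] by (metis (mono_tags, lifting) eventually_mono)
    show "(\<lambda>n. exp (-(a - \<epsilon>) * real n ^ 2)) \<longlonglongrightarrow> 0" using aeps by real_asymp
  qed auto
  have "(\<lambda>n. y * \<bar>L n\<bar>) \<longlonglongrightarrow> y * \<bar>0\<bar>" by (intro tendsto_intros L0)
  hence "\<forall>\<^sub>F n in sequentially. y * \<bar>L n\<bar> < 1/2"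
    by (intro order_tendstoD(2)) auto
  with eventually_ge_at_top[of N0] have "\<forall>\<^sub>F n in sequentially. n \<ge> N0 \<and> y * \<bar>L n\<bar> < 1/2"
    by eventually_elim auto
  hence ex: "\<exists>n. n \<ge> N0 \<and> y * \<bar>L n\<bar> < 1/2"
    by (auto simp: eventually_sequentially)
  define n1 where "n1 = (LEAST n. n \<ge> N0 \<and> y * \<bar>L n\<bar> < 1/2)"
  have n1: "n1 \<ge> N0" "y * \<bar>L n1\<bar> < 1/2" using LeastI_ex[OF ex] by (auto simp: n1_def)
  have n1_min: "y * \<bar>L n\<bar> \<ge> 1/2" if "n \<ge> N0" "n < n1" for n
    using not_less_Least[of n "\<lambda>n. n \<ge> N0 \<and> y * \<bar>L n\<bar> < 1/2"] that by (auto simp: n1_def)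
  define \<Lambda> where "\<Lambda> = Pz n1 * q + (\<Sum>i<k. P n1 i * p i)"
  have \<Lambda>: "of_int \<Lambda> = y * L n1 - (\<Sum>i<k. of_int (P n1 i) * (y * \<theta> i - of_int (p i)))"
    unfolding \<Lambda>_def L_def y_def
    by (simp add: algebra_simps sum_distrib_left sum_distrib_right sum_subtractf)
  have err: "\<bar>\<Sum>i<k. of_int (P n1 i) * (y * \<theta> i - of_int (p i))\<bar> \<le> real k * H n1 / N"
  proof -
    have "\<bar>\<Sum>i<k. of_int (P n1 i) * (y * \<theta> i - of_int (p i))\<bar> \<le> (\<Sum>i<k. \<bar>of_int (P n1 i) * (y * \<theta> i - of_int (p i))\<bar>)"
      by (rule sum_abs)
    also have "\<dots> \<le> (\<Sum>i<k. H n1 * (1 / N))"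
      unfolding abs_mult using N0[OF n1(1)] qp y_def Hpos[of n1]
      by (intro sum_mono mult_mono) (auto intro: less_imp_le)
    finally show ?thesis by simp
  qed
  have key: "min (1/2) (y * \<bar>L n1\<bar>) \<le> real k * H n1 / N"
  proof (cases "\<Lambda> = 0")
    case True
    hence "y * L n1 = (\<Sum>i<k. of_int (P n1 i) * (y * \<theta> i - of_int (p i)))" using \<Lambda> by simp
    hence "\<bar>y * L n1\<bar> \<le> real k * H n1 / N" using err by simp
    thus ?thesis using y1 by (simp add: abs_mult)
  next
    case False
    hence "1 \<le> \<bar>real_of_int \<Lambda>\<bar>" by simp
    also have "\<dots> \<le> \<bar>y * L n1\<bar> + real k * H n1 / N" using \<Lambda> err by linarith
    finally show ?thesis using n1(2) y1 by (simp add: abs_mult)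
  qed
  show False
  proof (cases "n1 = N0")
    case True
    have pos: "min (1/2) \<bar>L N0\<bar> > 0" using N0[of N0] by simp
    have "min (1/2) \<bar>L N0\<bar> \<le> min (1/2) (y * \<bar>L N0\<bar>)" 
      using mult_right_mono[OF y1, of "\<bar>L N0\<bar>"] by linarith
    also have "\<dots> \<le> real k * H N0 / N" using key True by simp
    also have "\<dots> < min (1/2) \<bar>L N0\<bar>"
    proof -
      have "real k * H N0 \<le> (real k + 1) * H N0" using Hpos[of N0] by simp
      also have "\<dots> < N * min (1/2) \<bar>L N0\<bar>" using Nbig pos by (simp add: divide_less_eq)
      finally show ?thesis using Npos by (subst divide_less_eq) (simp add: mult.commute)
    qed
    finally show False by simp
  next
    case False
    hence n1': "n1 - 1 \<ge> N0" "n1 - 1 < n1" using n1(1) by auto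
    define n' where "n' = real n1 - 1"
    have n': "real (n1 - 1) = n'" using n1' by (simp add: n'_def of_nat_diff)
    define E where "E = (a - \<epsilon>) * n' ^ 2"
    define F where "F = (a + \<epsilon>) * real n1 ^ 2"
    \<comment> \<open>Minimality of \<open>n1\<close> bounds y from below through
      \<open>L (n1 - 1)\<close>, Dirichlet bounds it from above by N^k, and \<open>key\<close>
      bounds N; eliminating y and N leaves a quadratic in \<open>n1\<close> that \<open>ev1\<close>
      excludes. The shift to n1 - 1 costs only linear terms.\<close>
    have yE: "y \<ge> 1/2 * exp E"
    proof -
      have "1/2 \<le> y * \<bar>L (n1 - 1)\<bar>" using n1_min n1' by blast
      also have "\<dots> \<le> y * exp (- E)" using L_up[OF n1'(1)] y1 unfolding n' E_def mult_minus_left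
        by (intro mult_left_mono) linarith+
      finally show ?thesis by (simp add: exp_minus field_simps)
    qed
    have "n' ^ 2 \<le> real n1 ^ 2" using n1' unfolding n'_def by (intro power_mono) auto
    hence "(a - \<epsilon>) * n' ^ 2 \<le> (a - \<epsilon>) * real n1 ^ 2" using aeps by (intro mult_left_mono) auto
    also have "\<dots> \<le> F" unfolding F_def using eps by (intro mult_right_mono) auto
    finally have EF: "E \<le> F" by (simp add: E_def)
    have "1/2 * exp (E - F) \<le> min (1/2) (y * \<bar>L n1\<bar>)"
    proof (rule min.boundedI)
      show "1/2 * exp (E - F) \<le> 1/2" using EF by simp
      have "1/2 * exp (E - F) = (1/2 * exp E) * exp (- F)" by (simp add: exp_diff exp_minus field_simps)
      also have "\<dots> \<le> y * \<bar>L n1\<bar>" using yE L_lo[OF n1(1)] y1 unfolding F_def mult_minus_left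
        by (intro mult_mono) (linarith | simp)+
      finally show "1/2 * exp (E - F) \<le> y * \<bar>L n1\<bar>" .
    qed
    also have "\<dots> \<le> real k * H n1 / N" by (rule key)
    also have "\<dots> \<le> (real k + 1) * exp ((b + \<epsilon>) * real n1 ^ 2) / N"
      using H_up[OF n1(1)] Hpos[of n1] by (intro divide_right_mono mult_mono) auto
    finally have "real N \<le> 2 * (real k + 1) * exp ((b + \<epsilon>) * real n1 ^ 2 + F - E)"
      using Npos by (simp add: exp_diff exp_add field_simps)
    hence "ln (real N) \<le> ln (2 * (real k + 1) * exp ((b + \<epsilon>) * real n1 ^ 2 + F - E))"
      using Npos by (subst ln_le_cancel_iff) auto
    also have "\<dots> = ln (2 * (real k + 1)) + ((b + \<epsilon>) * real n1 ^ 2 + F - E)"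
      by (subst ln_mult) (auto intro!: add_pos_nonneg)
    finally have lnN: "ln (real N) \<le> ln (2 * (real k + 1)) + ((b + \<epsilon>) * real n1 ^ 2 + F - E)" .
    have "exp E \<le> 2 * real N ^ k" using yE yN by simp
    hence "ln (exp E) \<le> ln (2 * real N ^ k)" using Npos by (subst ln_le_cancel_iff) auto
    hence "E \<le> ln 2 + k * ln N" using Npos by (simp add: ln_mult ln_realpow)
    also have "\<dots> \<le> ln 2 + k * (ln (2 * (real k + 1)) + ((b + \<epsilon>) * real n1 ^ 2 + F - E))"
      using lnN by (intro add_left_mono mult_left_mono) auto
    finally have "E * (1 + k) - k * ((b + \<epsilon>) * real n1 ^ 2 + F) \<le> K" unfolding K_def by (simp add: algebra_simps)
    moreover have "E * (1 + k) - k * ((b + \<epsilon>) * real n1 ^ 2 + F) = \<delta> * real n1 ^ 2 - 2 * c1 * real n1 + c1"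
      unfolding E_def F_def n'_def \<delta>_def c1_def c2_def by (simp add: algebra_simps power2_eq_square)
    ultimately show False using N0[OF n1(1)] by linarith
  qed
qed

section \<open>Rational bases and dimension\<close>

lemma of_rat_complex_of_real: "(of_rat r :: complex) = complex_of_real (of_rat r)"
  by (cases r) (auto simp: of_rat_rat)

lemma common_denominator:
  fixes r :: "'a \<Rightarrow> rat"
  assumes "finite I"
  obtains M :: int where "M > 0" "\<And>i. i \<in> I \<Longrightarrow> \<exists>k::int. real_of_int M * of_rat (r i) = of_int k"
proof -
  have "\<exists>M::int. M > 0 \<and> (\<forall>i\<in>I. \<exists>k::int. real_of_int M * of_rat (r i) = of_int k)"
    using assms
  proof (induction I rule: finite_induct)
    case (insert x F)
    then obtain M :: int where M: "M > 0" "\<forall>i\<in>F. \<exists>k::int. real_of_int M * of_rat (r i) = of_int k" by blast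
    obtain u v :: int where "quotient_of (r x) = (u, v)" by fastforce
    hence uv: "r x = of_int u / of_int v" "v > 0"
      using quotient_of_div quotient_of_denom_pos by blast+
    show ?case
    proof (rule exI[of _ "M * v"], intro conjI ballI)
      fix i assume "i \<in> insert x F"
      then consider "i = x" | "i \<in> F" by auto
      thus "\<exists>k. real_of_int (M * v) * of_rat (r i) = of_int k"
      proof cases
        case 1
        show ?thesis using uv 1 by (intro exI[of _ "M * u"]) (simp add: of_rat_divide)
      next
        case 2
        then obtain k where k: "real_of_int M * of_rat (r i) = of_int k" using M by blast
        hence "real_of_int (M * v) * of_rat (r i) = of_int (k * v)"
          by (simp add: mult.commute mult.left_commute)
        thus ?thesis by blast
      qed
    qed (use M uv in auto)
  qed (auto intro: exI[of _ 1])
  thus ?thesis using that by blast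
qed

text \<open>Keeping 1 in the basis lets the integer constant term of a form absorb the coordinates
  along 1, so that only dim - 1 real numbers have to be approximated simultaneously.\<close>

lemma basis_containing_one:
  assumes "1 \<in> S"
  obtains Bs where "1 \<in> Bs" "Bs \<subseteq> S" "S \<subseteq> Q.span Bs" "Q.dim (Q.span S) = card Bs"
proof -
  have "Q.independent {1::complex}" using Q.dependent_single[of "1::complex"] by simp
  then obtain Bs where Bs: "{1} \<subseteq> Bs" "Bs \<subseteq> S" "Q.independent Bs" "S \<subseteq> Q.span Bs"
    using Q.maximal_independent_subset_extend[of "{1}" S] assms by auto
  have "Q.span Bs = Q.span S"
  proof (rule subset_antisym)
    show "Q.span Bs \<subseteq> Q.span S" using Bs(2) by (rule Q.span_mono)
    show "Q.span S \<subseteq> Q.span Bs" using Q.span_mono[OF Bs(4)] unfolding Q.span_span .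
  qed
  hence "Q.dim (Q.span S) = card Bs"
    using Q.dim_eq_card[OF _ Bs(3), of "Q.span S"] by (simp add: Q.span_span)
  thus ?thesis using Bs by (intro that[of Bs]) auto
qed

text \<open>Expressing the numbers in a rational basis that contains 1 and clearing denominators
  turns the forms into integer forms in the other basis elements. The denominator \<open>M\<close>
  and the coordinates \<open>R\<close> do not depend on n, so both rates survive.\<close>

lemma dim_lower_bound:
  fixes x :: "'i \<Rightarrow> real" and B :: "nat \<Rightarrow> 'i \<Rightarrow> int" and Bz :: "nat \<Rightarrow> int"
    and H :: "nat \<Rightarrow> real" and T :: "'i set"
  defines "L \<equiv> \<lambda>n. of_int (Bz n) + (\<Sum>t\<in>T. of_int (B n t) * x t)"
  assumes T: "finite T" and a: "a > 0" and b: "b > 0"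
    and Lnz: "\<forall>\<^sub>F n in sequentially. L n \<noteq> 0"
    and Llim: "(\<lambda>n. ln \<bar>L n\<bar> / real n ^ 2) \<longlonglongrightarrow> - a"
    and Hpos: "\<And>n. H n > 0"
    and Hlim: "(\<lambda>n. ln (H n) / real n ^ 2) \<longlonglongrightarrow> b"
    and BH: "\<forall>\<^sub>F n in sequentially. \<forall>t\<in>T. \<bar>of_int (B n t)\<bar> \<le> H n"
  shows "1 + a / b \<le> real (Q.dim (Q.span ({1} \<union> (\<lambda>t. complex_of_real (x t)) ` T)))"
proof -
  define S where "S = {1} \<union> (\<lambda>t. complex_of_real (x t)) ` T"
  have finS: "finite S" using T by (simp add: S_def)
  obtain Bs where Bs: "1 \<in> Bs" "Bs \<subseteq> S" "S \<subseteq> Q.span Bs" and dim: "Q.dim (Q.span S) = card Bs"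
    by (rule basis_containing_one[of S]) (simp add: S_def)
  have finB: "finite Bs" using finS Bs(2) finite_subset by blast
  define k where "k = card (Bs - {1})"
  have cardB: "card Bs = Suc k" using Bs(1) finB unfolding k_def
    by (metis card_Suc_Diff1)
  obtain \<eta> where \<eta>: "bij_betw \<eta> {..<k} (Bs - {1})"
    using ex_bij_betw_nat_finite[of "Bs - {1}"] finB unfolding k_def lessThan_atLeast0 by auto
  define \<theta> where "\<theta> i = Re (\<eta> i)" for i
  have real_B: "v = complex_of_real (Re v)" if "v \<in> Bs" for v
    using that Bs(2) unfolding S_def by auto
  have "\<exists>u. complex_of_real (x t) = (\<Sum>v\<in>Bs. scaleQ (u v) v)" if "t \<in> T" for t
  proof -
    have "complex_of_real (x t) \<in> Q.span Bs" using that Bs(3) by (auto simp: S_def)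
    thus ?thesis unfolding Q.span_finite[OF finB] by auto
  qed
  then obtain u where u: "\<And>t. t \<in> T \<Longrightarrow> complex_of_real (x t) = (\<Sum>v\<in>Bs. scaleQ (u t v) v)" by metis
  have xt: "x t = of_rat (u t 1) + (\<Sum>i<k. of_rat (u t (\<eta> i)) * \<theta> i)" if "t \<in> T" for t
  proof -
    have "x t = (\<Sum>v\<in>Bs. of_rat (u t v) * Re v)"
    proof -
      have "x t = Re (\<Sum>v\<in>Bs. scaleQ (u t v) v)" using u[OF that] by (metis Re_complex_of_real)
      also have "\<dots> = (\<Sum>v\<in>Bs. of_rat (u t v) * Re v)"
        by (simp add: scaleQ_def of_rat_complex_of_real)
      finally show ?thesis .
    qed
    also have "\<dots> = of_rat (u t 1) * Re 1 + (\<Sum>v\<in>Bs - {1}. of_rat (u t v) * Re v)"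
      using Bs(1) finB by (subst sum.remove[of _ 1]) auto
    also have "(\<Sum>v\<in>Bs - {1}. of_rat (u t v) * Re v) = (\<Sum>i<k. of_rat (u t (\<eta> i)) * \<theta> i)"
      unfolding \<theta>_def by (rule sum.reindex_bij_betw[OF \<eta>, symmetric])
    finally show ?thesis by simp
  qed
  obtain M :: int where M: "M > 0"
    "\<And>tv. tv \<in> T \<times> Bs \<Longrightarrow> \<exists>k::int. real_of_int M * of_rat (case_prod u tv) = of_int k"
    using common_denominator[of "T \<times> Bs" "case_prod u"] T finB by auto
  have "\<exists>R::int. real_of_int M * of_rat (u t v) = of_int R" if "t \<in> T" "v \<in> Bs" for t v
    using M(2)[of "(t, v)"] that by auto
  then obtain R where R: "\<And>t v. t \<in> T \<Longrightarrow> v \<in> Bs \<Longrightarrow> real_of_int M * of_rat (u t v) = of_int (R t v)"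
    by metis
  have \<eta>B: "\<eta> i \<in> Bs" if "i < k" for i using \<eta> that by (auto simp: bij_betw_def)
  define P where "P n i = (\<Sum>t\<in>T. B n t * R t (\<eta> i))" for n i
  define Pz where "Pz n = M * Bz n + (\<Sum>t\<in>T. B n t * R t 1)" for n
  have L': "of_int (Pz n) + (\<Sum>i<k. of_int (P n i) * \<theta> i) = of_int M * L n" for n
  proof -
    have "of_int M * L n = of_int M * of_int (Bz n) + (\<Sum>t\<in>T. of_int (B n t) * (of_int M * x t))"
      unfolding L_def by (simp add: algebra_simps sum_distrib_left)
    also have "(\<Sum>t\<in>T. of_int (B n t) * (of_int M * x t)) =
       (\<Sum>t\<in>T. of_int (B n t) * (of_int (R t 1) + (\<Sum>i<k. of_int (R t (\<eta> i)) * \<theta> i)))"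
    proof (intro sum.cong refl)
      fix t assume t: "t \<in> T"
      have "of_int M * x t = of_int M * of_rat (u t 1) + (\<Sum>i<k. (of_int M * of_rat (u t (\<eta> i))) * \<theta> i)"
        using xt[OF t] by (simp add: algebra_simps sum_distrib_left)
      also have "\<dots> = of_int (R t 1) + (\<Sum>i<k. of_int (R t (\<eta> i)) * \<theta> i)"
        using R[OF t] \<eta>B Bs(1) by simp
      finally show "of_int (B n t) * (of_int M * x t) = of_int (B n t) * (of_int (R t 1) + (\<Sum>i<k. of_int (R t (\<eta> i)) * \<theta> i))" by simp
    qed
    also have "\<dots> = (\<Sum>t\<in>T. of_int (B n t) * of_int (R t 1)) + (\<Sum>t\<in>T. \<Sum>i<k. of_int (B n t) * of_int (R t (\<eta> i)) * \<theta> i)"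
      by (simp add: algebra_simps sum.distrib sum_distrib_left)
    also have "(\<Sum>t\<in>T. \<Sum>i<k. of_int (B n t) * of_int (R t (\<eta> i)) * \<theta> i) = (\<Sum>i<k. of_int (P n i) * \<theta> i)"
      unfolding P_def by (subst sum.swap) (simp add: sum_distrib_right)
    finally show ?thesis by (simp add: Pz_def)
  qed
  \<comment> \<open>The summand 1 keeps the factor positive even if all coordinates vanish, so that
    its logarithm can be split off.\<close>
  define C where "C = 1 + (\<Sum>t\<in>T. \<Sum>v\<in>Bs. \<bar>real_of_int (R t v)\<bar>)"
  have C: "C \<ge> 1" unfolding C_def by (simp add: sum_nonneg)
  have inv: "(\<lambda>n::nat. c / real n ^ 2) \<longlonglongrightarrow> 0" for c by real_asymp
  have "a \<le> real k * b"
  proof (rule linear_forms_lower_bound[where Pz = Pz and P = P and \<theta> = \<theta> and H = "\<lambda>n. C * H n"])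
    show "\<forall>\<^sub>F n in sequentially. of_int (Pz n) + (\<Sum>i<k. of_int (P n i) * \<theta> i) \<noteq> 0"
      unfolding L' using Lnz M(1) by simp
    have "(\<lambda>n. ln (of_int M) / real n ^ 2 + ln \<bar>L n\<bar> / real n ^ 2) \<longlonglongrightarrow> 0 + -a"
      by (intro tendsto_add inv Llim)
    also have "?this \<longleftrightarrow> (\<lambda>n. ln \<bar>of_int (Pz n) + (\<Sum>i<k. of_int (P n i) * \<theta> i)\<bar> / real n ^ 2) \<longlonglongrightarrow> 0 + -a"
      unfolding L' using Lnz M(1)
      by (intro tendsto_cong, elim eventually_mono) (simp add: abs_mult ln_mult add_divide_distrib)
    finally show "(\<lambda>n. ln \<bar>of_int (Pz n) + (\<Sum>i<k. of_int (P n i) * \<theta> i)\<bar> / real n ^ 2) \<longlonglongrightarrow> -a" by simp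
    show "\<And>n. C * H n > 0" using C Hpos by simp
    have "(\<lambda>n. ln C / real n ^ 2 + ln (H n) / real n ^ 2) \<longlonglongrightarrow> 0 + b"
      by (intro tendsto_add inv Hlim)
    also have "(\<lambda>n. ln C / real n ^ 2 + ln (H n) / real n ^ 2) = (\<lambda>n. ln (C * H n) / real n ^ 2)"
      using C Hpos by (subst ln_mult_pos) (auto simp: add_divide_distrib)
    finally show "(\<lambda>n. ln (C * H n) / real n ^ 2) \<longlonglongrightarrow> b" by simp
    show "\<forall>\<^sub>F n in sequentially. \<forall>i<k. \<bar>of_int (P n i)\<bar> \<le> C * H n"
      using BH
    proof (eventually_elim, safe)
      fix n i assume B: "\<forall>t\<in>T. \<bar>real_of_int (B n t)\<bar> \<le> H n" and i: "i < k"
      have "\<bar>real_of_int (P n i)\<bar> \<le> (\<Sum>t\<in>T. \<bar>real_of_int (B n t)\<bar> * \<bar>real_of_int (R t (\<eta> i))\<bar>)"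
        unfolding P_def by (simp flip: abs_mult)
      also have "\<dots> \<le> (\<Sum>t\<in>T. H n * (\<Sum>v\<in>Bs. \<bar>real_of_int (R t v)\<bar>))"
        using B Hpos[of n] finB \<eta>B[OF i]
        by (intro sum_mono mult_mono member_le_sum) auto
      also have "\<dots> \<le> C * H n"
        unfolding C_def sum_distrib_left[symmetric] using Hpos[of n] by (simp add: mult.commute)
      finally show "\<bar>real_of_int (P n i)\<bar> \<le> C * H n" .
    qed
  qed (use a b in auto)
  hence "a / b \<le> real k" using b by (simp add: divide_le_eq)
  thus ?thesis unfolding S_def[symmetric] dim cardB by simp
qed

section \<open>Sums over divisors\<close>

lemma real_div_nat_le: "real (N div k) \<le> real N / real k"
  using floor_divide_of_nat_eq[of N k, where 'a = real] of_int_floor_le[of "real N / real k"] by simp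

lemma real_div_nat_ge: "real N / real k - 1 \<le> real (N div k)"
  using floor_divide_of_nat_eq[of N k, where 'a = real] floor_correct[of "real N / real k"] by simp

text \<open>
  Isolating the term \<open>k = 1\<close> bounds \<open>\<bar>g N\<bar>\<close> by \<open>\<sigma>\<close> times an earlier bound on \<open>g\<close>, up to
  \<open>o(N\<^sup>2)\<close>; iterating this replaces Moebius inversion.
\<close>

lemma quadratic_contraction:
  fixes g :: "nat \<Rightarrow> real" and K :: "nat set" and \<sigma> C :: real
  assumes K: "1 \<in> K" and \<sigma>: "0 \<le> \<sigma>" "\<sigma> < 1"
    and \<sigma>_sum: "\<And>N. (\<Sum>k\<in>K \<inter> {2..N}. 1 / real k ^ 2) \<le> \<sigma>"
    and C: "\<And>N. \<bar>g N\<bar> \<le> C * real N ^ 2"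
    and lim: "(\<lambda>N. (\<Sum>k\<in>K \<inter> {1..N}. g (N div k)) / real N ^ 2) \<longlonglongrightarrow> 0"
  shows "(\<lambda>N. g N / real N ^ 2) \<longlonglongrightarrow> 0"
proof -
  have C0: "C \<ge> 0" using C[of 1] by simp
  have step: "\<forall>\<^sub>F N in sequentially. \<bar>g N\<bar> \<le> (\<sigma> * \<theta> + \<eta>) * real N ^ 2"
    if \<theta>: "\<theta> \<ge> 0" and \<eta>: "\<eta> > 0" and ev: "\<forall>\<^sub>F N in sequentially. \<bar>g N\<bar> \<le> \<theta> * real N ^ 2" for \<theta> \<eta>
  proof -
    obtain M0 where M0: "\<And>N. N \<ge> M0 \<Longrightarrow> \<bar>g N\<bar> \<le> \<theta> * real N ^ 2"
      using ev by (auto simp: eventually_sequentially)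
    \<comment> \<open>Where \<open>N div k\<close> is below \<open>M0\<close> only the a priori
      bound is available. It costs a constant for each k, hence O(N) in total, which is negligible
      against N^2.\<close>
    have each: "\<bar>g (N div k)\<bar> \<le> \<theta> * real N ^ 2 * (1 / real k ^ 2) + C * real M0 ^ 2" if "k > 0" for N k
    proof (cases "N div k \<ge> M0")
      case True
      have "\<bar>g (N div k)\<bar> \<le> \<theta> * real (N div k) ^ 2" using M0[OF True] .
      also have "\<dots> \<le> \<theta> * (real N / real k) ^ 2"
        using \<theta> by (intro mult_left_mono power_mono real_div_nat_le) auto
      also have "\<dots> = \<theta> * real N ^ 2 * (1 / real k ^ 2)" by (simp add: power_divide)
      also have "\<dots> \<le> \<dots> + C * real M0 ^ 2" using C0 by simp
      finally show ?thesis .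
    next
      case False
      have "\<bar>g (N div k)\<bar> \<le> C * real (N div k) ^ 2" using C .
      also have "\<dots> \<le> C * real M0 ^ 2" using False C0 by (intro mult_left_mono power_mono) auto
      also have "\<dots> \<le> \<theta> * real N ^ 2 * (1 / real k ^ 2) + C * real M0 ^ 2" using \<theta> by simp
      finally show ?thesis .
    qed
    have bnd: "\<bar>g N\<bar> \<le> \<bar>\<Sum>k\<in>K \<inter> {1..N}. g (N div k)\<bar> + \<sigma> * \<theta> * real N ^ 2 + C * real M0 ^ 2 * real N"
      if "N > 0" for N
    proof -
      have KN: "K \<inter> {1..N} = insert 1 (K \<inter> {2..N})" using K that by auto
      have "(\<Sum>k\<in>K \<inter> {1..N}. g (N div k)) = g N + (\<Sum>k\<in>K \<inter> {2..N}. g (N div k))"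
        unfolding KN by simp
      hence "\<bar>g N\<bar> \<le> \<bar>\<Sum>k\<in>K \<inter> {1..N}. g (N div k)\<bar> + \<bar>\<Sum>k\<in>K \<inter> {2..N}. g (N div k)\<bar>" by linarith
      also have "\<bar>\<Sum>k\<in>K \<inter> {2..N}. g (N div k)\<bar> \<le> (\<Sum>k\<in>K \<inter> {2..N}. \<bar>g (N div k)\<bar>)" by (rule sum_abs)
      also have "\<dots> \<le> (\<Sum>k\<in>K \<inter> {2..N}. \<theta> * real N ^ 2 * (1 / real k ^ 2) + C * real M0 ^ 2)"
        by (intro sum_mono each) auto
      also have "\<dots> = \<theta> * real N ^ 2 * (\<Sum>k\<in>K \<inter> {2..N}. 1 / real k ^ 2) + card (K \<inter> {2..N}) * (C * real M0 ^ 2)"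
        by (simp add: sum.distrib sum_distrib_left)
      also have "\<dots> \<le> \<theta> * real N ^ 2 * \<sigma> + real N * (C * real M0 ^ 2)"
      proof (intro add_mono mult_left_mono mult_right_mono)
        have "card (K \<inter> {2..N}) \<le> card {2..N}" by (intro card_mono) auto
        thus "real (card (K \<inter> {2..N})) \<le> real N" by simp
      qed (use \<theta> C0 \<sigma>_sum in auto)
      finally show ?thesis by (simp add: algebra_simps)
    qed
    have "(\<lambda>N. \<bar>(\<Sum>k\<in>K \<inter> {1..N}. g (N div k)) / real N ^ 2\<bar> + C * real M0 ^ 2 / real N) \<longlonglongrightarrow> \<bar>0\<bar> + 0"
      by (intro tendsto_add tendsto_rabs lim real_tendsto_divide_at_top[OF tendsto_const] filterlim_real_sequentially)
    hence "\<forall>\<^sub>F N in sequentially. \<bar>(\<Sum>k\<in>K \<inter> {1..N}. g (N div k)) / real N ^ 2\<bar> + C * real M0 ^ 2 / real N < \<eta>"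
      using \<eta> by (intro order_tendstoD(2)) auto
    thus ?thesis using eventually_gt_at_top[of 0]
    proof eventually_elim
      case (elim N)
      have "\<bar>\<Sum>k\<in>K \<inter> {1..N}. g (N div k)\<bar> + C * real M0 ^ 2 * real N =
         real N ^ 2 * (\<bar>(\<Sum>k\<in>K \<inter> {1..N}. g (N div k)) / real N ^ 2\<bar> + C * real M0 ^ 2 / real N)"
        using elim(2) by (simp add: field_simps power2_eq_square)
      also have "\<dots> \<le> real N ^ 2 * \<eta>" using elim by (intro mult_left_mono) auto
      finally show ?case using bnd[OF elim(2)] by (simp add: algebra_simps)
    qed
  qed
  \<comment> \<open>The slack (1 - \<sigma>) \<epsilon> / 2 granted to each application of
    \<open>step\<close> makes \<epsilon> / 2 a fixed point: the additive error does not grow while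
    \<sigma>^i C tends to 0.\<close>
  have iter: "\<forall>\<^sub>F N in sequentially. \<bar>g N\<bar> \<le> (\<sigma> ^ i * C + \<epsilon> / 2) * real N ^ 2" if "\<epsilon> > 0" for \<epsilon> i
  proof (induction i)
    case 0
    have "\<bar>g N\<bar> \<le> (\<sigma> ^ 0 * C + \<epsilon> / 2) * real N ^ 2" for N
    proof -
      have "C * real N ^ 2 \<le> (\<sigma> ^ 0 * C + \<epsilon> / 2) * real N ^ 2"
        using that by (intro mult_right_mono) auto
      thus ?thesis using C[of N] by linarith
    qed
    thus ?case by simp
  next
    case (Suc i)
    have "\<forall>\<^sub>F N in sequentially. \<bar>g N\<bar> \<le> (\<sigma> * (\<sigma> ^ i * C + \<epsilon> / 2) + (1 - \<sigma>) * \<epsilon> / 2) * real N ^ 2"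
      using that \<sigma> C0 by (intro step Suc.IH) auto
    also have "\<sigma> * (\<sigma> ^ i * C + \<epsilon> / 2) + (1 - \<sigma>) * \<epsilon> / 2 = \<sigma> ^ Suc i * C + \<epsilon> / 2"
      by (simp add: field_simps)
    finally show ?case .
  qed
  show ?thesis
  proof (rule LIMSEQ_I, goal_cases)
    case (1 \<epsilon>)
    have "(\<lambda>i. \<sigma> ^ i * C) \<longlonglongrightarrow> 0 * C" using \<sigma> by (intro tendsto_intros LIMSEQ_power_zero) auto
    hence "\<forall>\<^sub>F i in sequentially. \<sigma> ^ i * C < \<epsilon> / 2" using 1 by (intro order_tendstoD(2)) auto
    then obtain i where i: "\<sigma> ^ i * C < \<epsilon> / 2" by (auto simp: eventually_sequentially)
    from iter[OF 1, of i] eventually_gt_at_top[of 0]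
    have "\<forall>\<^sub>F N in sequentially. norm (g N / real N ^ 2 - 0) < \<epsilon>"
    proof eventually_elim
      case (elim N)
      have "\<bar>g N\<bar> / real N ^ 2 \<le> \<sigma> ^ i * C + \<epsilon> / 2" using elim by (simp add: divide_le_eq)
      thus ?case using i by simp
    qed
    thus ?case by (simp add: eventually_sequentially)
  qed
qed

text \<open>For k > 0 the quotient (N div k)^2 / N^2 tends to 1 / k^2 and is dominated by it, so
  Tannery's theorem exchanges limit and sum.\<close>

lemma sum_floor_squares:
  fixes K :: "nat set" and Z :: real
  assumes Z: "(\<lambda>k. if k \<in> K then 1 / real k ^ 2 else 0) sums Z"
  shows "(\<lambda>N. (\<Sum>k\<in>K \<inter> {1..N}. real (N div k) ^ 2) / real N ^ 2) \<longlonglongrightarrow> Z"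
proof -
  define M where "M k = (if k \<in> K then 1 / real k ^ 2 else 0)" for k
  define a where "a k N = (if k \<in> K then real (N div k) ^ 2 / real N ^ 2 else 0)" for k N
  have aM: "\<bar>a k N\<bar> \<le> M k" for k N
  proof (cases "k = 0 \<or> N = 0")
    case False
    have "real (N div k) ^ 2 \<le> (real N / real k) ^ 2" by (intro power_mono) (auto simp: real_div_nat_le)
    thus ?thesis using False by (simp add: a_def M_def field_simps)
  qed (auto simp: a_def M_def)
  have "(\<lambda>N. a k N) \<longlonglongrightarrow> M k" for k
  proof (cases "k \<in> K \<and> k > 0")
    case True
    have "(\<lambda>N. real (N div k) / real N) \<longlonglongrightarrow> 1 / real k"
    proof (rule tendsto_sandwich[of "\<lambda>N. 1 / real k - 1 / real N" _ _ "\<lambda>N. 1 / real k"])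
      show "\<forall>\<^sub>F N in sequentially. 1 / real k - 1 / real N \<le> real (N div k) / real N"
        using eventually_gt_at_top[of 0]
      proof eventually_elim
        case (elim N)
        have "real N / real k - 1 \<le> real (N div k)" by (rule real_div_nat_ge)
        hence "(real N / real k - 1) / real N \<le> real (N div k) / real N" by (intro divide_right_mono) auto
        thus ?case using elim by (simp add: diff_divide_distrib)
      qed
      show "\<forall>\<^sub>F N in sequentially. real (N div k) / real N \<le> 1 / real k"
        using eventually_gt_at_top[of 0]
      proof eventually_elim
        case (elim N)
        have "real (N div k) / real N \<le> (real N / real k) / real N"
          by (intro divide_right_mono real_div_nat_le) auto
        thus ?case using elim by simp
      qed
      have "(\<lambda>N. 1 / real k - 1 / real N) \<longlonglongrightarrow> 1 / real k - 0"
        by (intro tendsto_diff tendsto_const lim_1_over_n)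
      thus "(\<lambda>N. 1 / real k - 1 / real N) \<longlonglongrightarrow> 1 / real k" by simp
    qed auto
    from tendsto_power[OF this, of 2] show ?thesis using True by (simp add: a_def M_def power_divide)
  qed (auto simp: a_def M_def)
  hence "eventually (\<lambda>N. summable (\<lambda>k. norm (a k N))) sequentially \<and> summable (\<lambda>k. norm (M k)) \<and>
      (\<lambda>N. suminf (\<lambda>k. a k N)) \<longlonglongrightarrow> suminf M"
    using Z unfolding M_def[symmetric]
    by (intro tannerys_theorem[where M = M]) (auto simp: aM sums_iff case_prod_unfold)
  hence "(\<lambda>N. suminf (\<lambda>k. a k N)) \<longlonglongrightarrow> suminf M" by blast
  also have "suminf M = Z" using Z unfolding M_def[symmetric] by (simp add: sums_iff)
  also have "(\<lambda>N. suminf (\<lambda>k. a k N)) = (\<lambda>N. (\<Sum>k\<in>K \<inter> {1..N}. real (N div k) ^ 2) / real N ^ 2)"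
  proof
    fix N
    have "suminf (\<lambda>k. a k N) = (\<Sum>k\<in>K \<inter> {1..N}. a k N)"
      by (rule suminf_finite) (auto simp: a_def Suc_le_eq)
    also have "\<dots> = (\<Sum>k\<in>K \<inter> {1..N}. real (N div k) ^ 2) / real N ^ 2"
      by (simp add: a_def sum_divide_distrib)
    finally show "suminf (\<lambda>k. a k N) = (\<Sum>k\<in>K \<inter> {1..N}. real (N div k) ^ 2) / real N ^ 2" .
  qed
  finally show ?thesis .
qed

text \<open>Write m = k d: since \<open>K\<close> is closed under products and divisors, the sum of
  \<open>l m\<close> over m in \<open>K\<close> up to N equals the sum of \<Psi> (N div k) over k in
  \<open>K\<close>. The same sum for s / Z times N^2 is asymptotically s N^2, so the difference
  \<open>g\<close> satisfies the hypotheses of \<open>quadratic_contraction\<close> with \<sigma> =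
  Z - 1; hence the condition Z < 2.\<close>

lemma divisor_sum_inversion_asymp:
  fixes K :: "nat set" and L l :: "nat \<Rightarrow> real" and Z s :: real
  assumes K: "1 \<in> K" "0 \<notin> K" and Kmult: "\<And>a b. a * b \<in> K \<longleftrightarrow> a \<in> K \<and> b \<in> K"
    and L: "\<And>d. L d \<ge> 0" and Ll: "\<And>m. m > 0 \<Longrightarrow> (\<Sum>d | d dvd m. L d) = l m"
    and lim: "(\<lambda>N. (\<Sum>m\<in>K \<inter> {1..N}. l m) / real N ^ 2) \<longlonglongrightarrow> s"
    and Z: "(\<lambda>k. if k \<in> K then 1 / real k ^ 2 else 0) sums Z" "Z < 2"
  shows "(\<lambda>N. (\<Sum>d\<in>K \<inter> {1..N}. L d) / real N ^ 2) \<longlonglongrightarrow> s / Z"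
proof -
  define \<Psi> where "\<Psi> N = (\<Sum>d\<in>K \<inter> {1..N}. L d)" for N
  define g where "g N = \<Psi> N - s / Z * real N ^ 2" for N
  have \<Psi>_nonneg: "\<Psi> N \<ge> 0" for N unfolding \<Psi>_def by (intro sum_nonneg L)
  have sum\<Psi>: "(\<Sum>k\<in>K \<inter> {1..N}. \<Psi> (N div k)) = (\<Sum>m\<in>K \<inter> {1..N}. l m)" for N
  proof -
    have "(\<Sum>k\<in>K \<inter> {1..N}. \<Psi> (N div k)) = (\<Sum>(k,d)\<in>(SIGMA k:K \<inter> {1..N}. K \<inter> {1..N div k}). L d)"
      unfolding \<Psi>_def by (subst sum.Sigma) auto
    also have "\<dots> = (\<Sum>(m,d)\<in>(SIGMA m:K \<inter> {1..N}. {d. d dvd m}). L d)"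
    proof (rule sum.reindex_bij_witness[where i = "\<lambda>(m,d). (m div d, d)" and j = "\<lambda>(k,d). (k * d, d)"], goal_cases)
      case (1 a)
      thus ?case by (auto simp: Suc_le_eq)
    next
      case (2 a)
      then obtain k d where a: "a = (k, d)" "k \<in> K" "k \<ge> 1" "k \<le> N" "d \<in> K" "1 \<le> d" "d \<le> N div k" by auto
      have "k * d \<le> N" using a by (metis less_eq_div_iff_mult_less_eq mult.commute Suc_le_eq One_nat_def)
      thus ?case using a Kmult[of k d] by (auto simp: Suc_le_eq)
    next
      case (3 a)
      then obtain m d where a: "a = (m, d)" "m \<in> K" "m \<ge> 1" "m \<le> N" "d dvd m" by auto
      then obtain k where k: "m = k * d" by (metis dvdE mult.commute)
      thus ?case using a Kmult[of k d] by auto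
    next
      case (4 a)
      then obtain m d where a: "a = (m, d)" "m \<in> K" "m \<ge> 1" "m \<le> N" "d dvd m" by auto
      then obtain k where k: "m = k * d" by (metis dvdE mult.commute)
      have kd: "k \<ge> 1" "d \<ge> 1" using a k by (auto simp: Suc_le_eq)
      have "k \<le> N" using a k kd by (metis dual_order.trans dvd_imp_le dvd_triv_left less_eq_Suc_le One_nat_def)
      moreover have "d \<le> N div k" using a k kd by (simp add: less_eq_div_iff_mult_less_eq mult.commute)
      ultimately show ?case using a k kd Kmult[of k d] by auto
    qed auto
    also have "\<dots> = (\<Sum>m\<in>K \<inter> {1..N}. \<Sum>d | d dvd m. L d)"
      by (subst sum.Sigma) auto
    also have "\<dots> = (\<Sum>m\<in>K \<inter> {1..N}. l m)" by (intro sum.cong Ll) auto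
    finally show ?thesis .
  qed
  define w where "w k = (if k \<in> K then 1 / real k ^ 2 else 0)" for k
  have wZ: "w sums Z" using Z(1) by (simp add: w_def[abs_def])
  have w0: "w k \<ge> 0" for k by (simp add: w_def)
  have \<sigma>: "(\<Sum>k\<in>K \<inter> {2..N}. 1 / real k ^ 2) \<le> Z - 1" for N
  proof -
    have "(\<Sum>k\<in>insert 1 (K \<inter> {2..N}). w k) \<le> suminf w"
      using wZ w0 by (intro sum_le_suminf) (auto simp: sums_iff)
    also have "suminf w = Z" using wZ by (simp add: sums_iff)
    finally show ?thesis using K by (simp add: w_def)
  qed
  have Z1: "Z - 1 \<ge> 0" using \<sigma>[of 0] by simp
  have "Bseq (\<lambda>N. (\<Sum>m\<in>K \<inter> {1..N}. l m) / real N ^ 2)"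
    using lim by (intro convergent_imp_Bseq) (auto simp: convergent_def)
  then obtain C where C: "\<And>N. \<bar>(\<Sum>m\<in>K \<inter> {1..N}. l m) / real N ^ 2\<bar> \<le> C"
    by (auto simp: Bseq_def)
  have \<Psi>C: "\<Psi> N \<le> C * real N ^ 2" for N
  proof (cases "N = 0")
    case False
    have "\<Psi> N = \<Psi> (N div 1)" by simp
    also have "\<dots> \<le> (\<Sum>k\<in>K \<inter> {1..N}. \<Psi> (N div k))"
      using K False \<Psi>_nonneg by (intro member_le_sum[of 1 _ "\<lambda>k. \<Psi> (N div k)"]) auto
    also have "\<dots> = (\<Sum>m\<in>K \<inter> {1..N}. l m)" by (rule sum\<Psi>)
    also have "\<dots> \<le> C * real N ^ 2" using C[of N] False by (simp add: abs_le_iff divide_le_eq)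
    finally show ?thesis .
  qed (simp add: \<Psi>_def)
  have "(\<lambda>N. g N / real N ^ 2) \<longlonglongrightarrow> 0"
  proof (rule quadratic_contraction[where K = K and \<sigma> = "Z - 1" and C = "C + \<bar>s / Z\<bar>"])
    show "\<bar>g N\<bar> \<le> (C + \<bar>s / Z\<bar>) * real N ^ 2" for N
    proof -
      have "\<bar>g N\<bar> \<le> \<bar>\<Psi> N\<bar> + \<bar>s / Z * real N ^ 2\<bar>" unfolding g_def by (rule abs_triangle_ineq4)
      thus ?thesis using \<Psi>C[of N] \<Psi>_nonneg[of N] by (simp add: abs_mult distrib_right)
    qed
    have "(\<lambda>N. (\<Sum>m\<in>K \<inter> {1..N}. l m) / real N ^ 2 - s / Z * ((\<Sum>k\<in>K \<inter> {1..N}. real (N div k) ^ 2) / real N ^ 2))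
        \<longlonglongrightarrow> s - s / Z * Z"
      by (intro tendsto_intros lim sum_floor_squares Z)
    also have "(\<lambda>N. (\<Sum>m\<in>K \<inter> {1..N}. l m) / real N ^ 2 - s / Z * ((\<Sum>k\<in>K \<inter> {1..N}. real (N div k) ^ 2) / real N ^ 2))
       = (\<lambda>N. (\<Sum>k\<in>K \<inter> {1..N}. g (N div k)) / real N ^ 2)"
      unfolding sum\<Psi>[symmetric] g_def by (simp add: sum_subtractf sum_distrib_left diff_divide_distrib)
    also have "s - s / Z * Z = 0" using Z1 by simp
    finally show "(\<lambda>N. (\<Sum>k\<in>K \<inter> {1..N}. g (N div k)) / real N ^ 2) \<longlonglongrightarrow> 0" .
  qed (use K \<sigma> Z1 Z(2) in auto)
  hence "(\<lambda>N. g N / real N ^ 2 + s / Z) \<longlonglongrightarrow> 0 + s / Z" by (intro tendsto_intros)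
  also have "?this \<longleftrightarrow> ?thesis" unfolding \<Psi>_def[symmetric]
    by (simp only: add_0, intro tendsto_cong eventually_mono[OF eventually_gt_at_top[of 0]])
       (simp add: g_def field_simps)
  finally show ?thesis .
qed

lemma odd_inverse_squares_sums: "(\<lambda>k. if odd k then 1 / real k ^ 2 else 0) sums (pi ^ 2 / 8)"
proof -
  have all: "(\<lambda>k. 1 / real k ^ 2) sums (pi ^ 2 / 6)"
    using sums_Suc[of "\<lambda>k. 1 / real k ^ 2" "pi ^ 2 / 6"] inverse_squares_sums by (simp add: add.commute)
  have "(\<lambda>k. if even k then 1 / real k ^ 2 else 0) sums (pi ^ 2 / 6 / 4)"
  proof -
    have "(\<lambda>k. 1 / real k ^ 2 / 4) sums (pi ^ 2 / 6 / 4)" by (rule sums_divide[OF all])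
    hence "(\<lambda>k. if even (2 * k) then 1 / real (2 * k) ^ 2 else 0) sums (pi ^ 2 / 6 / 4)"
      by (simp add: power_mult_distrib mult.commute)
    thus ?thesis
      by (subst (asm) sums_mono_reindex[of "\<lambda>k. 2 * k" "\<lambda>k. if even k then 1 / real k ^ 2 else 0"])
         (auto simp: strict_mono_def elim!: evenE)
  qed
  from sums_diff[OF all this]
  have "(\<lambda>k. 1 / real k ^ 2 - (if even k then 1 / real k ^ 2 else 0)) sums (pi ^ 2 / 8)"
    by (simp add: field_simps)
  also have "(\<lambda>k. 1 / real k ^ 2 - (if even k then 1 / real k ^ 2 else 0)) = (\<lambda>k. if odd k then 1 / real k ^ 2 else 0)"
    by auto
  finally show ?thesis .
qed

section \<open>Primitive parts of powers minus one\<close>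

text \<open>Euclid's algorithm on the exponents: p^(m + k) - 1 is congruent to p^k - 1 modulo p^m -
  1.\<close>

lemma gcd_power_minus_one: "gcd (p ^ m - 1) (p ^ n - 1) = \<bar>p ^ gcd m n - 1\<bar>" for p :: int
proof (induction "m + n" arbitrary: m n rule: less_induct)
  case less
  have red: "gcd (p ^ m - 1) (p ^ (m + k) - 1) = gcd (p ^ m - 1) (p ^ k - 1)" for m k
  proof -
    have "p ^ (m + k) - 1 = p ^ k * (p ^ m - 1) + (p ^ k - 1)" by (simp add: power_add algebra_simps)
    thus ?thesis by (simp only: gcd_add_mult)
  qed
  consider "m = 0" | "n = 0" | "m > 0" "n > 0" "m \<le> n" | "m > 0" "n > 0" "n \<le> m" by linarith
  thus ?case
  proof cases
    case 3
    then obtain k where k: "n = m + k" using le_Suc_ex by blast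
    show ?thesis using less[of m k] 3 red[of m k] by (simp add: k)
  next
    case 4
    then obtain k where k: "m = n + k" using le_Suc_ex by blast
    show ?thesis using less[of n k] 4 red[of n k] by (simp add: k gcd.commute)
  qed auto
qed

lemma gcd_Lcm_image:
  fixes f :: "'a \<Rightarrow> nat"
  assumes "finite S"
  shows "gcd x (Lcm (f ` S)) = Lcm ((\<lambda>d. gcd x (f d)) ` S)"
  using assms by (induction S rule: finite_induct) (auto simp: gcd_lcm_distrib)

text \<open>Adjoin the elements of \<open>S\<close> in increasing order. By distributivity of gcd
  over Lcm and by \<open>gcd_b\<close>, the part of \<open>b m\<close> already contained in the Lcm
  of the earlier terms is the Lcm over the proper divisors of m, so the new Lcm gains exactly the
  factor \<open>\<Phi> m\<close>.\<close>

lemma prod_primitive_parts_eq_Lcm: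
  fixes b :: "nat \<Rightarrow> nat" and \<Phi> :: "nat \<Rightarrow> nat"
  assumes pos: "\<And>m. m > 0 \<Longrightarrow> b m > 0"
    and gcd_b: "\<And>m n. m > 0 \<Longrightarrow> n > 0 \<Longrightarrow> gcd (b m) (b n) = b (gcd m n)"
    and \<Phi>: "\<And>m. m > 0 \<Longrightarrow> \<Phi> m = b m div Lcm (b ` {d. d dvd m \<and> d < m})"
    and S: "finite S" "0 \<notin> S" "\<And>m d. m \<in> S \<Longrightarrow> d dvd m \<Longrightarrow> d \<in> S"
  shows "(\<Prod>d\<in>S. \<Phi> d) = Lcm (b ` S)"
  using S
proof (induction S rule: finite_linorder_max_induct)
  case (insert m S)
  have m: "m > 0" using insert.prems by auto
  have closed: "d \<in> S" if "x \<in> S" "d dvd x" for x d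
  proof -
    have "d \<in> insert m S" using that insert.prems by blast
    moreover have "x > 0" using that insert.prems(1) by (cases x) auto
    hence "d \<le> x" using that(2) by (intro dvd_imp_le)
    hence "d \<noteq> m" using insert.hyps that by auto
    ultimately show ?thesis by auto
  qed
  have IH: "(\<Prod>d\<in>S. \<Phi> d) = Lcm (b ` S)"
    using insert.IH insert.prems(1) closed by blast
  define D where "D = {d. d dvd m \<and> d < m}"
  have DS: "D \<subseteq> S" using insert.prems(2)[of m] by (auto simp: D_def)
  have "gcd (b m) (Lcm (b ` S)) = Lcm ((\<lambda>d. gcd (b m) (b d)) ` S)"
    by (rule gcd_Lcm_image[OF insert.hyps(1)])
  also have "(\<lambda>d. gcd (b m) (b d)) ` S = (\<lambda>d. b (gcd m d)) ` S"
    using insert.prems m by (intro image_cong refl gcd_b) (auto intro: gr0I)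
  also have "\<dots> = b ` D"
  proof (intro equalityI subsetI)
    fix x assume "x \<in> (\<lambda>d. b (gcd m d)) ` S"
    then obtain d where d: "d \<in> S" "x = b (gcd m d)" by auto
    have "d \<noteq> 0" using d insert.prems(1) by (cases d) auto
    hence "gcd m d \<le> d" by (rule gcd_le2_nat)
    hence "gcd m d < m" using d insert.hyps by auto
    thus "x \<in> b ` D" using d by (auto simp: D_def)
  next
    fix x assume "x \<in> b ` D"
    then obtain d where d: "d dvd m" "d < m" "x = b d" by (auto simp: D_def)
    hence "gcd m d = d" by (simp add: gcd_proj2_if_dvd)
    moreover have "d \<in> S" using d DS by (auto simp: D_def)
    ultimately show "x \<in> (\<lambda>d. b (gcd m d)) ` S" using d by force
  qed
  finally have gcd_eq: "gcd (b m) (Lcm (b ` S)) = Lcm (b ` D)" .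
  have "Lcm (b ` insert m S) = lcm (b m) (Lcm (b ` S))" by simp
  also have "\<dots> = b m * Lcm (b ` S) div gcd (b m) (Lcm (b ` S))" by (rule lcm_nat_def)
  also have "\<dots> = b m div gcd (b m) (Lcm (b ` S)) * Lcm (b ` S)"
    by (simp add: div_mult_swap mult.commute)
  also have "\<dots> = \<Phi> m * Lcm (b ` S)" using \<Phi>[OF m] by (simp add: gcd_eq D_def)
  finally have "Lcm (b ` insert m S) = \<Phi> m * Lcm (b ` S)" .
  moreover have "m \<notin> S" using insert.hyps by auto
  ultimately show ?case using insert.hyps IH by simp
qed simp

definition abs_pm1 :: "int \<Rightarrow> nat \<Rightarrow> nat" where
  "abs_pm1 p m = nat \<bar>p ^ m - 1\<bar>"

text \<open>
  For \<open>m > 1\<close> this is the absolute value at \<open>p\<close> of the cyclotomic polynomial of order \<open>m\<close>.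
  Dividing by a least common multiple makes it an integer without reference to that polynomial.
\<close>

definition prim_part :: "int \<Rightarrow> nat \<Rightarrow> nat" where
  "prim_part p m = abs_pm1 p m div Lcm (abs_pm1 p ` {d. d dvd m \<and> d < m})"

lemma abs_power_minus_one_bounds:
  fixes z :: real
  assumes "\<bar>z\<bar> \<ge> 2" "m > 0"
  shows "\<bar>z\<bar> ^ m / 2 \<le> \<bar>z ^ m - 1\<bar>" "\<bar>z ^ m - 1\<bar> \<le> 2 * \<bar>z\<bar> ^ m"
proof -
  have "2 \<le> \<bar>z\<bar> ^ 1" using assms by simp
  also have "\<bar>z\<bar> ^ 1 \<le> \<bar>z\<bar> ^ m" using assms by (intro power_increasing) auto
  finally have "2 \<le> \<bar>z ^ m\<bar>" by (simp add: power_abs)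
  thus "\<bar>z\<bar> ^ m / 2 \<le> \<bar>z ^ m - 1\<bar>" "\<bar>z ^ m - 1\<bar> \<le> 2 * \<bar>z\<bar> ^ m" unfolding power_abs[symmetric] by linarith+
qed

lemma real_abs_pm1: "real (abs_pm1 p m) = \<bar>real_of_int p ^ m - 1\<bar>"
  by (simp add: abs_pm1_def)

text \<open>Ensures the contraction condition Z < 2 for Z = pi^2 / 6 and for Z = pi^2 / 8.\<close>

lemma pi_sq_less: "pi ^ 2 < 12"
proof -
  have "pi * pi < 3.2 * 3.2" using pi_approx by (intro mult_strict_mono) auto
  thus ?thesis unfolding power2_eq_square by (rule order.strict_trans) simp
qed

lemma sum_odd_upto: "\<Sum>({k. odd k} \<inter> {1..N}) = ((N + 1) div 2) ^ 2" for N :: nat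
proof (induction N)
  case (Suc N)
  have *: "{k. odd k} \<inter> {1..Suc N} = (if odd (Suc N) then insert (Suc N) ({k. odd k} \<inter> {1..N}) else {k. odd k} \<inter> {1..N})"
    by (auto simp: le_Suc_eq)
  show ?case
  proof (cases "odd (Suc N)")
    case True
    then obtain j where "N = 2 * j" by auto
    thus ?thesis using Suc True unfolding * by (simp add: power2_eq_square)
  next
    case False
    then obtain j where "N = 2 * j + 1" by (auto elim!: oddE)
    thus ?thesis using Suc False unfolding * by (simp add: power2_eq_square)
  qed
qed simp

lemma sum_odd_upto_asymp: "(\<lambda>N. real (\<Sum>({d. odd d} \<inter> {1..N})) / real N ^ 2) \<longlonglongrightarrow> 1/4"
proof -
  define x where "x N = real ((N + 1) div 2)" for N
  have x: "real N \<le> 2 * x N" "2 * x N \<le> real N + 1" for N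
  proof -
    have "N \<le> 2 * ((N + 1) div 2)" "2 * ((N + 1) div 2) \<le> N + 1" by presburger+
    hence "real N \<le> real (2 * ((N + 1) div 2))" "real (2 * ((N + 1) div 2)) \<le> real (N + 1)"
      by (simp_all only: of_nat_le_iff)
    thus "real N \<le> 2 * x N" "2 * x N \<le> real N + 1" by (simp_all add: x_def)
  qed
  have lo: "real N ^ 2 / 4 \<le> x N ^ 2" for N
    using power_mono[OF x(1)[of N], of 2] by (simp add: power_mult_distrib)
  have up: "x N ^ 2 \<le> (real N + 1) ^ 2 / 4" for N
    using power_mono[OF x(2)[of N], of 2] x(1)[of N] by (simp add: power_mult_distrib)
  have "(\<lambda>N. x N ^ 2 / real N ^ 2) \<longlonglongrightarrow> 1/4"
  proof (rule tendsto_sandwich[of "\<lambda>N. real N ^ 2 / 4 / real N ^ 2" _ _ "\<lambda>N. (real N + 1) ^ 2 / 4 / real N ^ 2"])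
    show "\<forall>\<^sub>F N in sequentially. real N ^ 2 / 4 / real N ^ 2 \<le> x N ^ 2 / real N ^ 2"
      by (intro always_eventually allI divide_right_mono lo zero_le_power2)
    show "\<forall>\<^sub>F N in sequentially. x N ^ 2 / real N ^ 2 \<le> (real N + 1) ^ 2 / 4 / real N ^ 2"
      by (intro always_eventually allI divide_right_mono up zero_le_power2)
    show "(\<lambda>N. real N ^ 2 / 4 / real N ^ 2) \<longlonglongrightarrow> 1/4" by real_asymp
    show "(\<lambda>N. (real N + 1) ^ 2 / 4 / real N ^ 2) \<longlonglongrightarrow> 1/4" by real_asymp
  qed
  moreover have "real (\<Sum>({d. odd d} \<inter> {1..N})) = x N ^ 2" for N
    unfolding sum_odd_upto x_def by (simp only: of_nat_power)
  ultimately show ?thesis by (simp only:)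
qed

context
  fixes p :: int
  assumes p: "\<bar>p\<bar> \<ge> 2"
begin

lemma abs_pm1_pos: "m > 0 \<Longrightarrow> abs_pm1 p m > 0"
proof -
  assume m: "m > 0"
  have z: "\<bar>real_of_int p\<bar> \<ge> 2" using p by linarith
  hence "0 < \<bar>real_of_int p\<bar> ^ m / 2" by (intro divide_pos_pos zero_less_power) auto
  also have "\<dots> \<le> real (abs_pm1 p m)" using abs_power_minus_one_bounds(1)[OF z m] by (simp add: real_abs_pm1)
  finally show ?thesis by simp
qed

lemma gcd_abs_pm1: "gcd (abs_pm1 p m) (abs_pm1 p n) = abs_pm1 p (gcd m n)"
proof -
  have "int (gcd (abs_pm1 p m) (abs_pm1 p n)) = gcd (p ^ m - 1) (p ^ n - 1)"
    by (simp only: abs_pm1_def gcd_int_def)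
  also have "\<dots> = int (abs_pm1 p (gcd m n))" unfolding gcd_power_minus_one by (simp add: abs_pm1_def)
  finally show ?thesis by (simp only: of_nat_eq_iff)
qed

lemma prod_prim_part_Lcm:
  assumes "finite S" "0 \<notin> S" "\<And>m d. m \<in> S \<Longrightarrow> d dvd m \<Longrightarrow> d \<in> S"
  shows "(\<Prod>d\<in>S. prim_part p d) = Lcm (abs_pm1 p ` S)"
  by (rule prod_primitive_parts_eq_Lcm) (use assms abs_pm1_pos gcd_abs_pm1 in \<open>auto simp: prim_part_def\<close>)

text \<open>The divisors of m are closed under taking divisors, and the Lcm of their
  \<open>abs_pm1\<close> values is attained at m itself. Up to sign this is the factorisation of p^m
  - 1 into cyclotomic values.\<close>

lemma prod_prim_part: "m > 0 \<Longrightarrow> (\<Prod>d | d dvd m. prim_part p d) = abs_pm1 p m"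
proof (subst prod_prim_part_Lcm)
  assume m: "m > 0"
  have "abs_pm1 p d dvd abs_pm1 p m" if "d dvd m" for d
    using gcd_abs_pm1[of d m] gcd_nat.absorb1[OF that] by (metis gcd_dvd2)
  thus "Lcm (abs_pm1 p ` {d. d dvd m}) = abs_pm1 p m"
    by (intro dvd_antisym Lcm_least dvd_Lcm) auto
qed (auto intro: dvd_trans)

lemma prim_part_pos: "d > 0 \<Longrightarrow> prim_part p d > 0"
proof -
  assume d: "d > 0"
  have "prim_part p d \<noteq> 0"
  proof
    assume "prim_part p d = 0"
    hence "(\<Prod>d' | d' dvd d. prim_part p d') = 0" using d by (subst prod_zero_iff) (auto intro!: exI[of _ d])
    thus False using prod_prim_part[OF d] abs_pm1_pos[OF d] by simp
  qed
  thus ?thesis by simp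
qed

lemma ln_abs_pm1_bounds:
  assumes "m > 0"
  shows "\<bar>ln (real (abs_pm1 p m)) - real m * ln \<bar>real_of_int p\<bar>\<bar> \<le> ln 2"
proof -
  define z where "z = real_of_int p"
  have z: "\<bar>z\<bar> \<ge> 2" using p unfolding z_def by linarith
  have pw: "\<bar>z\<bar> ^ m > 0" using z by (intro zero_less_power) linarith
  have b: "real (abs_pm1 p m) > 0" using abs_pm1_pos[OF assms] by simp
  have "ln (real (abs_pm1 p m)) \<le> ln (2 * \<bar>z\<bar> ^ m)"
    using b pw abs_power_minus_one_bounds(2)[OF z assms] by (subst ln_le_cancel_iff) (auto simp: real_abs_pm1 z_def)
  also have "\<dots> = ln 2 + m * ln \<bar>z\<bar>" using pw z by (subst ln_mult) (auto simp: ln_realpow)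
  finally have 1: "ln (real (abs_pm1 p m)) \<le> ln 2 + m * ln \<bar>z\<bar>" .
  have "ln (\<bar>z\<bar> ^ m / 2) \<le> ln (real (abs_pm1 p m))"
    using b pw abs_power_minus_one_bounds(1)[OF z assms] by (subst ln_le_cancel_iff) (auto simp: real_abs_pm1 z_def)
  also have "ln (\<bar>z\<bar> ^ m / 2) = m * ln \<bar>z\<bar> - ln 2" using pw z by (subst ln_div) (auto simp: ln_realpow)
  finally show ?thesis using 1 by (simp add: z_def abs_le_iff)
qed

lemma sum_ln_abs_pm1_asymp:
  assumes "(\<lambda>N. real (\<Sum>(K \<inter> {1..N})) / real N ^ 2) \<longlonglongrightarrow> s"
  shows "(\<lambda>N. (\<Sum>m\<in>K \<inter> {1..N}. ln (real (abs_pm1 p m))) / real N ^ 2) \<longlonglongrightarrow> s * ln \<bar>real_of_int p\<bar>"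
proof -
  define \<kappa> where "\<kappa> = ln \<bar>real_of_int p\<bar>"
  define e where "e N = (\<Sum>m\<in>K \<inter> {1..N}. ln (real (abs_pm1 p m)) - real m * \<kappa>)" for N
  have e: "\<bar>e N\<bar> \<le> real N * ln 2" for N
  proof -
    have "\<bar>e N\<bar> \<le> (\<Sum>m\<in>K \<inter> {1..N}. \<bar>ln (real (abs_pm1 p m)) - real m * \<kappa>\<bar>)" unfolding e_def by (rule sum_abs)
    also have "\<dots> \<le> (\<Sum>m\<in>K \<inter> {1..N}. ln 2)" unfolding \<kappa>_def by (intro sum_mono ln_abs_pm1_bounds) auto
    also have "\<dots> \<le> (\<Sum>m\<in>{1..N}. ln 2)" by (intro sum_mono2) auto
    finally show ?thesis by simp
  qed
  have "(\<lambda>N. e N / real N ^ 2) \<longlonglongrightarrow> 0"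
  proof (rule Lim_null_comparison)
    show "\<forall>\<^sub>F N in sequentially. norm (e N / real N ^ 2) \<le> ln 2 / real N"
      using eventually_gt_at_top[of 0]
    proof eventually_elim
      case (elim N)
      have "\<bar>e N\<bar> / real N ^ 2 \<le> (real N * ln 2) / real N ^ 2" by (intro divide_right_mono e) auto
      thus ?case using elim by (simp add: power2_eq_square)
    qed
    show "(\<lambda>N. ln 2 / real N) \<longlonglongrightarrow> 0" by real_asymp
  qed
  hence "(\<lambda>N. real (\<Sum>(K \<inter> {1..N})) / real N ^ 2 * \<kappa> + e N / real N ^ 2) \<longlonglongrightarrow> s * \<kappa> + 0"
    by (intro tendsto_intros assms)
  also have "(\<lambda>N. real (\<Sum>(K \<inter> {1..N})) / real N ^ 2 * \<kappa> + e N / real N ^ 2) =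
     (\<lambda>N. (\<Sum>m\<in>K \<inter> {1..N}. ln (real (abs_pm1 p m))) / real N ^ 2)"
    by (rule ext) (simp add: e_def sum_subtractf add_divide_distrib[symmetric] sum_distrib_right)
  finally show ?thesis by (simp add: \<kappa>_def)
qed

lemma ln_prod_prim_part_asymp:
  assumes K: "1 \<in> K" "0 \<notin> K" and Kmult: "\<And>a b. a * b \<in> K \<longleftrightarrow> a \<in> K \<and> b \<in> K"
    and s: "(\<lambda>N. real (\<Sum>(K \<inter> {1..N})) / real N ^ 2) \<longlonglongrightarrow> s"
    and Z: "(\<lambda>k. if k \<in> K then 1 / real k ^ 2 else 0) sums Z" "Z < 2"
  shows "(\<lambda>N. ln (real (\<Prod>d\<in>K \<inter> {1..N}. prim_part p d)) / real N ^ 2) \<longlonglongrightarrow> s * ln \<bar>real_of_int p\<bar> / Z"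
proof -
  \<comment> \<open>The inversion lemma wants a non-negative function at every d. At d = 0 the
    primitive part is 0; replacing it by its maximum with 1 changes nothing for d > 0.\<close>
  have "(\<lambda>N. (\<Sum>d\<in>K \<inter> {1..N}. ln (real (max 1 (prim_part p d)))) / real N ^ 2) \<longlonglongrightarrow> s * ln \<bar>real_of_int p\<bar> / Z"
  proof (rule divisor_sum_inversion_asymp[OF K Kmult _ _ sum_ln_abs_pm1_asymp[OF s] Z])
    fix m :: nat assume m: "m > 0"
    have "(\<Sum>d | d dvd m. ln (real (max 1 (prim_part p d)))) = (\<Sum>d | d dvd m. ln (real (prim_part p d)))"
    proof (intro sum.cong refl)
      fix d assume "d \<in> {d. d dvd m}"
      hence "d > 0" using m by (auto intro: gr0I)
      hence "prim_part p d > 0" by (rule prim_part_pos)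
      thus "ln (real (max 1 (prim_part p d))) = ln (real (prim_part p d))" by (simp add: max_def)
    qed
    also have "\<dots> = ln (\<Prod>d | d dvd m. real (prim_part p d))"
      using prim_part_pos m by (subst ln_prod) (auto simp: dvd_pos_nat)
    also have "\<dots> = ln (real (abs_pm1 p m))" by (simp flip: prod_prim_part[OF m])
    finally show "(\<Sum>d | d dvd m. ln (real (max 1 (prim_part p d)))) = ln (real (abs_pm1 p m))" .
  qed auto
  also have "(\<lambda>N. (\<Sum>d\<in>K \<inter> {1..N}. ln (real (max 1 (prim_part p d)))) / real N ^ 2) =
     (\<lambda>N. ln (real (\<Prod>d\<in>K \<inter> {1..N}. prim_part p d)) / real N ^ 2)"
  proof
    fix N
    have "(\<Sum>d\<in>K \<inter> {1..N}. ln (real (max 1 (prim_part p d)))) = (\<Sum>d\<in>K \<inter> {1..N}. ln (real (prim_part p d)))"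
      using prim_part_pos by (intro sum.cong refl) (auto simp: max_def not_less_eq_eq Suc_le_eq)
    also have "\<dots> = ln (real (\<Prod>d\<in>K \<inter> {1..N}. prim_part p d))"
      unfolding of_nat_prod by (subst ln_prod) (auto intro!: prim_part_pos)
    finally show "(\<Sum>d\<in>K \<inter> {1..N}. ln (real (max 1 (prim_part p d)))) / real N ^ 2 = ln (real (\<Prod>d\<in>K \<inter> {1..N}. prim_part p d)) / real N ^ 2"
      by simp
  qed
  finally show ?thesis .
qed

text \<open>The constant is 1 / 2, from the sum of the m up to N, divided by Z = pi^2 / 6.\<close>

lemma ln_prod_prim_part_all_asymp:
  "(\<lambda>N. ln (real (\<Prod>d\<in>{1..N}. prim_part p d)) / real N ^ 2) \<longlonglongrightarrow> 3 / pi ^ 2 * ln \<bar>real_of_int p\<bar>"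
proof -
  have "(\<lambda>N. ln (real (\<Prod>d\<in>{0<..} \<inter> {1..N}. prim_part p d)) / real N ^ 2) \<longlonglongrightarrow> (1/2) * ln \<bar>real_of_int p\<bar> / (pi ^ 2 / 6)"
  proof (rule ln_prod_prim_part_asymp)
    have "real (\<Sum>({0<..} \<inter> {1..N})) = real N * (real N + 1) / 2" for N :: nat
    proof -
      have "{0<..} \<inter> {1..N} = {1..N}" by auto
      moreover have "2 * (\<Sum>{1..N}) = N * (N + 1)" by (induction N) simp_all
      hence "2 * real (\<Sum>{1..N}) = real N * (real N + 1)"
        by (metis of_nat_1 of_nat_add of_nat_mult of_nat_numeral)
      ultimately show ?thesis by simp
    qed
    moreover have "(\<lambda>N::nat. real N * (real N + 1) / 2 / real N ^ 2) \<longlonglongrightarrow> 1/2" by real_asymp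
    ultimately show "(\<lambda>N. real (\<Sum>({0<..} \<inter> {1..N})) / real N ^ 2) \<longlonglongrightarrow> 1/2" by (simp only:)
    have "(\<lambda>k. 1 / real k ^ 2) sums (pi ^ 2 / 6)"
      using sums_Suc[of "\<lambda>k. 1 / real k ^ 2" "pi ^ 2 / 6"] inverse_squares_sums by (simp add: add.commute)
    also have "(\<lambda>k. 1 / real k ^ 2) = (\<lambda>k. if k \<in> {0<..} then 1 / real k ^ 2 else 0)" by auto
    finally show "(\<lambda>k. if k \<in> {0<..} then 1 / real k ^ 2 else 0) sums (pi ^ 2 / 6)" .
    show "pi ^ 2 / 6 < 2" using pi_sq_less by simp
  qed auto
  moreover have "{0<..} \<inter> {1..N} = {1..N}" for N :: nat by auto
  moreover have "(1/2) * ln \<bar>real_of_int p\<bar> / (pi ^ 2 / 6) = 3 / pi ^ 2 * ln \<bar>real_of_int p\<bar>" by simp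
  ultimately show ?thesis by (simp only:)
qed

text \<open>The constant is 1 / 4, from the sum of the odd m up to N, divided by Z = pi^2 /
  8.\<close>

lemma ln_prod_prim_part_odd_asymp:
  "(\<lambda>N. ln (real (\<Prod>d\<in>{d. odd d} \<inter> {1..N}. prim_part p d)) / real N ^ 2) \<longlonglongrightarrow> 2 / pi ^ 2 * ln \<bar>real_of_int p\<bar>"
proof -
  have Z: "(\<lambda>k. if k \<in> {d. odd d} then 1 / real k ^ 2 else 0) sums (pi ^ 2 / 8)"
    unfolding mem_Collect_eq by (rule odd_inverse_squares_sums)
  have Z2: "pi ^ 2 / 8 < 2" using pi_sq_less by simp
  have "(\<lambda>N. ln (real (\<Prod>d\<in>{d. odd d} \<inter> {1..N}. prim_part p d)) / real N ^ 2) \<longlonglongrightarrow> (1/4) * ln \<bar>real_of_int p\<bar> / (pi ^ 2 / 8)"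
    by (rule ln_prod_prim_part_asymp[OF _ _ _ sum_odd_upto_asymp Z Z2]) auto
  moreover have "(1/4) * ln \<bar>real_of_int p\<bar> / (pi ^ 2 / 8) = 2 / pi ^ 2 * ln \<bar>real_of_int p\<bar>" by simp
  ultimately show ?thesis by (simp only:)
qed

end

section \<open>Asymptotics of the bound\<close>

lemma pi_sq_greater: "pi ^ 2 > 9"
proof -
  have "3 * 3 < pi * pi" using pi_approx by (intro mult_strict_mono) auto
  thus ?thesis by (simp add: power2_eq_square)
qed

text \<open>Since pi > 3, the term 16 r / 3 outweighs 16 / pi^2. The lower-order terms of the
  denominator may therefore be dropped in an upper bound of \<open>f_r\<close>.\<close>

lemma f_r_denominator_gt:
  assumes "r \<ge> 1"
  shows "(48 / pi ^ 2 + 2) * real A + 8 * real r ^ 2 <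
    (48 / pi ^ 2 + 2) * real A + 8 * real r ^ 2 - 16 / pi ^ 2 + 16 * real r / 3"
proof -
  have "16 / pi ^ 2 < 16 / 9" using pi_sq_greater by (intro divide_strict_left_mono) auto
  moreover have "16 / 9 < 16 * real r / 3" using assms by simp
  ultimately show ?thesis by linarith
qed

text \<open>Uniform in r: the mean inequality controls the term 4 r A of the numerator, and the term
  A costs only the constant 1 / c, negligible against sqrt A.\<close>

lemma f_r_le:
  assumes "r \<ge> 1" "A \<ge> 1"
  defines "c \<equiv> 48 / pi ^ 2 + 2"
  shows "f_r r A \<le> sqrt (real A) / sqrt (2 * c) + 1 / c"
proof -
  have c: "c > 0" unfolding c_def by (intro add_nonneg_pos) auto
  define D where "D = c * real A + 8 * real r ^ 2"
  have A: "real A > 0" and r: "real r > 0" using assms by auto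
  have D: "D > 0" unfolding D_def using c A by (intro add_pos_nonneg mult_pos_pos) auto
  have "f_r r A \<le> (4 * real r * real A + real A) / D"
    unfolding f_r_def c_def[symmetric]
  proof (rule frac_le)
    show "D \<le> c * real A + 8 * real r ^ 2 - 16 / pi ^ 2 + 16 * real r / 3"
      using f_r_denominator_gt[OF assms(1), of A] by (simp add: D_def c_def)
  qed (use D in auto)
  also have "\<dots> = 4 * real r * real A / D + real A / D" by (rule add_divide_distrib)
  also have "\<dots> \<le> sqrt (real A) / sqrt (2 * c) + 1 / c"
  proof (rule add_mono)
    have "2 * (sqrt (c * real A) * (sqrt 8 * real r)) \<le> (sqrt (c * real A)) ^ 2 + (sqrt 8 * real r) ^ 2"
      using sum_squares_bound[of "sqrt (c * real A)" "sqrt 8 * real r"] by (simp add: mult.assoc)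
    also have "\<dots> = D" unfolding D_def using c A by (simp add: power_mult_distrib)
    finally have D_ge: "2 * (sqrt (c * real A) * (sqrt 8 * real r)) \<le> D" .
    have "sqrt 8 = 2 * sqrt 2" using real_sqrt_mult[of 4 2] by simp
    hence E: "2 * (sqrt (c * real A) * (sqrt 8 * real r)) = 4 * real r * (sqrt (2 * c) * sqrt (real A))"
      by (simp add: real_sqrt_mult)
    have "4 * real r * real A / D \<le> 4 * real r * real A / (4 * real r * (sqrt (2 * c) * sqrt (real A)))"
      using D_ge E A r c D by (intro divide_left_mono) (auto intro!: mult_pos_pos)
    also have "\<dots> = real A / (sqrt (2 * c) * sqrt (real A))" using r by simp
    also have "\<dots> = sqrt (real A) / sqrt (2 * c)"
      using A c by (simp add: field_simps flip: power2_eq_square)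
    finally show "4 * real r * real A / D \<le> sqrt (real A) / sqrt (2 * c)" .
    have "real A / D \<le> real A / (c * real A)"
      using A c by (intro divide_left_mono) (auto simp: D_def intro!: mult_pos_pos add_pos_nonneg)
    thus "real A / D \<le> 1 / c" using A by simp
  qed
  finally show ?thesis .
qed

lemma f_max_set:
  "finite {f_r r A | r. 1 \<le> r \<and> real r < real A / 2}"
  "A \<ge> 3 \<Longrightarrow> {f_r r A | r. 1 \<le> r \<and> real r < real A / 2} \<noteq> {}"
proof -
  have "{f_r r A | r. 1 \<le> r \<and> real r < real A / 2} \<subseteq> (\<lambda>r. f_r r A) ` {..A}"
  proof
    fix a assume "a \<in> {f_r r A | r. 1 \<le> r \<and> real r < real A / 2}"
    then obtain r where r: "a = f_r r A" "real r < real A / 2" by blast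
    hence "r \<le> A" by simp
    thus "a \<in> (\<lambda>r. f_r r A) ` {..A}" using r by blast
  qed
  thus "finite {f_r r A | r. 1 \<le> r \<and> real r < real A / 2}" by (rule finite_subset) auto
  show "{f_r r A | r. 1 \<le> r \<and> real r < real A / 2} \<noteq> {}" if "A \<ge> 3"
    using that by (auto intro!: exI[of _ 1])
qed

lemma f_max_asymp_equiv: "f_max \<sim>[at_top] (\<lambda>A. pi / (2 * sqrt (pi ^ 2 + 24)) * sqrt (real A))"
proof -
  define c where "c = 48 / pi ^ 2 + 2"
  have c: "c > 0" unfolding c_def by (intro add_nonneg_pos) auto
  have "2 * c = (2 * sqrt (pi ^ 2 + 24) / pi) ^ 2"
    unfolding c_def by (simp add: power_divide power_mult_distrib field_simps)
  hence s2c: "sqrt (2 * c) = 2 * sqrt (pi ^ 2 + 24) / pi" by simp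
  define rr where "rr A = nat \<lfloor>sqrt (c / 8) * sqrt (real A)\<rfloor>" for A :: nat
  define s where "s = sqrt (c / 8)"
  have s: "s > 0" using c by (simp add: s_def)
  have rr: "real (rr A) \<le> s * sqrt (real A)" "s * sqrt (real A) - 1 \<le> real (rr A)" for A
  proof -
    have "0 \<le> s * sqrt (real A)" using s by simp
    thus "real (rr A) \<le> s * sqrt (real A)" "s * sqrt (real A) - 1 \<le> real (rr A)"
      unfolding rr_def s_def[symmetric] by linarith+
  qed
  \<comment> \<open>With r = t sqrt A, the quotient f(r;A) / sqrt A becomes a rational function of t
    and 1 / sqrt A that is continuous at the limit point, so only the limit of t matters.\<close>
  define t where "t A = real (rr A) / sqrt (real A)" for A
  have t: "t \<longlonglongrightarrow> s"
  proof (rule tendsto_sandwich[of "\<lambda>A. s - 1 / sqrt (real A)" _ _ "\<lambda>A. s"])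
    show "\<forall>\<^sub>F A in sequentially. s - 1 / sqrt (real A) \<le> t A"
      using eventually_gt_at_top[of 0]
    proof eventually_elim
      case (elim A)
      have "(s * sqrt (real A) - 1) / sqrt (real A) \<le> t A" unfolding t_def by (intro divide_right_mono rr) auto
      thus ?case using elim by (simp add: diff_divide_distrib)
    qed
    show "\<forall>\<^sub>F A in sequentially. t A \<le> s"
      using eventually_gt_at_top[of 0]
    proof eventually_elim
      case (elim A)
      have "t A \<le> s * sqrt (real A) / sqrt (real A)" unfolding t_def by (intro divide_right_mono rr) auto
      thus ?case using elim by simp
    qed
    show "(\<lambda>A. s - 1 / sqrt (real A)) \<longlonglongrightarrow> s" by real_asymp
  qed auto
  have i: "(\<lambda>A. 1 / sqrt (real A)) \<longlonglongrightarrow> 0" by real_asymp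
  have "(\<lambda>A. (4 * t A + 1 / sqrt (real A) - 4 * t A ^ 2 * (1 / sqrt (real A))) /
      (c + 8 * t A ^ 2 - 16 / pi ^ 2 * (1 / sqrt (real A)) ^ 2 + 16 / 3 * t A * (1 / sqrt (real A))))
     \<longlonglongrightarrow> (4 * s + 0 - 4 * s ^ 2 * 0) / (c + 8 * s ^ 2 - 16 / pi ^ 2 * 0 ^ 2 + 16 / 3 * s * 0)"
    using c by (intro tendsto_intros t i) (auto simp: add_pos_nonneg add_nonneg_eq_0_iff)
  also have "(4 * s + 0 - 4 * s ^ 2 * 0) / (c + 8 * s ^ 2 - 16 / pi ^ 2 * 0 ^ 2 + 16 / 3 * s * 0) = 1 / sqrt (2 * c)"
  proof -
    have s2: "8 * s ^ 2 = c" using c by (simp add: s_def)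
    have "2 * c = (4 * s) ^ 2" using s2 by (simp add: power_mult_distrib)
    hence "sqrt (2 * c) = \<bar>4 * s\<bar>" by (simp only: real_sqrt_abs)
    hence "sqrt (2 * c) = 4 * s" using s by simp
    moreover have "(4 * s + 0 - 4 * s ^ 2 * 0) / (c + 8 * s ^ 2 - 16 / pi ^ 2 * 0 ^ 2 + 16 / 3 * s * 0) = 4 * s / (16 * s ^ 2)"
      unfolding s2[symmetric] by simp
    moreover have "4 * s / (16 * s ^ 2) = 1 / (4 * s)" using s by (simp add: power2_eq_square)
    ultimately show ?thesis by (simp only:)
  qed
  finally have lim1: "(\<lambda>A. (4 * t A + 1 / sqrt (real A) - 4 * t A ^ 2 * (1 / sqrt (real A))) /
      (c + 8 * t A ^ 2 - 16 / pi ^ 2 * (1 / sqrt (real A)) ^ 2 + 16 / 3 * t A * (1 / sqrt (real A))))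
     \<longlonglongrightarrow> 1 / sqrt (2 * c)" .
  have lim_low: "(\<lambda>A. f_r (rr A) A / sqrt (real A)) \<longlonglongrightarrow> 1 / sqrt (2 * c)"
  proof (rule Lim_transform_eventually[OF lim1], use eventually_gt_at_top[of 0] in eventually_elim)
    case (elim A)
    define x where "x = sqrt (real A)"
    have x: "x > 0" "real A = x ^ 2" using elim by (auto simp: x_def)
    have tx: "real (rr A) = t A * x"
      using elim by (simp add: t_def x_def)
    have 1: "4 * (t A * x) * x ^ 2 + x ^ 2 - 4 * (t A * x) ^ 2 = x ^ 3 * (4 * t A + 1 / x - 4 * t A ^ 2 * (1 / x))"
      using x(1) by (simp add: field_simps power2_eq_square power3_eq_cube)
    have 2: "c * x ^ 2 + 8 * (t A * x) ^ 2 - 16 / pi ^ 2 + 16 * (t A * x) / 3 =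
       x ^ 2 * (c + 8 * t A ^ 2 - 16 / pi ^ 2 * (1 / x) ^ 2 + 16 / 3 * t A * (1 / x))"
      using x(1) by (simp add: algebra_simps power2_eq_square)
    have "f_r (rr A) A / x = (x ^ 3 * (4 * t A + 1 / x - 4 * t A ^ 2 * (1 / x))) /
       (x ^ 2 * (c + 8 * t A ^ 2 - 16 / pi ^ 2 * (1 / x) ^ 2 + 16 / 3 * t A * (1 / x))) / x"
      unfolding f_r_def c_def[symmetric] tx x(2) 1 2 ..
    also have "\<dots> = (4 * t A + 1 / x - 4 * t A ^ 2 * (1 / x)) / (c + 8 * t A ^ 2 - 16 / pi ^ 2 * (1 / x) ^ 2 + 16 / 3 * t A * (1 / x))"
    proof -
      have "x ^ 3 * a / (x ^ 2 * b) / x = a / b" for a b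
        using x(1) by (simp add: power2_eq_square power3_eq_cube)
      thus ?thesis .
    qed
    finally show ?case by (simp only: x_def)
  qed
  have lim_up: "(\<lambda>A. 1 / sqrt (2 * c) + 1 / c * (1 / sqrt (real A))) \<longlonglongrightarrow> 1 / sqrt (2 * c) + 1 / c * 0"
    by (intro tendsto_intros i)
  have "(\<lambda>A. f_max A / sqrt (real A)) \<longlonglongrightarrow> 1 / sqrt (2 * c)"
  proof (rule tendsto_sandwich[OF _ _ lim_low lim_up[simplified]])
    have "filterlim (\<lambda>A::nat. s * sqrt (real A)) at_top sequentially" using s by real_asymp
    hence ev1: "\<forall>\<^sub>F A in sequentially. s * sqrt (real A) \<ge> 2"
      by (simp add: filterlim_at_top)
    have "(\<lambda>A::nat. s * sqrt (real A) / real A) \<longlonglongrightarrow> 0" by real_asymp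
    hence ev2: "\<forall>\<^sub>F A in sequentially. s * sqrt (real A) / real A < 1/2" by (intro order_tendstoD(2)) auto
    show "\<forall>\<^sub>F A in sequentially. f_r (rr A) A / sqrt (real A) \<le> f_max A / sqrt (real A)"
      using ev1 ev2 eventually_gt_at_top[of 0]
    proof eventually_elim
      case (elim A)
      have "real (rr A) \<ge> 1" using rr(2)[of A] elim by linarith
      moreover have "real (rr A) < real A / 2"
      proof -
        have "s * sqrt (real A) < 1/2 * real A" using elim by (simp only: divide_less_eq of_nat_0_less_iff if_True)
        thus ?thesis using rr(1)[of A] by linarith
      qed
      ultimately have "f_r (rr A) A \<in> {f_r r A | r. 1 \<le> r \<and> real r < real A / 2}" by auto
      hence "f_r (rr A) A \<le> f_max A" unfolding f_max_def by (intro Max_ge f_max_set)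
      thus ?case by (intro divide_right_mono) auto
    qed
    show "\<forall>\<^sub>F A in sequentially. f_max A / sqrt (real A) \<le> 1 / sqrt (2 * c) + 1 / (c * sqrt (real A))"
      using eventually_ge_at_top[of 3]
    proof eventually_elim
      case (elim A)
      have "f_max A \<le> sqrt (real A) / sqrt (2 * c) + 1 / c"
        unfolding f_max_def
      proof (rule Max.boundedI[OF f_max_set(1) f_max_set(2)[OF elim]])
        fix a assume "a \<in> {f_r r A | r. 1 \<le> r \<and> real r < real A / 2}"
        thus "a \<le> sqrt (real A) / sqrt (2 * c) + 1 / c" using f_r_le[of _ A] elim by (auto simp: c_def)
      qed
      hence "f_max A / sqrt (real A) \<le> (sqrt (real A) / sqrt (2 * c) + 1 / c) / sqrt (real A)"
        by (intro divide_right_mono) auto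
      also have "\<dots> = 1 / sqrt (2 * c) + 1 / (c * sqrt (real A))"
        using elim by (simp add: add_divide_distrib)
      finally show ?case .
    qed
  qed
  hence "(\<lambda>A. f_max A / sqrt (real A) / (1 / sqrt (2 * c))) \<longlonglongrightarrow> 1 / sqrt (2 * c) / (1 / sqrt (2 * c))"
    by (rule tendsto_divide[OF _ tendsto_const]) (use c in simp)
  also have "1 / sqrt (2 * c) / (1 / sqrt (2 * c)) = 1" using c by simp
  also have "(\<lambda>A. f_max A / sqrt (real A) / (1 / sqrt (2 * c))) = (\<lambda>A. f_max A / (1 / sqrt (2 * c) * sqrt (real A)))"
    by (simp only: divide_divide_eq_left mult.commute)
  finally have "(\<lambda>A. f_max A / (1 / sqrt (2 * c) * sqrt (real A))) \<longlonglongrightarrow> 1" .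
  moreover have "1 / sqrt (2 * c) = pi / (2 * sqrt (pi ^ 2 + 24))" unfolding s2c by simp
  ultimately show ?thesis by (intro asymp_equivI') (simp only:)
qed

section \<open>Partial fractions\<close>

lemma pcompose_power: "pcompose (p ^ k) r = pcompose p r ^ k"
  by (induction k) (simp_all add: pcompose_mult pcompose_1)

text \<open>The product over the earlier roots has order 0 at the new root, so the whole order of M
  there passes to the cofactor.\<close>

lemma prod_linear_powers_dvd:
  fixes M :: "'a::field poly"
  assumes "finite S" "inj_on x S" "\<And>j. j \<in> S \<Longrightarrow> [:- x j, 1:] ^ A dvd M"
  shows "(\<Prod>j\<in>S. [:- x j, 1:] ^ A) dvd M"
proof (cases "M = 0")
  case False
  show ?thesis using assms
  proof (induction S rule: finite_induct)
    case (insert j S)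
    have "(\<Prod>j\<in>S. [:- x j, 1:] ^ A) dvd M"
      by (rule insert.IH) (use insert.prems in auto)
    then obtain K where K: "M = (\<Prod>j\<in>S. [:- x j, 1:] ^ A) * K" by (rule dvdE)
    have "poly (\<Prod>j\<in>S. [:- x j, 1:] ^ A) (x j) \<noteq> 0"
      using insert.prems(1) insert.hyps by (auto simp: poly_prod)
    hence "order (x j) (\<Prod>j\<in>S. [:- x j, 1:] ^ A) = 0" by (rule order_0I)
    moreover have "order (x j) M = order (x j) (\<Prod>j\<in>S. [:- x j, 1:] ^ A) + order (x j) K"
      using False unfolding K by (rule order_mult)
    moreover have "A \<le> order (x j) M" using insert.prems(2)[of j] False by (simp add: order_divides)
    ultimately have "[:- x j, 1:] ^ A dvd K" by (simp add: order_divides)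
    hence "(\<Prod>j\<in>S. [:- x j, 1:] ^ A) * [:- x j, 1:] ^ A dvd M" unfolding K by (intro mult_dvd_mono) auto
    thus ?case using insert.hyps by (simp add: mult.commute)
  qed simp
qed simp

text \<open>Each \<open>g j\<close> is the expansion at \<open>x j\<close> of the function freed of
  that pole, in the local parameter x with X = x j + y j x. Subtracting the contributions of the
  truncated expansions \<open>G j\<close> leaves a numerator \<open>M\<close> divisible by every (X
  - x j)^A, hence by a polynomial of degree A (n + 1); its own degree is smaller, so it is 0. The
  scale \<open>y j\<close> is later taken equal to \<open>x j\<close>, which makes the parameter
  multiplicative.\<close>

lemma partial_fractions:
  fixes x y :: "nat \<Rightarrow> 'a::field" and N :: "'a poly" and g :: "nat \<Rightarrow> 'a fps"
  assumes inj: "inj_on x {..n}" and y: "\<And>j. j \<le> n \<Longrightarrow> y j \<noteq> 0"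
    and deg: "degree N < A * (n + 1)"
    and g: "\<And>j. j \<le> n \<Longrightarrow> g j = fps_of_poly (pcompose N [:x j, y j:]) *
              inverse (\<Prod>i\<in>{..n} - {j}. fps_of_poly [:x j - x i, y j:]) ^ A"
    and X: "X \<notin> x ` {..n}"
  shows "poly N X / (\<Prod>i\<le>n. X - x i) ^ A =
    (\<Sum>j\<le>n. \<Sum>k<A. fps_nth (g j) k / y j ^ A / ((X - x j) / y j) ^ (A - k))"
proof -
  define Lin where "Lin j = [:- x j / y j, 1 / y j:]" for j
  define G where "G j = (\<Sum>k<A. smult (fps_nth (g j) k) (Lin j ^ k))" for j
  define Pr where "Pr j = (\<Prod>i\<in>{..n} - {j}. [:- x i, 1:] ^ A)" for j
  define M where "M = N - (\<Sum>j\<le>n. G j * Pr j)"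
  have A: "A > 0" using deg by (cases A) auto
  have deg_Pr: "degree (Pr j) = A * n" if "j \<le> n" for j
  proof -
    have "degree (Pr j) = (\<Sum>i\<in>{..n} - {j}. degree ([:- x i, 1:] ^ A))"
      unfolding Pr_def by (rule degree_prod_eq_sum_degree) auto
    also have "\<dots> = (\<Sum>i\<in>{..n} - {j}. A)" by (intro sum.cong refl) (simp add: degree_power_eq)
    also have "\<dots> = A * n" using that by simp
    finally show ?thesis .
  qed
  have deg_G: "degree (G j) \<le> A - 1" for j
    unfolding G_def
  proof (rule degree_sum_le)
    fix k assume "k \<in> {..<A}"
    have "degree (smult (fps_nth (g j) k) (Lin j ^ k)) \<le> degree (Lin j ^ k)" by (rule degree_smult_le)
    also have "\<dots> \<le> degree (Lin j) * k" by (rule degree_power_le)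
    also have "\<dots> \<le> 1 * k" by (intro mult_right_mono) (auto simp: Lin_def)
    finally show "degree (smult (fps_nth (g j) k) (Lin j ^ k)) \<le> A - 1" using \<open>k \<in> {..<A}\<close> by simp
  qed simp
  have "degree (G j * Pr j) \<le> A * (n + 1) - 1" if "j \<le> n" for j
  proof -
    have "degree (G j * Pr j) \<le> degree (G j) + degree (Pr j)" by (rule degree_mult_le)
    also have "\<dots> \<le> (A - 1) + A * n" using deg_G[of j] deg_Pr[OF that] by simp
    also have "\<dots> = A * (n + 1) - 1" using A by simp
    finally show ?thesis .
  qed
  hence "degree (\<Sum>j\<le>n. G j * Pr j) \<le> A * (n + 1) - 1" by (intro degree_sum_le) auto
  hence "degree M \<le> A * (n + 1) - 1" unfolding M_def using deg by (intro degree_diff_le) auto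
  hence deg_M: "degree M < A * (n + 1)" using A by (meson Suc_pred' le_imp_less_Suc nat_0_less_mult_iff zero_less_Suc add_gr_0 less_one order.strict_trans1 diff_less)
  have "[:- x j, 1:] ^ A dvd M" if j: "j \<le> n" for j
  proof -
    \<comment> \<open>The substitution moves \<open>x j\<close> to 0, where divisibility by the A-th
      power means that the first A coefficients vanish; \<open>Lin j\<close> undoes it.\<close>
    define q where "q = [:x j, y j:]"
    have Lq: "pcompose (Lin j) q = [:0, 1:]" using y[OF j] by (simp add: Lin_def q_def pcompose_pCons)
    have qL: "pcompose q (Lin j) = [:0, 1:]" using y[OF j] by (simp add: Lin_def q_def pcompose_pCons)
    have lin_q: "pcompose [:- x i, 1:] q = [:x j - x i, y j:]" for i
      by (simp add: q_def pcompose_pCons)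
    define M' where "M' = pcompose M q"
    define R where "R = fps_of_poly (pcompose (Pr j) q)"
    define D where "D = (\<Prod>i\<in>{..n} - {j}. fps_of_poly [:x j - x i, y j:])"
    have R: "R = D ^ A"
      unfolding R_def Pr_def D_def
      by (simp add: pcompose_prod pcompose_power lin_q fps_of_poly_prod fps_of_poly_power prod_power_distrib)
    have "fps_nth D 0 = (\<Prod>i\<in>{..n} - {j}. x j - x i)"
      unfolding D_def fps_of_poly_prod[symmetric] fps_of_poly_nth
    by (simp add: poly_0_coeff_0[symmetric] poly_prod)
    also have "\<dots> \<noteq> 0" using inj j by (auto simp: inj_on_def)
    finally have D0: "fps_nth D 0 \<noteq> 0" .
    have DD: "inverse D ^ A * D ^ A = 1"
      using inverse_mult_eq_1[OF D0] by (simp flip: power_mult_distrib)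
    have N': "fps_of_poly (pcompose N q) = g j * R"
      unfolding g[OF j] R D_def[symmetric] q_def[symmetric] mult.assoc DD by simp
    have G': "pcompose (G j) q = (\<Sum>k<A. monom (fps_nth (g j) k) k)"
      unfolding G_def pcompose_sum pcompose_smult pcompose_power Lq
      by (simp add: monom_altdef)
    have "monom 1 A dvd M'"
      unfolding monom_1_dvd_iff'
    proof (intro allI impI)
      fix k assume k: "k < A"
      have "M' = (pcompose N q - pcompose (G j) q * pcompose (Pr j) q) - (\<Sum>i\<in>{..n}-{j}. pcompose (G i) q * pcompose (Pr i) q)"
        unfolding M'_def M_def using j
        by (subst sum.remove[of _ j]) (auto simp: pcompose_diff pcompose_add pcompose_mult pcompose_sum)
      moreover have "coeff (\<Sum>i\<in>{..n}-{j}. pcompose (G i) q * pcompose (Pr i) q) k = 0"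
      proof -
        have "monom 1 A dvd pcompose (G i) q * pcompose (Pr i) q" if i: "i \<in> {..n}-{j}" for i
        proof -
          have "[:- x j, 1:] ^ A dvd Pr i" unfolding Pr_def using i j by (intro dvd_prodI) auto
          then obtain T where T: "Pr i = [:- x j, 1:] ^ A * T" by (rule dvdE)
          have "pcompose (Pr i) q = [:0, y j:] ^ A * pcompose T q"
            unfolding T pcompose_mult pcompose_power lin_q by simp
          also have "[:0, y j:] = smult (y j) [:0, 1:]" by simp
          also have "smult (y j) [:0, 1:] ^ A = smult (y j ^ A) (monom 1 A)"
            by (simp only: smult_power monom_altdef) simp
          finally have "pcompose (Pr i) q = monom 1 A * smult (y j ^ A) (pcompose T q)" by simp
          thus ?thesis by (metis dvd_mult dvd_triv_left)
        qed
        hence "monom 1 A dvd (\<Sum>i\<in>{..n}-{j}. pcompose (G i) q * pcompose (Pr i) q)" by (rule dvd_sum)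
        thus ?thesis using k unfolding monom_1_dvd_iff' by blast
      qed
      moreover have "coeff (pcompose N q - pcompose (G j) q * pcompose (Pr j) q) k = 0"
      proof -
        have "coeff (pcompose N q - pcompose (G j) q * pcompose (Pr j) q) k =
          fps_nth (fps_of_poly (pcompose N q - pcompose (G j) q * pcompose (Pr j) q)) k" by simp
        also have "\<dots> = fps_nth ((g j - fps_of_poly (pcompose (G j) q)) * R) k"
          by (simp only: fps_of_poly_diff fps_of_poly_mult N' R_def[symmetric] left_diff_distrib)
        also have "\<dots> = (\<Sum>i=0..k. fps_nth (g j - fps_of_poly (pcompose (G j) q)) i * fps_nth R (k - i))"
          by (rule fps_mult_nth)
        also have "\<dots> = 0"
        proof (intro sum.neutral ballI)
          fix i assume i: "i \<in> {0..k}"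
          have "coeff (pcompose (G j) q) i = fps_nth (g j) i"
            unfolding G' using i k by (simp add: coeff_sum if_distrib cong: if_cong)
          thus "fps_nth (g j - fps_of_poly (pcompose (G j) q)) i * fps_nth R (k - i) = 0" by simp
        qed
        finally show ?thesis .
      qed
      ultimately show "coeff M' k = 0" by simp
    qed
    then obtain T where T: "M' = monom 1 A * T" by (rule dvdE)
    have "M = pcompose M' (Lin j)" unfolding M'_def pcompose_assoc[symmetric] qL by simp
    also have "\<dots> = Lin j ^ A * pcompose T (Lin j)"
      unfolding T by (simp add: pcompose_mult monom_altdef pcompose_power pcompose_pCons)
    also have "Lin j = smult (1 / y j) [:- x j, 1:]" by (simp add: Lin_def)
    also have "smult (1 / y j) [:- x j, 1:] ^ A = smult ((1 / y j) ^ A) ([:- x j, 1:] ^ A)"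
      by (rule smult_power)
    finally have "M = [:- x j, 1:] ^ A * smult ((1 / y j) ^ A) (pcompose T (smult (1 / y j) [:- x j, 1:]))"
      by simp
    thus ?thesis by (metis dvd_triv_left)
  qed
  hence "(\<Prod>j\<le>n. [:- x j, 1:] ^ A) dvd M" using inj by (intro prod_linear_powers_dvd) auto
  moreover have "degree (\<Prod>j\<le>n. [:- x j, 1:] ^ A) = A * (n + 1)"
    by (subst degree_prod_eq_sum_degree) (auto simp: degree_power_eq)
  ultimately have "M = 0" using deg_M by (metis divides_degree leD)
  hence N: "poly N X = (\<Sum>j\<le>n. poly (G j) X * poly (Pr j) X)"
    by (simp add: M_def poly_sum)
  have nz: "X - x i \<noteq> 0" if "i \<le> n" for i using X that by auto
  have "poly N X / (\<Prod>i\<le>n. X - x i) ^ A = (\<Sum>j\<le>n. poly (G j) X * poly (Pr j) X / (\<Prod>i\<le>n. X - x i) ^ A)"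
    unfolding N by (rule sum_divide_distrib)
  also have "\<dots> = (\<Sum>j\<le>n. \<Sum>k<A. fps_nth (g j) k / y j ^ A / ((X - x j) / y j) ^ (A - k))"
  proof (intro sum.cong refl)
    fix j assume "j \<in> {..n}"
    hence j: "j \<le> n" by simp
    define u where "u = (X - x j) / y j"
    have u: "u \<noteq> 0" "X - x j = u * y j" using nz[OF j] y[OF j] by (auto simp: u_def)
    have "(\<Prod>i\<le>n. X - x i) ^ A = (u * y j) ^ A * poly (Pr j) X"
    proof -
      have "(\<Prod>i\<le>n. X - x i) = (X - x j) * (\<Prod>i\<in>{..n}-{j}. X - x i)" using j by (subst prod.remove[of _ j]) auto
      thus ?thesis unfolding Pr_def by (simp add: u(2)[symmetric] poly_prod power_mult_distrib prod_power_distrib)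
    qed
    moreover have "poly (Pr j) X \<noteq> 0" using nz by (auto simp: Pr_def poly_prod)
    ultimately have "poly (G j) X * poly (Pr j) X / (\<Prod>i\<le>n. X - x i) ^ A = poly (G j) X / (u * y j) ^ A"
      by simp
    also have G_X: "poly (G j) X = (\<Sum>k<A. fps_nth (g j) k * u ^ k)"
      unfolding G_def u_def Lin_def by (simp add: poly_sum diff_divide_distrib)
    also have "\<dots> / (u * y j) ^ A = (\<Sum>k<A. fps_nth (g j) k / y j ^ A / u ^ (A - k))"
      unfolding sum_divide_distrib
    proof (intro sum.cong refl)
      fix k assume "k \<in> {..<A}"
      hence "u ^ A = u ^ k * u ^ (A - k)" by (simp flip: power_add)
      thus "fps_nth (g j) k * u ^ k / (u * y j) ^ A = fps_nth (g j) k / y j ^ A / u ^ (A - k)"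
        using u y[OF j] by (simp add: power_mult_distrib)
    qed
    finally show "poly (G j) X * poly (Pr j) X / (\<Prod>i\<le>n. X - x i) ^ A =
      (\<Sum>k<A. fps_nth (g j) k / y j ^ A / ((X - x j) / y j) ^ (A - k))" by (simp only: G_X u_def)
  qed
  finally show ?thesis .
qed

section \<open>Power series with controlled denominators\<close>

text \<open>
  Equivalently, \<open>f(D x)\<close> has integer coefficients; hence closure under products.
\<close>

definition scaled_int :: "real \<Rightarrow> real fps \<Rightarrow> bool" where
  "scaled_int D f \<longleftrightarrow> (\<forall>k. D ^ k * fps_nth f k \<in> \<int>)"

lemma scaled_intD: "scaled_int D f \<Longrightarrow> D ^ k * fps_nth f k \<in> \<int>"
  by (simp add: scaled_int_def)

lemma scaled_int_mult: "scaled_int D f \<Longrightarrow> scaled_int D g \<Longrightarrow> scaled_int D (f * g)"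
  unfolding scaled_int_def
proof
  fix k assume f: "\<forall>k. D ^ k * fps_nth f k \<in> \<int>" and g: "\<forall>k. D ^ k * fps_nth g k \<in> \<int>"
  have "D ^ k * fps_nth (f * g) k = (\<Sum>i=0..k. (D ^ i * fps_nth f i) * (D ^ (k - i) * fps_nth g (k - i)))"
    unfolding fps_mult_nth sum_distrib_left
  proof (intro sum.cong refl)
    fix i assume "i \<in> {0..k}"
    hence "D ^ k = D ^ i * D ^ (k - i)" by (simp flip: power_add)
    thus "D ^ k * (fps_nth f i * fps_nth g (k - i)) = (D ^ i * fps_nth f i) * (D ^ (k - i) * fps_nth g (k - i))"
      by simp
  qed
  also have "\<dots> \<in> \<int>" using f g by (intro Ints_sum Ints_mult[of "D ^ _ * fps_nth f _"]) auto
  finally show "D ^ k * fps_nth (f * g) k \<in> \<int>" .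
qed

lemma scaled_int_const: "a \<in> \<int> \<Longrightarrow> scaled_int D (fps_const a)"
  by (auto simp: scaled_int_def fps_nth_fps_const)

lemma scaled_int_1: "scaled_int D 1"
  using scaled_int_const[of 1] by simp

lemma scaled_int_prod: "(\<And>i. i \<in> S \<Longrightarrow> scaled_int D (f i)) \<Longrightarrow> scaled_int D (\<Prod>i\<in>S. f i)"
  by (induction S rule: infinite_finite_induct) (auto intro: scaled_int_1 scaled_int_mult)

lemma scaled_int_power: "scaled_int D f \<Longrightarrow> scaled_int D (f ^ k)"
  by (induction k) (auto intro: scaled_int_1 scaled_int_mult)

lemma scaled_int_linear: "a \<in> \<int> \<Longrightarrow> D * b \<in> \<int> \<Longrightarrow> scaled_int D (fps_of_poly [:a, b:])"
  by (auto simp: scaled_int_def coeff_pCons split: nat.split)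

lemma inverse_fps_linear:
  fixes b :: "'a::field"
  shows "inverse (fps_of_poly [:1, b:]) = Abs_fps (\<lambda>k. (- b) ^ k)"
proof (rule fps_inverse_unique, rule fps_ext)
  fix k
  show "fps_nth (fps_of_poly [:1, b:] * Abs_fps (\<lambda>k. (- b) ^ k)) k = fps_nth 1 k"
    unfolding fps_of_poly_linear' by (cases k) (simp_all add: distrib_right mult.assoc)
qed

lemma scaled_int_inverse_linear: "D * b \<in> \<int> \<Longrightarrow> scaled_int D (inverse (fps_of_poly [:1, b:]))"
proof -
  assume "D * b \<in> \<int>"
  hence "(- (D * b)) ^ k \<in> \<int>" for k by (intro Ints_power Ints_minus)
  thus ?thesis unfolding scaled_int_def inverse_fps_linear by (simp flip: power_mult_distrib)
qed

text \<open>
  The radius \<open>1 / 4\<close> makes the inverse of \<open>1 + b x\<close> have norm at most \<open>2\<close> whenever \<open>\<bar>b\<bar> \<le> 2\<close>.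
\<close>

definition trunc_norm :: "nat \<Rightarrow> real fps \<Rightarrow> real" where
  "trunc_norm K f = (\<Sum>k<K. \<bar>fps_nth f k\<bar> / 4 ^ k)"

lemma trunc_norm_nonneg: "trunc_norm K f \<ge> 0"
  unfolding trunc_norm_def by (intro sum_nonneg) auto

lemma coeff_le_trunc_norm: "k < K \<Longrightarrow> \<bar>fps_nth f k\<bar> \<le> 4 ^ k * trunc_norm K f"
proof -
  assume "k < K"
  hence "\<bar>fps_nth f k\<bar> / 4 ^ k \<le> trunc_norm K f" unfolding trunc_norm_def
    by (intro member_le_sum[where f = "\<lambda>k. \<bar>fps_nth f k\<bar> / 4 ^ k"]) auto
  thus ?thesis by (simp add: divide_le_eq mult.commute)
qed

lemma trunc_norm_mult: "trunc_norm K (f * g) \<le> trunc_norm K f * trunc_norm K g"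
proof -
  define F where "F k = \<bar>fps_nth f k\<bar> / 4 ^ k" for k
  define G where "G k = \<bar>fps_nth g k\<bar> / 4 ^ k" for k
  have "trunc_norm K (f * g) \<le> (\<Sum>k<K. \<Sum>i\<le>k. F i * G (k - i))"
    unfolding trunc_norm_def
  proof (rule sum_mono)
    fix k assume "k \<in> {..<K}"
    have "\<bar>fps_nth (f * g) k\<bar> / 4 ^ k \<le> (\<Sum>i\<le>k. \<bar>fps_nth f i * fps_nth g (k - i)\<bar>) / 4 ^ k"
      unfolding fps_mult_nth atLeast0AtMost by (intro divide_right_mono sum_abs) auto
    also have "\<dots> = (\<Sum>i\<le>k. F i * G (k - i))"
      unfolding sum_divide_distrib F_def G_def
    proof (intro sum.cong refl)
      fix i assume "i \<in> {..k}"
      hence "(4::real) ^ k = 4 ^ i * 4 ^ (k - i)" by (simp flip: power_add)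
      thus "\<bar>fps_nth f i * fps_nth g (k - i)\<bar> / 4 ^ k = \<bar>fps_nth f i\<bar> / 4 ^ i * (\<bar>fps_nth g (k - i)\<bar> / 4 ^ (k - i))"
        by (simp add: abs_mult)
    qed
    finally show "\<bar>fps_nth (f * g) k\<bar> / 4 ^ k \<le> (\<Sum>i\<le>k. F i * G (k - i))" .
  qed
  also have "\<dots> = (\<Sum>(i,j)\<in>{(i,j). i + j < K}. F i * G j)"
    by (rule sum.triangle_reindex[symmetric])
  also have "\<dots> \<le> (\<Sum>(i,j)\<in>{..<K} \<times> {..<K}. F i * G j)"
    by (intro sum_mono2) (auto simp: F_def G_def)
  also have "\<dots> = trunc_norm K f * trunc_norm K g"
    by (simp add: trunc_norm_def F_def G_def sum_product sum.cartesian_product)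
  finally show ?thesis .
qed

lemma trunc_norm_const_le: "trunc_norm K (fps_const a) \<le> \<bar>a\<bar>"
proof (cases K)
  case (Suc n)
  have "trunc_norm K (fps_const a) = (\<Sum>k\<in>{0}. \<bar>fps_nth (fps_const a) k\<bar> / 4 ^ k)"
    unfolding trunc_norm_def using Suc by (intro sum.mono_neutral_right) (auto simp: fps_nth_fps_const)
  thus ?thesis by simp
qed (simp add: trunc_norm_def)

lemma trunc_norm_prod_le:
  assumes "\<And>i. i \<in> S \<Longrightarrow> trunc_norm K (f i) \<le> c i"
  shows "trunc_norm K (\<Prod>i\<in>S. f i) \<le> (\<Prod>i\<in>S. c i)"
proof (cases "finite S")
  case True
  thus ?thesis using assms
  proof (induction S rule: finite_induct)
    case empty
    thus ?case using trunc_norm_const_le[of K 1] by simp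
  next
    case (insert i S)
    have "trunc_norm K (f i * (\<Prod>i\<in>S. f i)) \<le> trunc_norm K (f i) * trunc_norm K (\<Prod>i\<in>S. f i)" by (rule trunc_norm_mult)
    also have "\<dots> \<le> c i * (\<Prod>i\<in>S. c i)"
    proof (intro mult_mono trunc_norm_nonneg)
      show 1: "trunc_norm K (f i) \<le> c i" by (rule insert.prems) simp
      show "trunc_norm K (\<Prod>i\<in>S. f i) \<le> (\<Prod>i\<in>S. c i)" by (rule insert.IH, rule insert.prems) simp
      show "0 \<le> c i" using 1 trunc_norm_nonneg[of K "f i"] by linarith
    qed
    finally show ?case using insert.hyps by simp
  qed
qed (use trunc_norm_const_le[of K 1] in simp)

lemma trunc_norm_power_le: "trunc_norm K f \<le> c \<Longrightarrow> trunc_norm K (f ^ k) \<le> c ^ k"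
  using trunc_norm_prod_le[of "{..<k}" K "\<lambda>_. f" "\<lambda>_. c"] by simp

lemma trunc_norm_linear_le: "trunc_norm K (fps_of_poly [:a, b:]) \<le> \<bar>a\<bar> + \<bar>b\<bar>"
proof -
  have "trunc_norm K (fps_of_poly [:a, b:]) \<le> (\<Sum>k\<in>{..<max K 2}. \<bar>fps_nth (fps_of_poly [:a, b:]) k\<bar> / 4 ^ k)"
    unfolding trunc_norm_def by (intro sum_mono2) auto
  also have "\<dots> = (\<Sum>k\<in>{0,1}. \<bar>fps_nth (fps_of_poly [:a, b:]) k\<bar> / 4 ^ k)"
    by (intro sum.mono_neutral_right) (auto simp: coeff_pCons split: nat.splits)
  also have "\<dots> \<le> \<bar>a\<bar> + \<bar>b\<bar>" by simp
  finally show ?thesis .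
qed

lemma trunc_norm_inverse_linear_le:
  assumes "\<bar>b\<bar> \<le> 2"
  shows "trunc_norm K (inverse (fps_of_poly [:1, b:])) \<le> 2"
proof -
  have "trunc_norm K (inverse (fps_of_poly [:1, b:])) \<le> (\<Sum>k<K. (1 / 2) ^ k)"
    unfolding trunc_norm_def inverse_fps_linear
  proof (rule sum_mono)
    fix k assume "k \<in> {..<K}"
    have "\<bar>b\<bar> ^ k / 4 ^ k \<le> 2 ^ k / 4 ^ k" using assms by (intro divide_right_mono power_mono) auto
    also have "\<dots> = (1 / 2 :: real) ^ k" unfolding power_divide[symmetric] by simp
    finally show "\<bar>fps_nth (Abs_fps (\<lambda>k. (- b) ^ k)) k\<bar> / 4 ^ k \<le> (1 / 2) ^ k"
      by (simp add: power_abs)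
  qed
  also have "\<dots> \<le> (\<Sum>k. (1 / 2) ^ k)" by (intro sum_le_suminf) auto
  also have "\<dots> = (2::real)" by (subst suminf_geometric) auto
  finally show ?thesis .
qed

text \<open>The quotient is a Gaussian binomial coefficient, and the induction is its Pascal rule,
  read off from x^(j + k) - 1 = (x^j - 1) x^k + (x^k - 1).\<close>

lemma q_binomial_dvd:
  fixes x :: "'a::comm_ring_1"
  shows "(\<Prod>i=1..j. x ^ i - 1) * (\<Prod>i=1..k. x ^ i - 1) dvd (\<Prod>i=1..j + k. x ^ i - 1)"
proof (induction "j + k" arbitrary: j k)
  case (Suc m)
  define F where "F n = (\<Prod>i=1..n. x ^ i - 1)" for n
  have F_Suc: "F (Suc n) = F n * (x ^ Suc n - 1)" for n by (simp add: F_def)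
  show ?case
  proof (cases "j = 0 \<or> k = 0")
    case False
    then obtain j' k' where jk: "j = Suc j'" "k = Suc k'" by (metis not0_implies_Suc)
    have 1: "F j' * F k dvd F m" using Suc.hyps(1)[of j' k] Suc.hyps(2) jk by (simp add: F_def)
    have 2: "F j * F k' dvd F m" using Suc.hyps(1)[of j k'] Suc.hyps(2) jk by (simp add: F_def)
    have "F (j + k) = F m * (x ^ (j + k) - 1)" using F_Suc[of m] Suc.hyps(2) by simp
    also have "\<dots> = F m * (x ^ j - 1) * x ^ k + F m * (x ^ k - 1)"
      by (simp add: power_add algebra_simps)
    finally have eq: "F (j + k) = F m * (x ^ j - 1) * x ^ k + F m * (x ^ k - 1)" .
    have "F j' * F k * (x ^ j - 1) dvd F m * (x ^ j - 1)" by (intro mult_dvd_mono 1) auto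
    hence 3: "F j * F k dvd F m * (x ^ j - 1)" using F_Suc[of j'] jk by (simp add: ac_simps)
    have "F j * F k' * (x ^ k - 1) dvd F m * (x ^ k - 1)" by (intro mult_dvd_mono 2) auto
    hence 4: "F j * F k dvd F m * (x ^ k - 1)" using F_Suc[of k'] jk by (simp add: ac_simps)
    have "F j * F k dvd F (j + k)" unfolding eq by (rule dvd_add[OF dvd_mult2[OF 3] 4])
    thus ?thesis by (simp add: F_def)
  qed (use Suc in auto)
qed simp

text \<open>As d is odd, 2 is invertible modulo d, so the i with d dividing l + 2 i form a full
  residue class, which has at least n div d members below n.\<close>

lemma card_multiples_in_progression:
  fixes d l n :: nat
  assumes d: "odd d"
  shows "n div d \<le> card {i. i < n \<and> d dvd l + 2 * i}"
proof -
  have d0: "d > 0" using d by (auto intro: gr0I)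
  obtain e where e: "d = 2 * e + 1" using d by (rule oddE)
  \<comment> \<open>With d = 2 e + 1 the inverse of 2 is e + 1, and d - 1 stands for -1; so c is -l
    / 2 modulo d.\<close>
  define c where "c = ((d - 1) * (e + 1) * l) mod d"
  have c: "c < d" using d0 by (simp add: c_def)
  define M where "M = (d - 1) * (e + 1) * l"
  have "l + 2 * c + d * (2 * (M div d)) = l + 2 * M"
    unfolding c_def M_def[symmetric] using mult_div_mod_eq[of d M] by linarith
  also have "\<dots> = d * (d * l)" unfolding M_def e by (simp add: algebra_simps)
  finally have "d dvd l + 2 * c + d * (2 * (M div d))" by simp
  hence dc: "d dvd l + 2 * c" by (subst (asm) dvd_add_left_iff) auto
  have "(\<lambda>t. t * d + c) ` {..<n div d} \<subseteq> {i. i < n \<and> d dvd l + 2 * i}"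
  proof
    fix i assume "i \<in> (\<lambda>t. t * d + c) ` {..<n div d}"
    then obtain t where t: "t < n div d" "i = t * d + c" by auto
    have "t * d + c < (t + 1) * d" using c by simp
    also have "\<dots> \<le> n div d * d" using t by (intro mult_right_mono) auto
    also have "\<dots> \<le> n" by simp
    finally have "i < n" using t by simp
    moreover have "l + 2 * i = (l + 2 * c) + d * (2 * t)" unfolding t(2) by (simp add: algebra_simps)
    hence "d dvd l + 2 * i" using dvd_add[OF dc dvd_triv_left] by (simp only:)
    ultimately show "i \<in> {i. i < n \<and> d dvd l + 2 * i}" by simp
  qed
  hence "card ((\<lambda>t. t * d + c) ` {..<n div d}) \<le> card {i. i < n \<and> d dvd l + 2 * i}"
    by (intro card_mono) auto
  moreover have "card ((\<lambda>t. t * d + c) ` {..<n div d}) = n div d"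
    using d0 by (subst card_image) (auto simp: inj_on_def)
  ultimately show ?thesis by simp
qed

text \<open>\<open>S\<close> collects the factors that contribute their constant coefficient. In the
  integrality proof, the k remaining ones are those for which a power of the denominator must
  pay.\<close>

lemma coeff_prod_linear:
  fixes c b :: "'i \<Rightarrow> 'a::comm_ring_1"
  assumes "finite I"
  shows "coeff (\<Prod>i\<in>I. [:c i, b i:]) k = (\<Sum>S | S \<subseteq> I \<and> card (I - S) = k. (\<Prod>i\<in>S. c i) * (\<Prod>i\<in>I - S. b i))"
proof -
  have "(\<Prod>i\<in>I. [:c i, b i:]) = (\<Prod>i\<in>I. [:c i:] + monom (b i) 1)"
    by (intro prod.cong refl) (simp add: monom_altdef)
  also have "\<dots> = (\<Sum>S\<in>Pow I. (\<Prod>i\<in>S. [:c i:]) * (\<Prod>i\<in>I - S. monom (b i) 1))"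
    by (rule prod_add[OF assms])
  also have "\<dots> = (\<Sum>S\<in>Pow I. monom ((\<Prod>i\<in>S. c i) * (\<Prod>i\<in>I - S. b i)) (card (I - S)))"
  proof (intro sum.cong refl)
    fix S assume "S \<in> Pow I"
    have 1: "(\<Prod>i\<in>S. [:c i:]) = [:\<Prod>i\<in>S. c i:]" for S
      by (induction S rule: infinite_finite_induct) (auto simp: one_pCons mult.commute)
    have 2: "(\<Prod>i\<in>S. monom (b i) 1) = monom (\<Prod>i\<in>S. b i) (card S)" for S
      by (induction S rule: infinite_finite_induct) (auto simp: mult_monom)
    show "(\<Prod>i\<in>S. [:c i:]) * (\<Prod>i\<in>I - S. monom (b i) 1) = monom ((\<Prod>i\<in>S. c i) * (\<Prod>i\<in>I - S. b i)) (card (I - S))"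
      unfolding 1 2 by (simp add: smult_monom)
  qed
  finally have "coeff (\<Prod>i\<in>I. [:c i, b i:]) k = (\<Sum>S\<in>Pow I. if card (I - S) = k then (\<Prod>i\<in>S. c i) * (\<Prod>i\<in>I - S. b i) else 0)"
    by (simp add: coeff_sum)
  also have "\<dots> = (\<Sum>S | S \<subseteq> I \<and> card (I - S) = k. (\<Prod>i\<in>S. c i) * (\<Prod>i\<in>I - S. b i))"
    using assms by (simp add: sum.If_cases) (intro sum.cong, auto)
  finally show ?thesis .
qed

text \<open>By \<open>prod_prim_part_Lcm\<close> this is the least common multiple of the |p^l - 1|
  with 1 \<le> l \<le> N; \<open>Dodd\<close> is the same for odd l.\<close>

definition Dall :: "int \<Rightarrow> nat \<Rightarrow> nat" where
  "Dall p N = (\<Prod>d\<in>{1..N}. prim_part p d)"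

definition Dodd :: "int \<Rightarrow> nat \<Rightarrow> nat" where
  "Dodd p N = (\<Prod>d\<in>{d. odd d} \<inter> {1..N}. prim_part p d)"

text \<open>
  The product of the \<open>p ^ l - 1\<close> over any \<open>n\<close> consecutive odd exponents \<open>l\<close> is divisible by \<open>Yodd p n\<close>:
  each odd \<open>d \<le> n\<close> divides at least \<open>n div d\<close> of these \<open>l\<close>.
\<close>

definition Yodd :: "int \<Rightarrow> nat \<Rightarrow> nat" where
  "Yodd p n = (\<Prod>d\<in>{d. odd d} \<inter> {1..n}. prim_part p d ^ (n div d))"

context
  fixes p :: int
  assumes p: "\<bar>p\<bar> \<ge> 2"
begin

lemma abs_pm1_dvd_Dall: "1 \<le> l \<Longrightarrow> l \<le> N \<Longrightarrow> abs_pm1 p l dvd Dall p N"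
proof -
  assume l: "1 \<le> l" "l \<le> N"
  have "{d. d dvd l} \<subseteq> {1..N}"
  proof
    fix d assume "d \<in> {d. d dvd l}"
    hence d: "d dvd l" by simp
    hence "d \<le> l" using l by (intro dvd_imp_le) auto
    moreover have "d \<noteq> 0" using d l by auto
    ultimately show "d \<in> {1..N}" using l by auto
  qed
  moreover have "abs_pm1 p l = (\<Prod>d | d dvd l. prim_part p d)" using prod_prim_part[OF p, of l] l by simp
  ultimately show ?thesis unfolding Dall_def by (simp add: prod_dvd_prod_subset)
qed

lemma abs_pm1_dvd_Dodd: "odd l \<Longrightarrow> l \<le> N \<Longrightarrow> abs_pm1 p l dvd Dodd p N"
proof -
  assume l: "odd l" "l \<le> N"
  have l0: "l > 0" using l by (auto intro: gr0I)
  have "{d. d dvd l} \<subseteq> {d. odd d} \<inter> {1..N}"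
  proof
    fix d assume "d \<in> {d. d dvd l}"
    hence d: "d dvd l" by simp
    hence "d \<le> l" using l0 by (rule dvd_imp_le)
    moreover have "odd d" using d l(1) dvd_trans by blast
    moreover have "d \<noteq> 0" using d l0 by auto
    ultimately show "d \<in> {d. odd d} \<inter> {1..N}" using l by auto
  qed
  thus ?thesis unfolding Dodd_def prod_prim_part[OF p l0, symmetric]
    by (intro prod_dvd_prod_subset) auto
qed

text \<open>An odd d \<le> n divides at least n div d of the n exponents l + 2 i, and at most k of
  these are lost outside \<open>S\<close>. The product over \<open>S\<close> thus lacks at most k
  copies of \<open>prim_part p d\<close>, and each factor \<open>Dall p N\<close> supplies
  one.\<close>

lemma Yodd_dvd:
  assumes S: "S \<subseteq> {..<n}" and k: "card ({..<n} - S) = k" and l: "odd l" and N: "n \<le> N"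
  shows "Yodd p n dvd Dall p N ^ k * (\<Prod>i\<in>S. abs_pm1 p (l + 2 * i))"
proof -
  define Od where "Od = {d::nat. odd d} \<inter> {1..n}"
  have finS: "finite S" using S finite_subset by blast
  have "Yodd p n dvd (\<Prod>d\<in>Od. prim_part p d ^ (k + card {i\<in>S. d dvd l + 2 * i}))"
    unfolding Yodd_def Od_def[symmetric]
  proof (intro prod_dvd_prod le_imp_power_dvd)
    fix d assume "d \<in> Od"
    hence d: "odd d" by (simp add: Od_def)
    have "n div d \<le> card {i. i < n \<and> d dvd l + 2 * i}" by (rule card_multiples_in_progression[OF d])
    also have "\<dots> \<le> card (({..<n} - S) \<union> {i\<in>S. d dvd l + 2 * i})"
      using finS by (intro card_mono) auto
    also have "\<dots> \<le> k + card {i\<in>S. d dvd l + 2 * i}" using k card_Un_le by blast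
    finally show "n div d \<le> k + card {i\<in>S. d dvd l + 2 * i}" .
  qed
  also have "\<dots> = (\<Prod>d\<in>Od. prim_part p d) ^ k * (\<Prod>d\<in>Od. prim_part p d ^ card {i\<in>S. d dvd l + 2 * i})"
    by (simp add: power_add prod.distrib prod_power_distrib)
  also have "\<dots> dvd Dall p N ^ k * (\<Prod>i\<in>S. abs_pm1 p (l + 2 * i))"
  proof (intro mult_dvd_mono dvd_power_same)
    show "(\<Prod>d\<in>Od. prim_part p d) dvd Dall p N"
      unfolding Dall_def using N by (intro prod_dvd_prod_subset) (auto simp: Od_def)
    have "(\<Prod>d\<in>Od. prim_part p d ^ card {i\<in>S. d dvd l + 2 * i}) = (\<Prod>d\<in>Od. \<Prod>i\<in>S. if d dvd l + 2 * i then prim_part p d else 1)"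
    proof (intro prod.cong refl)
      fix d
      show "prim_part p d ^ card {i\<in>S. d dvd l + 2 * i} = (\<Prod>i\<in>S. if d dvd l + 2 * i then prim_part p d else 1)"
        using finS by (simp add: prod.If_cases Collect_conj_eq Int_commute)
    qed
    also have "\<dots> = (\<Prod>i\<in>S. \<Prod>d\<in>Od. if d dvd l + 2 * i then prim_part p d else 1)" by (rule prod.swap)
    also have "\<dots> dvd (\<Prod>i\<in>S. abs_pm1 p (l + 2 * i))"
    proof (rule prod_dvd_prod)
      fix i assume "i \<in> S"
      have l0: "l + 2 * i > 0" using l by (auto intro: gr0I)
      have "(\<Prod>d\<in>Od. if d dvd l + 2 * i then prim_part p d else 1) = (\<Prod>d\<in>{d\<in>Od. d dvd l + 2 * i}. prim_part p d)"
        by (simp add: prod.If_cases Od_def) (intro prod.cong, auto)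
      also have "\<dots> dvd (\<Prod>d | d dvd l + 2 * i. prim_part p d)"
        using l0 by (intro prod_dvd_prod_subset) auto
      also have "\<dots> = abs_pm1 p (l + 2 * i)" by (rule prod_prim_part[OF p l0])
      finally show "(\<Prod>d\<in>Od. if d dvd l + 2 * i then prim_part p d else 1) dvd abs_pm1 p (l + 2 * i)" .
    qed
    finally show "(\<Prod>d\<in>Od. prim_part p d ^ card {i\<in>S. d dvd l + 2 * i}) dvd (\<Prod>i\<in>S. abs_pm1 p (l + 2 * i))" .
  qed
  finally show ?thesis .
qed

lemma Yodd_pos: "Yodd p n > 0"
  unfolding Yodd_def using prim_part_pos[OF p] by (intro prod_pos) auto

lemma Dall_pos: "Dall p N > 0"
  unfolding Dall_def using prim_part_pos[OF p] by (intro prod_pos) auto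

lemma Dodd_pos: "Dodd p N > 0"
  unfolding Dodd_def using prim_part_pos[OF p] by (intro prod_pos) auto

text \<open>In the coefficient of x^k, k of the factors \<open>c i\<close> are replaced by integers
  \<open>b i\<close>; by \<open>Yodd_dvd\<close> the k-th power of \<open>Dall p N\<close> restores
  divisibility by \<open>Yodd p n\<close>.\<close>

lemma scaled_int_block:
  fixes c b :: "nat \<Rightarrow> real"
  assumes l: "odd l" and N: "n \<le> N" and b: "\<And>i. b i \<in> \<int>"
    and c: "\<And>i. \<bar>c i\<bar> = real (abs_pm1 p (l + 2 * i))"
  shows "scaled_int (real (Dall p N)) (fps_const (1 / real (Yodd p n)) * (\<Prod>i<n. fps_of_poly [:c i, b i:]))"
  unfolding scaled_int_def
proof
  fix k
  have "real (Dall p N) ^ k * fps_nth (fps_const (1 / real (Yodd p n)) * (\<Prod>i<n. fps_of_poly [:c i, b i:])) k =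
     (\<Sum>S | S \<subseteq> {..<n} \<and> card ({..<n} - S) = k. real (Dall p N) ^ k * (\<Prod>i\<in>S. c i) / real (Yodd p n) * (\<Prod>i\<in>{..<n} - S. b i))"
    unfolding fps_of_poly_prod[symmetric] fps_mult_left_const_nth fps_of_poly_nth
    by (subst coeff_prod_linear) (simp_all add: sum_distrib_left algebra_simps)
  also have "\<dots> \<in> \<int>"
  proof (intro Ints_sum Ints_mult Ints_prod b)
    fix S assume "S \<in> {S. S \<subseteq> {..<n} \<and> card ({..<n} - S) = k}"
    hence "Yodd p n dvd Dall p N ^ k * (\<Prod>i\<in>S. abs_pm1 p (l + 2 * i))"
      by (intro Yodd_dvd l N) auto
    then obtain q where "Dall p N ^ k * (\<Prod>i\<in>S. abs_pm1 p (l + 2 * i)) = Yodd p n * q" by (rule dvdE)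
    hence "real (Dall p N ^ k * (\<Prod>i\<in>S. abs_pm1 p (l + 2 * i))) = real (Yodd p n * q)" by (rule arg_cong)
    hence "real (Dall p N) ^ k * \<bar>\<Prod>i\<in>S. c i\<bar> = real (Yodd p n) * real q"
      by (simp add: abs_prod c)
    hence "\<bar>real (Dall p N) ^ k * (\<Prod>i\<in>S. c i) / real (Yodd p n)\<bar> = real q"
      using Yodd_pos[of n] by (simp add: abs_mult)
    thus "real (Dall p N) ^ k * (\<Prod>i\<in>S. c i) / real (Yodd p n) \<in> \<int>"
      by (metis Ints_of_nat minus_in_Ints_iff abs_if)
  qed
  finally show "real (Dall p N) ^ k * fps_nth (fps_const (1 / real (Yodd p n)) * (\<Prod>i<n. fps_of_poly [:c i, b i:])) k \<in> \<int>" .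
qed

end

section \<open>Growth of the common divisor\<close>

lemma card_multiples_upto: "d > 0 \<Longrightarrow> card {i \<in> {1..n}. d dvd i} = n div d" for d n :: nat
proof -
  assume d: "d > 0"
  have "bij_betw (\<lambda>t. t * d) {1..n div d} {i \<in> {1..n}. d dvd i}"
    using d by (intro bij_betw_byWitness[where f' = "\<lambda>i. i div d"])
      (auto simp: mult.commute Suc_le_eq less_eq_div_iff_mult_less_eq div_greater_zero_iff dest: dvd_imp_le elim!: dvdE intro: div_le_mono)
  from bij_betw_same_card[OF this] show ?thesis by simp
qed

context
  fixes p :: int
  assumes p: "\<bar>p\<bar> \<ge> 2"
begin

text \<open>Regrouped by multiples, the logarithm is the sum G over i \<le> n of \<open>w i\<close>,
  the contribution of the odd divisors of i. As w (2 i) = w i, and w i = ln |p^i - 1| for odd i, one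
  has G (2 n) = G n + E n with E n near \<kappa> n^2. A growth of c \<kappa> n^2 fits this when 4 c
  = c + 1, whence the constant 1 / 3.\<close>

lemma ln_Yodd_asymp: "(\<lambda>n. ln (real (Yodd p n)) / real n ^ 2) \<longlonglongrightarrow> ln \<bar>real_of_int p\<bar> / 3"
proof -
  define \<kappa> where "\<kappa> = ln \<bar>real_of_int p\<bar>"
  have \<kappa>: "\<kappa> > 0" unfolding \<kappa>_def using p by (intro ln_gt_zero) linarith
  define w where "w i = (\<Sum>d | odd d \<and> d dvd i. ln (real (prim_part p d)))" for i
  define G where "G n = (\<Sum>i\<in>{1..n}. w i)" for n
  have lnY: "ln (real (Yodd p n)) = G n" for n
  proof -
    define Od where "Od = {d. odd d} \<inter> {1..n}"
    have "ln (real (Yodd p n)) = (\<Sum>d\<in>Od. real (n div d) * ln (real (prim_part p d)))"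
    proof -
      have "ln (\<Prod>d\<in>Od. real (prim_part p d) ^ (n div d)) = (\<Sum>d\<in>Od. ln (real (prim_part p d) ^ (n div d)))"
        using prim_part_pos[OF p] by (intro ln_prod) (auto simp: Od_def)
      also have "\<dots> = (\<Sum>d\<in>Od. real (n div d) * ln (real (prim_part p d)))"
        by (intro sum.cong refl ln_realpow)
      finally show ?thesis by (simp add: Yodd_def Od_def)
    qed
    also have "\<dots> = (\<Sum>d\<in>Od. \<Sum>i\<in>{1..n}. if d dvd i then ln (real (prim_part p d)) else 0)"
    proof (intro sum.cong refl)
      fix d assume "d \<in> Od"
      hence "d > 0" by (auto simp: Od_def)
      hence "real (n div d) * ln (real (prim_part p d)) = (\<Sum>i\<in>{i\<in>{1..n}. d dvd i}. ln (real (prim_part p d)))"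
        by (simp only: card_multiples_upto sum_constant)
      also have "\<dots> = (\<Sum>i\<in>{1..n}. if d dvd i then ln (real (prim_part p d)) else 0)"
        by (rule sum.inter_filter) auto
      finally show "real (n div d) * ln (real (prim_part p d)) = (\<Sum>i\<in>{1..n}. if d dvd i then ln (real (prim_part p d)) else 0)" .
    qed
    also have "\<dots> = (\<Sum>i\<in>{1..n}. \<Sum>d\<in>Od. if d dvd i then ln (real (prim_part p d)) else 0)" by (rule sum.swap)
    also have "\<dots> = G n" unfolding G_def w_def
    proof (rule sum.cong[OF refl])
      fix i assume i: "i \<in> {1..n}"
      have "(\<Sum>d\<in>Od. if d dvd i then ln (real (prim_part p d)) else 0) = (\<Sum>d\<in>{d\<in>Od. d dvd i}. ln (real (prim_part p d)))"
        by (rule sum.inter_filter[symmetric]) (auto simp: Od_def)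
      also have "{d\<in>Od. d dvd i} = {d. odd d \<and> d dvd i}"
        using i by (auto simp: Od_def Suc_le_eq dest: dvd_imp_le intro: gr0I)
      finally show "(\<Sum>d\<in>Od. if d dvd i then ln (real (prim_part p d)) else 0) = (\<Sum>d | odd d \<and> d dvd i. ln (real (prim_part p d)))" .
    qed
    finally show ?thesis .
  qed
  have w_even: "w (2 * i) = w i" for i
  proof -
    have "odd d \<and> d dvd 2 * i \<longleftrightarrow> odd d \<and> d dvd i" for d :: nat
      using coprime_dvd_mult_right_iff[of d 2 i] by (auto simp: coprime_right_2_iff_odd)
    thus ?thesis unfolding w_def by (intro sum.cong) auto
  qed
  have w_odd: "w i = ln (real (abs_pm1 p i))" if "odd i" for i
  proof -
    have i0: "i > 0" using that by (auto intro: gr0I)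
    have "{d. odd d \<and> d dvd i} = {d. d dvd i}" using that dvd_trans by blast
    hence "w i = ln (\<Prod>d | d dvd i. real (prim_part p d))"
      unfolding w_def using i0 prim_part_pos[OF p] by (subst ln_prod) (auto intro: dvd_pos_nat)
    also have "\<dots> = ln (real (abs_pm1 p i))" by (simp flip: prod_prim_part[OF p i0])
    finally show ?thesis .
  qed
  define E where "E n = (\<Sum>i<n. ln (real (abs_pm1 p (2 * i + 1))))" for n
  have E: "\<bar>E n - \<kappa> * real n ^ 2\<bar> \<le> real n * ln 2" for n
  proof (induction n)
    case (Suc n)
    have "\<bar>ln (real (abs_pm1 p (2 * n + 1))) - real (2 * n + 1) * \<kappa>\<bar> \<le> ln 2"
      unfolding \<kappa>_def by (rule ln_abs_pm1_bounds[OF p]) simp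
    moreover have "E (Suc n) - \<kappa> * real (Suc n) ^ 2 = (E n - \<kappa> * real n ^ 2) + (ln (real (abs_pm1 p (2 * n + 1))) - real (2 * n + 1) * \<kappa>)"
      by (simp add: E_def power2_eq_square algebra_simps)
    moreover have "real (Suc n) * ln 2 = real n * ln 2 + ln 2" by (simp add: algebra_simps)
    ultimately show ?case using Suc.IH by linarith
  qed (simp add: E_def)
  have G_even: "G (2 * n) = G n + E n" for n
  proof (induction n)
    case (Suc n)
    have "G (2 * Suc n) = G (2 * n) + w (2 * n + 1) + w (2 * (n + 1))" by (simp add: G_def)
    also have "\<dots> = G (Suc n) + E (Suc n)" unfolding w_even using Suc.IH w_odd[of "2 * n + 1"] by (simp add: G_def E_def)
    finally show ?case .
  qed (simp add: G_def E_def)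
  have G_odd: "G (2 * n + 1) = G n + E (n + 1)" for n
    using G_even[of n] w_odd[of "2 * n + 1"] by (simp add: G_def E_def)
  \<comment> \<open>Large enough for both halving steps: for n = 2 m + 1 the new error is at most (m
    + 1) ln 2 + \<kappa> (2 m + 2) / 3, which is below C (m + 1).\<close>
  define C where "C = ln 2 + \<kappa>"
  have C: "\<bar>G n - \<kappa> * real n ^ 2 / 3\<bar> \<le> C * real n" for n
  proof (induction n rule: less_induct)
    case (less n)
    show ?case
    proof (cases "n = 0")
      case False
      have l2: "ln 2 > (0::real)" by simp
      consider m where "n = 2 * m" "m < n" | m where "n = 2 * m + 1" "m < n"
        using False by (cases "even n") (auto elim!: evenE oddE)
      thus ?thesis
      proof cases
        case 1
        have "G n - \<kappa> * real n ^ 2 / 3 = (G m - \<kappa> * real m ^ 2 / 3) + (E m - \<kappa> * real m ^ 2)"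
          unfolding 1(1) G_even by (simp add: power_mult_distrib)
        moreover have "C * real m + real m * ln 2 \<le> C * real n"
          unfolding C_def 1(1) using \<kappa> l2 by (simp add: algebra_simps)
        ultimately show ?thesis using less.IH[OF 1(2)] E[of m] by linarith
      next
        case 2
        have "G n - \<kappa> * real n ^ 2 / 3 = (G m - \<kappa> * real m ^ 2 / 3) + (E (m + 1) - \<kappa> * real (m + 1) ^ 2) + \<kappa> * (2 * real m + 2) / 3"
          unfolding 2(1) G_odd by (simp add: power2_eq_square field_simps)
        moreover have "C * real m + (real (m + 1) * ln 2 + \<kappa> * (2 * real m + 2) / 3) \<le> C * real n"
        proof -
          have "\<kappa> * (2 * real m + 2) / 3 \<le> \<kappa> * (real m + 1)" using \<kappa> by (simp add: field_simps)
          thus ?thesis unfolding C_def 2(1) by (simp add: algebra_simps)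
        qed
        moreover have "\<kappa> * (2 * real m + 2) / 3 \<ge> 0" using \<kappa> by simp
        ultimately show ?thesis using less.IH[OF 2(2)] E[of "m + 1"] by linarith
      qed
    qed (simp add: G_def)
  qed
  have "(\<lambda>n. G n / real n ^ 2 - \<kappa> / 3) \<longlonglongrightarrow> 0"
  proof (rule Lim_null_comparison)
    show "\<forall>\<^sub>F n in sequentially. norm (G n / real n ^ 2 - \<kappa> / 3) \<le> C / real n"
      using eventually_gt_at_top[of 0]
    proof eventually_elim
      case (elim n)
      have "norm (G n / real n ^ 2 - \<kappa> / 3) = \<bar>G n - \<kappa> * real n ^ 2 / 3\<bar> / real n ^ 2"
      proof -
        have "G n / real n ^ 2 - \<kappa> / 3 = (G n - \<kappa> * real n ^ 2 / 3) / real n ^ 2"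
          using elim by (simp add: diff_divide_distrib)
        thus ?thesis by simp
      qed
      also have "\<dots> \<le> C * real n / real n ^ 2" by (intro divide_right_mono C) auto
      also have "\<dots> = C / real n" using elim by (simp add: power2_eq_square)
      finally show ?case .
    qed
    show "(\<lambda>n. C / real n) \<longlonglongrightarrow> 0" by (rule lim_const_over_n)
  qed
  thus ?thesis unfolding lnY \<kappa>_def by (rule LIM_zero_cancel)
qed

end

section \<open>Expansion of the beta series\<close>

lemma summable_power_mult_geometric:
  fixes x :: real
  assumes "\<bar>x\<bar> < 1"
  shows "summable (\<lambda>k. real (k + 1) ^ t * x ^ k)"
proof (induction t)
  case 0
  show ?case using assms by (simp add: summable_geometric)
next
  case (Suc t)
  show ?case
  proof (cases "x = 0")
    case True
    have "summable (\<lambda>k. if k = 0 then 1 else 0 :: real)" by (rule summable_single)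
    also have "(\<lambda>k. if k = 0 then 1 else 0 :: real) = (\<lambda>k. real (k + 1) ^ Suc t * x ^ k)"
      using True by (auto simp: power_0_left)
    finally show ?thesis .
  next
    case False
    have x0: "\<bar>x\<bar> > 0" using False by simp
    define c where "c = (1 + \<bar>x\<bar>) / 2"
    have c: "c < 1" "\<bar>x\<bar> < c" using assms by (auto simp: c_def field_simps)
    have "(\<lambda>k. (1 + 1 / real (Suc k)) ^ Suc t * \<bar>x\<bar>) \<longlonglongrightarrow> (1 + 0) ^ Suc t * \<bar>x\<bar>"
      by (intro tendsto_intros LIMSEQ_Suc[OF lim_1_over_n])
    hence "\<forall>\<^sub>F k in sequentially. (1 + 1 / real (Suc k)) ^ Suc t * \<bar>x\<bar> < c"
      using c by (intro order_tendstoD(2)) auto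
    then obtain K where K: "\<And>k. k \<ge> K \<Longrightarrow> (1 + 1 / real (Suc k)) ^ Suc t * \<bar>x\<bar> < c"
      by (auto simp: eventually_sequentially)
    show ?thesis
    proof (rule summable_ratio_test[OF c(1)])
      fix k assume "k \<ge> K"
      have "real (Suc k + 1) = real (k + 1) * (1 + 1 / real (Suc k))" by (simp add: field_simps)
      hence "norm (real (Suc k + 1) ^ Suc t * x ^ Suc k) = ((1 + 1 / real (Suc k)) ^ Suc t * \<bar>x\<bar>) * (real (k + 1) ^ Suc t * \<bar>x\<bar> ^ k)"
        by (simp only: power_mult_distrib norm_mult norm_power real_norm_def abs_of_nonneg of_nat_0_le_iff
            abs_mult power_abs power_Suc ac_simps) (simp add: abs_mult power_abs)
      also have "\<dots> \<le> c * (real (k + 1) ^ Suc t * \<bar>x\<bar> ^ k)"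
        using K[OF \<open>k \<ge> K\<close>] by (intro mult_right_mono) auto
      finally show "norm (real (Suc k + 1) ^ Suc t * x ^ Suc k) \<le> c * norm (real (k + 1) ^ Suc t * x ^ k)"
        by (simp add: abs_mult power_abs)
    qed
  qed
qed

text \<open>
  For \<open>t \<ge> 1\<close> this is the polylogarithm of order \<open>1 - t\<close>; the subtraction truncates at \<open>t = 0\<close>.
\<close>

definition polylog_neg :: "nat \<Rightarrow> real \<Rightarrow> real" where
  "polylog_neg t x = (\<Sum>k. real (k + 1) ^ (t - 1) * x ^ (k + 1))"

lemma polylog_neg_sums:
  assumes "\<bar>x\<bar> < 1"
  shows "(\<lambda>k. real (k + 1) ^ (t - 1) * x ^ (k + 1)) sums polylog_neg t x"
proof -
  have "summable (\<lambda>k. x * (real (k + 1) ^ (t - 1) * x ^ k))"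
    by (intro summable_mult summable_power_mult_geometric assms)
  also have "(\<lambda>k. x * (real (k + 1) ^ (t - 1) * x ^ k)) = (\<lambda>k. real (k + 1) ^ (t - 1) * x ^ (k + 1))"
    by (simp add: fun_eq_iff)
  finally show ?thesis unfolding polylog_neg_def by (rule summable_sums)
qed

text \<open>For s \<ge> 1 its value at a positive integer k is (s - 1)! times the binomial
  coefficient of k - 1 over s - 1, and its coefficient of index t - 1 is the signed Stirling number
  of the first kind for s and t.\<close>

definition falling_poly :: "nat \<Rightarrow> real poly" where
  "falling_poly s = (\<Prod>i\<in>{1..<s}. [:- real i, 1:])"

lemma falling_poly_Suc: "s \<ge> 1 \<Longrightarrow> falling_poly (Suc s) = falling_poly s * [:- real s, 1:]"
  by (simp add: falling_poly_def)

lemma poly_falling_poly: "poly (falling_poly s) y = (\<Prod>i\<in>{1..<s}. y - real i)"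
  by (simp add: falling_poly_def poly_prod)

text \<open>A discrete power rule. Multiplying a generating series by 1 - x takes differences of its
  coefficients, so this identity carries the induction on s in the two series evaluations
  below.\<close>

lemma falling_poly_diff: "s \<ge> 1 \<Longrightarrow> poly (falling_poly (Suc s)) y - poly (falling_poly (Suc s)) (y - 1) = real s * poly (falling_poly s) (y - 1)"
proof -
  assume s: "s \<ge> 1"
  have "(\<Prod>i\<in>{1..<Suc s}. y - real i) = (\<Prod>i\<in>{0..<s}. y - real (Suc i))"
    using prod.shift_bounds_Suc_ivl[of "\<lambda>i. y - real i" 0 s] by simp
  also have "\<dots> = (y - 1) * (\<Prod>i\<in>{1..<s}. y - real (Suc i))"
    using s prod.atLeast_Suc_lessThan[of 0 s "\<lambda>i. y - real (Suc i)"] by simp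
  also have "(\<Prod>i\<in>{1..<s}. y - real (Suc i)) = (\<Prod>i\<in>{1..<s}. y - 1 - real i)"
    by (intro prod.cong refl) simp
  finally have 1: "poly (falling_poly (Suc s)) y = (y - 1) * poly (falling_poly s) (y - 1)" by (simp only: poly_falling_poly)
  have 2: "poly (falling_poly (Suc s)) (y - 1) = poly (falling_poly s) (y - 1) * (y - 1 - real s)"
    unfolding falling_poly_Suc[OF s] poly_mult by simp
  show ?thesis unfolding 1 2 by (simp only: algebra_simps)
qed

lemma degree_falling_poly: "degree (falling_poly s) = s - 1"
  unfolding falling_poly_def by (subst degree_prod_eq_sum_degree) auto

lemma coeff_falling_poly_Ints: "coeff (falling_poly s) k \<in> \<int>"
proof -
  have "\<forall>k. coeff (\<Prod>i\<in>S. [:- real i, 1:]) k \<in> \<int>" if "finite S" for S :: "nat set"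
    using that
  proof (induction S rule: finite_induct)
    case (insert i S)
    show ?case
    proof
      fix k
      have "coeff [:- real i, 1:] j \<in> \<int>" for j by (auto simp: coeff_pCons split: nat.splits)
      thus "coeff (\<Prod>i\<in>insert i S. [:- real i, 1:]) k \<in> \<int>"
        using insert by (simp add: coeff_mult del: mult_pCons_left) (intro Ints_sum Ints_mult, auto)
    qed
  qed (auto simp: coeff_1)
  thus ?thesis by (simp add: falling_poly_def)
qed

lemma poly_falling_poly_altdef: "s \<ge> 1 \<Longrightarrow> poly (falling_poly s) y = (\<Sum>t=1..s. coeff (falling_poly s) (t - 1) * y ^ (t - 1))"
proof -
  assume s: "s \<ge> 1"
  have "poly (falling_poly s) y = (\<Sum>i\<le>s - 1. coeff (falling_poly s) i * y ^ i)" by (simp add: poly_altdef degree_falling_poly)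
  also have "\<dots> = (\<Sum>t=1..s. coeff (falling_poly s) (t - 1) * y ^ (t - 1))"
    using s by (intro sum.reindex_bij_witness[where i = "\<lambda>t. t - 1" and j = Suc]) auto
  finally show ?thesis .
qed

lemma poly_series_summable:
  fixes x :: real
  assumes "\<bar>x\<bar> < 1"
  shows "summable (\<lambda>k. poly P (real (k + 1)) * x ^ k)"
proof -
  have "summable (\<lambda>k. \<Sum>i\<le>degree P. coeff P i * (real (k + 1) ^ i * x ^ k))"
    by (intro summable_sum summable_mult summable_power_mult_geometric assms)
  thus ?thesis by (simp add: poly_altdef sum_distrib_right mult.assoc)
qed

lemma sums_mult_one_minus:
  fixes x :: real and u :: "nat \<Rightarrow> real"
  assumes "summable (\<lambda>k. u k * x ^ k)"
  shows "(\<lambda>k. (u k - (if k = 0 then 0 else u (k - 1))) * x ^ k) sums ((1 - x) * (\<Sum>k. u k * x ^ k))"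
proof -
  define U where "U = (\<Sum>k. u k * x ^ k)"
  have U: "(\<lambda>k. u k * x ^ k) sums U" using assms unfolding U_def by (rule summable_sums)
  have "(\<lambda>k. x * (u k * x ^ k)) sums (x * U)" by (rule sums_mult[OF U])
  hence "(\<lambda>k. (if Suc k = 0 then 0 else u (Suc k - 1) * x ^ Suc k)) sums (x * U)" by (simp add: ac_simps)
  hence "(\<lambda>k. (if k = 0 then 0 else u (k - 1) * x ^ k)) sums (x * U)"
    using sums_Suc[where f = "\<lambda>k. if k = 0 then 0 else u (k - 1) * x ^ k" and l = "x * U"] by simp
  from sums_diff[OF U this] have "(\<lambda>k. u k * x ^ k - (if k = 0 then 0 else u (k - 1) * x ^ k)) sums ((1 - x) * U)"
    by (simp add: algebra_simps)
  also have "(\<lambda>k. u k * x ^ k - (if k = 0 then 0 else u (k - 1) * x ^ k)) =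
     (\<lambda>k. (u k - (if k = 0 then 0 else u (k - 1))) * x ^ k)" by (auto simp: algebra_simps)
  finally show ?thesis by (simp add: U_def)
qed

lemma sums_drop_zero: "f sums S \<Longrightarrow> f 0 = 0 \<Longrightarrow> (\<lambda>k. f (Suc k)) sums S"
  for f :: "nat \<Rightarrow> real"
  by (simp add: sums_Suc_iff)

lemma falling_poly_series_pos:
  fixes x :: real
  assumes x: "\<bar>x\<bar> < 1"
  shows "(\<Sum>k. poly (falling_poly (Suc s)) (real (k + 1)) * x ^ k) = fact s * x ^ s / (1 - x) ^ Suc s"
proof (induction s)
  case 0
  show ?case using x by (simp add: falling_poly_def suminf_geometric)
next
  case (Suc s)
  let ?u = "\<lambda>s k. poly (falling_poly s) (real (k + 1))"
  have "(\<lambda>k. (?u (Suc (Suc s)) k - (if k = 0 then 0 else ?u (Suc (Suc s)) (k - 1))) * x ^ k) sums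
      ((1 - x) * (\<Sum>k. ?u (Suc (Suc s)) k * x ^ k))"
    by (intro sums_mult_one_minus poly_series_summable x)
  also have "(\<lambda>k. (?u (Suc (Suc s)) k - (if k = 0 then 0 else ?u (Suc (Suc s)) (k - 1))) * x ^ k) =
     (\<lambda>k. if k = 0 then 0 else real (Suc s) * x * (?u (Suc s) (k - 1) * x ^ (k - 1)))"
  proof
    fix k
    show "(?u (Suc (Suc s)) k - (if k = 0 then 0 else ?u (Suc (Suc s)) (k - 1))) * x ^ k =
      (if k = 0 then 0 else real (Suc s) * x * (?u (Suc s) (k - 1) * x ^ (k - 1)))"
    proof (cases k)
      case 0
      thus ?thesis by (auto simp: poly_falling_poly)
    next
      case (Suc j)
      have "?u (Suc (Suc s)) (Suc j) - ?u (Suc (Suc s)) j = real (Suc s) * ?u (Suc s) j"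
        using falling_poly_diff[of "Suc s" "real (Suc j + 1)"] by (simp add: add.commute)
      thus ?thesis using Suc by simp
    qed
  qed
  finally have "(\<lambda>k. if k = 0 then 0 else real (Suc s) * x * (?u (Suc s) (k - 1) * x ^ (k - 1))) sums
      ((1 - x) * (\<Sum>k. ?u (Suc (Suc s)) k * x ^ k))" .
  from sums_drop_zero[OF this]
  have "(\<lambda>k. real (Suc s) * x * (?u (Suc s) k * x ^ k)) sums ((1 - x) * (\<Sum>k. ?u (Suc (Suc s)) k * x ^ k))"
    by simp
  moreover have "(\<lambda>k. real (Suc s) * x * (?u (Suc s) k * x ^ k)) sums (real (Suc s) * x * (fact s * x ^ s / (1 - x) ^ Suc s))"
    using Suc.IH poly_series_summable[OF x, of "falling_poly (Suc s)"] by (intro sums_mult) (simp add: sums_iff)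
  ultimately have "(1 - x) * (\<Sum>k. ?u (Suc (Suc s)) k * x ^ k) = real (Suc s) * x * (fact s * x ^ s / (1 - x) ^ Suc s)"
    by (rule sums_unique2)
  moreover have "1 - x \<noteq> 0" using x by auto
  ultimately have "(\<Sum>k. ?u (Suc (Suc s)) k * x ^ k) = real (Suc s) * x * (fact s * x ^ s / (1 - x) ^ Suc s) / (1 - x)"
    by (metis nonzero_mult_div_cancel_left)
  also have "\<dots> = real (Suc s) * fact s * (x * x ^ s) / ((1 - x) * (1 - x) ^ Suc s)"
    by (simp only: times_divide_eq_right divide_divide_eq_left ac_simps)
  finally show ?case by (simp only: power_Suc fact_Suc)
qed

text \<open>The same recursion with the polynomial taken at the non-positive integers; this series
  supplies the identity that corresponds to replacing x by 1 / x.\<close>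

lemma falling_poly_series_neg:
  fixes x :: real
  assumes x: "\<bar>x\<bar> < 1"
  shows "(\<Sum>k. poly (falling_poly (Suc s)) (- real k) * x ^ k) = (-1) ^ s * fact s / (1 - x) ^ Suc s"
proof (induction s)
  case 0
  show ?case using x by (simp add: falling_poly_def suminf_geometric)
next
  case (Suc s)
  let ?u = "\<lambda>s k. poly (falling_poly s) (- real k)"
  have summ: "summable (\<lambda>k. ?u s k * x ^ k)" for s
  proof -
    have "?u s k = poly (pcompose (falling_poly s) [:1, -1:]) (real (k + 1))" for k by (simp add: poly_pcompose)
    thus ?thesis using poly_series_summable[OF x, of "pcompose (falling_poly s) [:1, -1:]"] by simp
  qed
  have "(\<lambda>k. (?u (Suc (Suc s)) k - (if k = 0 then 0 else ?u (Suc (Suc s)) (k - 1))) * x ^ k) sums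
      ((1 - x) * (\<Sum>k. ?u (Suc (Suc s)) k * x ^ k))"
    by (intro sums_mult_one_minus summ)
  also have "(\<lambda>k. (?u (Suc (Suc s)) k - (if k = 0 then 0 else ?u (Suc (Suc s)) (k - 1))) * x ^ k) =
     (\<lambda>k. - real (Suc s) * (?u (Suc s) k * x ^ k))"
  proof
    fix k
    show "(?u (Suc (Suc s)) k - (if k = 0 then 0 else ?u (Suc (Suc s)) (k - 1))) * x ^ k =
      - real (Suc s) * (?u (Suc s) k * x ^ k)"
    proof (cases k)
      case 0
      thus ?thesis by (simp add: falling_poly_Suc)
    next
      case (Suc j)
      have "?u (Suc (Suc s)) j - ?u (Suc (Suc s)) (Suc j) = real (Suc s) * ?u (Suc s) (Suc j)"
      proof -
        have "- real j - 1 = - real (Suc j)" by simp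
        thus ?thesis using falling_poly_diff[of "Suc s" "- real j"] by (simp only:) 
      qed
      hence "?u (Suc (Suc s)) (Suc j) - ?u (Suc (Suc s)) j = - real (Suc s) * ?u (Suc s) (Suc j)" by linarith
      thus ?thesis using Suc by simp
    qed
  qed
  finally have "(\<lambda>k. - real (Suc s) * (?u (Suc s) k * x ^ k)) sums ((1 - x) * (\<Sum>k. ?u (Suc (Suc s)) k * x ^ k))" .
  moreover have "(\<lambda>k. - real (Suc s) * (?u (Suc s) k * x ^ k)) sums (- real (Suc s) * ((-1) ^ s * fact s / (1 - x) ^ Suc s))"
    using Suc.IH summ[of "Suc s"] by (intro sums_mult) (simp add: sums_iff)
  ultimately have "(1 - x) * (\<Sum>k. ?u (Suc (Suc s)) k * x ^ k) = - real (Suc s) * ((-1) ^ s * fact s / (1 - x) ^ Suc s)"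
    by (rule sums_unique2)
  moreover have "1 - x \<noteq> 0" using x by auto
  ultimately have "(\<Sum>k. ?u (Suc (Suc s)) k * x ^ k) = - real (Suc s) * ((-1) ^ s * fact s / (1 - x) ^ Suc s) / (1 - x)"
    by (metis nonzero_mult_div_cancel_left)
  also have "\<dots> = - real (Suc s) * ((-1) ^ s * fact s) / ((1 - x) * (1 - x) ^ Suc s)"
    by (simp only: times_divide_eq_right divide_divide_eq_left ac_simps)
  also have "- real (Suc s) * ((-1) ^ s * fact s) = (-1) ^ Suc s * fact (Suc s)"
    unfolding fact_Suc by (simp add: algebra_simps)
  finally show ?case by (simp only: power_Suc)
qed

text \<open>Up to a factorial the values of \<open>falling_poly s\<close> are binomial coefficients,
  and these generate (x / (1 - x))^s. In this way the s-th powers of a partial fraction expansion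
  become combinations of polylogarithms.\<close>

lemma sum_falling_poly_Li:
  assumes x: "\<bar>x\<bar> < 1" and s: "s \<ge> 1"
  shows "(\<Sum>t=1..s. coeff (falling_poly s) (t - 1) * polylog_neg t x) = fact (s - 1) * (x / (1 - x)) ^ s"
proof -
  have "(\<lambda>k. \<Sum>t=1..s. coeff (falling_poly s) (t - 1) * (real (k + 1) ^ (t - 1) * x ^ (k + 1))) sums
     (\<Sum>t=1..s. coeff (falling_poly s) (t - 1) * polylog_neg t x)"
    by (intro sums_sum sums_mult polylog_neg_sums x)
  also have "(\<lambda>k. \<Sum>t=1..s. coeff (falling_poly s) (t - 1) * (real (k + 1) ^ (t - 1) * x ^ (k + 1))) =
     (\<lambda>k. x * (poly (falling_poly s) (real (k + 1)) * x ^ k))"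
    by (simp add: poly_falling_poly_altdef[OF s] sum_distrib_left sum_distrib_right ac_simps)
  finally have 1: "(\<lambda>k. x * (poly (falling_poly s) (real (k + 1)) * x ^ k)) sums (\<Sum>t=1..s. coeff (falling_poly s) (t - 1) * polylog_neg t x)" .
  obtain s' where s': "s = Suc s'" using s by (cases s) auto
  have "(\<lambda>k. x * (poly (falling_poly s) (real (k + 1)) * x ^ k)) sums (x * (fact s' * x ^ s' / (1 - x) ^ Suc s'))"
    using falling_poly_series_pos[OF x, of s'] poly_series_summable[OF x, of "falling_poly s"] unfolding s'
    by (intro sums_mult) (simp add: sums_iff)
  from sums_unique2[OF 1 this] show ?thesis by (simp add: s' power_divide)
qed

text \<open>
  The preceding lemma after \<open>x \<mapsto> 1 / x\<close>: then \<open>x / (1 - x)\<close> becomes \<open>- 1 - x / (1 - x)\<close>, and the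
  polylogarithm of order \<open>1 - t\<close> gets the sign \<open>(-1) ^ t\<close>, except for the constant term when \<open>t = 1\<close>.
\<close>

lemma sum_falling_poly_Li_alternating:
  assumes x: "\<bar>x\<bar> < 1" and s: "s \<ge> 1"
  shows "(\<Sum>t=1..s. coeff (falling_poly s) (t - 1) * ((-1) ^ t * polylog_neg t x)) =
     fact (s - 1) * (-1 - x / (1 - x)) ^ s - (-1) ^ s * fact (s - 1)"
proof -
  have x1: "1 - x \<noteq> 0" using x by auto
  obtain s' where s': "s = Suc s'" using s by (cases s) auto
  have "(\<lambda>k. \<Sum>t=1..s. coeff (falling_poly s) (t - 1) * ((-1) ^ t * (real (k + 1) ^ (t - 1) * x ^ (k + 1)))) sums
     (\<Sum>t=1..s. coeff (falling_poly s) (t - 1) * ((-1) ^ t * polylog_neg t x))"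
    by (intro sums_sum sums_mult polylog_neg_sums x)
  also have "(\<lambda>k. \<Sum>t=1..s. coeff (falling_poly s) (t - 1) * ((-1) ^ t * (real (k + 1) ^ (t - 1) * x ^ (k + 1)))) =
     (\<lambda>k. - (poly (falling_poly s) (- real (Suc k)) * x ^ Suc k))"
  proof
    fix k
    have "(-1) ^ t * real (k + 1) ^ (t - 1) = - ((- real (Suc k)) ^ (t - 1))" if t: "t \<in> {1..s}" for t
    proof -
      obtain t' where t': "t = Suc t'" using t by (cases t) auto
      have "(- real (Suc k)) ^ t' = (-1) ^ t' * real (k + 1) ^ t'" unfolding power_minus[of "real (Suc k)"] by simp
      thus ?thesis by (simp add: t')
    qed
    hence "(\<Sum>t=1..s. coeff (falling_poly s) (t - 1) * ((-1) ^ t * (real (k + 1) ^ (t - 1) * x ^ (k + 1)))) =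
       (\<Sum>t=1..s. coeff (falling_poly s) (t - 1) * (- ((- real (Suc k)) ^ (t - 1)) * x ^ (k + 1)))"
      by (intro sum.cong refl) (simp only: mult.assoc[symmetric])
    also have "\<dots> = - (poly (falling_poly s) (- real (Suc k)) * x ^ Suc k)"
      unfolding poly_falling_poly_altdef[OF s] sum_distrib_right sum_negf[symmetric] by (intro sum.cong refl) simp
    finally show "(\<Sum>t=1..s. coeff (falling_poly s) (t - 1) * ((-1) ^ t * (real (k + 1) ^ (t - 1) * x ^ (k + 1)))) =
       - (poly (falling_poly s) (- real (Suc k)) * x ^ Suc k)" .
  qed
  finally have 1: "(\<lambda>k. - (poly (falling_poly s) (- real (Suc k)) * x ^ Suc k)) sums (\<Sum>t=1..s. coeff (falling_poly s) (t - 1) * ((-1) ^ t * polylog_neg t x))" .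
  have "(\<lambda>k. poly (falling_poly s) (- real k) * x ^ k) sums ((-1) ^ s' * fact s' / (1 - x) ^ Suc s')"
  proof -
    have "poly (falling_poly s) (- real k) = poly (pcompose (falling_poly s) [:1, -1:]) (real (k + 1))" for k by (simp add: poly_pcompose)
    hence "summable (\<lambda>k. poly (falling_poly s) (- real k) * x ^ k)"
      using poly_series_summable[OF x, of "pcompose (falling_poly s) [:1, -1:]"] by simp
    thus ?thesis using falling_poly_series_neg[OF x, of s'] by (simp add: sums_iff s')
  qed
  \<comment> \<open>The polylogarithm series starts at exponent 1, so the term k = 0 is removed; it
    becomes the correction by (-1)^s (s - 1)!.\<close>
  hence "(\<lambda>k. poly (falling_poly s) (- real (Suc k)) * x ^ Suc k) sums ((-1) ^ s' * fact s' / (1 - x) ^ Suc s' - poly (falling_poly s) 0)"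
    by (subst sums_Suc_iff) simp
  from sums_unique2[OF 1 sums_minus[OF this]]
  have "(\<Sum>t=1..s. coeff (falling_poly s) (t - 1) * ((-1) ^ t * polylog_neg t x)) = poly (falling_poly s) 0 - (-1) ^ s' * fact s' / (1 - x) ^ Suc s'"
    by simp
  moreover have "poly (falling_poly s) 0 = (-1) ^ s' * fact s'"
  proof -
    have "poly (falling_poly s) 0 = (\<Prod>i\<in>{1..<Suc s'}. - real i)" by (simp add: poly_falling_poly s')
    also have "\<dots> = (-1) ^ s' * fact s'" by (induction s') (simp_all add: algebra_simps)
    finally show ?thesis .
  qed
  moreover have "-1 - x / (1 - x) = - (1 / (1 - x))" using x1 by (simp add: field_simps)
  ultimately show ?thesis by (simp add: s' power_minus[of "1 / (1 - x)"] power_divide)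
qed

text \<open>Both sides are iterated sums of (-1)^i k^(t - 1) q^((2 i + 1) k) over i \<ge> 0 and k
  \<ge> 1: summed over k first it gives polylogarithms, summed over i first a geometric series of
  ratio -q^(2 k). The bound k^(t - 1) |q|^(2 i) |q|^k factorises and justifies the exchange.\<close>

lemma polylog_neg_alternating_sums:
  fixes q :: real
  assumes q: "\<bar>q\<bar> < 1"
  shows "(\<lambda>i. (-1) ^ i * polylog_neg t (q ^ (2 * i + 1))) sums
    (\<Sum>k. real (k + 1) ^ (t - 1) * (q ^ (k + 1) / (1 + q ^ (2 * (k + 1)))))"
proof -
  define f where "f i k = (-1) ^ i * (real (k + 1) ^ (t - 1) * (q ^ (2 * i + 1)) ^ (k + 1))" for i k :: nat
  define u where "u i = (\<bar>q\<bar> ^ 2) ^ i" for i :: nat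
  define v where "v k = real (k + 1) ^ (t - 1) * \<bar>q\<bar> ^ (k + 1)" for k :: nat
  have pw: "\<bar>q ^ (2 * i + 1)\<bar> < 1" for i
    using q by (simp add: power_abs power_less_one_iff del: power_Suc)
  have q2: "\<bar>q\<bar> ^ 2 < 1" using q by (simp add: abs_square_less_1)
  have "summable u" unfolding u_def using q2 by (intro summable_geometric) simp
  hence u: "u summable_on UNIV" by (subst summable_on_UNIV_nonneg_real_iff) (auto simp: u_def)
  have "v sums polylog_neg t \<bar>q\<bar>" unfolding v_def using q by (intro polylog_neg_sums) simp
  hence v: "(v has_sum polylog_neg t \<bar>q\<bar>) UNIV"
    by (intro sums_nonneg_imp_has_sum) (simp_all add: v_def)
  have uv: "(\<lambda>(i,k). u i * v k) summable_on (UNIV \<times> UNIV)"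
  proof (rule summable_on_SigmaI)
    show "((\<lambda>y. case (x, y) of (i, k) \<Rightarrow> u i * v k) has_sum u x * polylog_neg t \<bar>q\<bar>) UNIV" for x
      using has_sum_cmult_right[OF v, of "u x"] by simp
    show "(\<lambda>x. u x * polylog_neg t \<bar>q\<bar>) summable_on UNIV" by (rule summable_on_cmult_left[OF u])
  qed (auto simp: u_def v_def)
  have nf: "norm (f i k) \<le> u i * v k" for i k
  proof -
    have "\<bar>q\<bar> ^ ((2 * i + 1) * (k + 1)) \<le> \<bar>q\<bar> ^ (2 * i + (k + 1))"
      using q by (intro power_decreasing) auto
    also have "\<bar>q\<bar> ^ (2 * i + (k + 1)) = u i * \<bar>q\<bar> ^ (k + 1)" by (simp only: u_def power_add power_mult)
    finally have "real (k + 1) ^ (t - 1) * \<bar>q\<bar> ^ ((2 * i + 1) * (k + 1)) \<le> real (k + 1) ^ (t - 1) * (u i * \<bar>q\<bar> ^ (k + 1))"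
      by (intro mult_left_mono) auto
    moreover have "norm (f i k) = real (k + 1) ^ (t - 1) * \<bar>q\<bar> ^ ((2 * i + 1) * (k + 1))"
      unfolding f_def power_mult[symmetric] norm_mult norm_power by simp
    ultimately show ?thesis by (simp only: v_def ac_simps)
  qed
  have "(\<lambda>x. norm ((\<lambda>(i,k). f i k) x)) summable_on (UNIV \<times> UNIV)"
    by (rule Infinite_Sum.abs_summable_on_comparison_test'[OF uv]) (use nf in auto)
  hence f: "(\<lambda>(i,k). f i k) summable_on (UNIV \<times> UNIV)" by (rule abs_summable_summable)
  have inner1: "infsum (\<lambda>k. f i k) UNIV = (-1) ^ i * polylog_neg t (q ^ (2 * i + 1))" for i
  proof -
    have "(\<lambda>k. f i k) sums ((-1) ^ i * polylog_neg t (q ^ (2 * i + 1)))"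
      unfolding f_def by (intro sums_mult polylog_neg_sums pw)
    moreover have "(\<lambda>k. f i k) summable_on UNIV"
      using summable_on_SigmaD1[of "\<lambda>i k. f i k" UNIV "\<lambda>_. UNIV" i] f by simp
    ultimately show ?thesis using has_sum_imp_sums has_sum_infsum sums_unique2 by blast
  qed
  have inner2: "infsum (\<lambda>i. f i k) UNIV = real (k + 1) ^ (t - 1) * (q ^ (k + 1) / (1 + q ^ (2 * (k + 1))))" for k
  proof -
    define Q where "Q = q ^ (k + 1)"
    have Q: "\<bar>Q\<bar> < 1" using q unfolding Q_def power_abs by (simp add: power_less_one_iff del: power_Suc)
    hence Q2: "\<bar>- (Q ^ 2)\<bar> < 1" by (simp add: power_less_one_iff abs_square_less_1)
    have "(\<lambda>i. real (k + 1) ^ (t - 1) * (Q * (- (Q ^ 2)) ^ i)) sums (real (k + 1) ^ (t - 1) * (Q * (1 / (1 - - (Q ^ 2)))))"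
      using Q2 by (intro sums_mult geometric_sums) simp
    also have "(\<lambda>i. real (k + 1) ^ (t - 1) * (Q * (- (Q ^ 2)) ^ i)) = (\<lambda>i. f i k)"
    proof
      fix i
      have "(q ^ (2 * i + 1)) ^ (k + 1) = Q * (Q ^ 2) ^ i"
        unfolding Q_def by (simp only: power_mult[symmetric] power_add[symmetric]) (simp add: algebra_simps)
      thus "real (k + 1) ^ (t - 1) * (Q * (- (Q ^ 2)) ^ i) = f i k"
        by (simp only: f_def power_minus[of "Q ^ 2"] ac_simps)
    qed
    finally have "(\<lambda>i. f i k) sums (real (k + 1) ^ (t - 1) * (Q / (1 + Q ^ 2)))" by simp
    moreover have "(\<lambda>i. f i k) summable_on UNIV"
    proof -
      have "(\<lambda>(k,i). f i k) summable_on (UNIV \<times> UNIV)" using f by (subst summable_on_swap) simp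
      thus ?thesis using summable_on_SigmaD1[of "\<lambda>k i. f i k" UNIV "\<lambda>_. UNIV" k] by simp
    qed
    ultimately have "infsum (\<lambda>i. f i k) UNIV = real (k + 1) ^ (t - 1) * (Q / (1 + Q ^ 2))"
      using has_sum_imp_sums has_sum_infsum sums_unique2 by blast
    moreover have "Q ^ 2 = q ^ (2 * (k + 1))" unfolding Q_def by (simp only: power_mult[symmetric] mult.commute)
    ultimately show ?thesis by (simp only: Q_def)
  qed
  have "(\<lambda>i. infsum (\<lambda>k. f i k) UNIV) summable_on UNIV"
    using summable_on_Sigma_banach[of "\<lambda>i k. f i k" UNIV "\<lambda>_. UNIV"] f by simp
  hence "(\<lambda>i. infsum (\<lambda>k. f i k) UNIV) sums (infsum (\<lambda>i. infsum (\<lambda>k. f i k) UNIV) UNIV)"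
    by (intro has_sum_imp_sums has_sum_infsum)
  moreover have "infsum (\<lambda>i. infsum (\<lambda>k. f i k) UNIV) UNIV = infsum (\<lambda>k. infsum (\<lambda>i. f i k) UNIV) UNIV"
    by (rule infsum_swap_banach) (use f in simp)
  moreover have "(\<lambda>k. infsum (\<lambda>i. f i k) UNIV) sums (infsum (\<lambda>k. infsum (\<lambda>i. f i k) UNIV) UNIV)"
  proof -
    have "(\<lambda>(k,i). f i k) summable_on (UNIV \<times> UNIV)" using f by (subst summable_on_swap) simp
    hence "(\<lambda>k. infsum (\<lambda>i. f i k) UNIV) summable_on UNIV"
      using summable_on_Sigma_banach[of "\<lambda>k i. f i k" UNIV "\<lambda>_. UNIV"] by simp
    thus ?thesis by (intro has_sum_imp_sums has_sum_infsum)
  qed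
  ultimately show ?thesis unfolding inner1 inner2 by (simp add: sums_iff)
qed

lemma beta_q_of_real:
  fixes q :: real
  assumes "\<bar>q\<bar> < 1"
  shows "beta_q (of_real q) t = of_real (\<Sum>k. real (k + 1) ^ (t - 1) * (q ^ (k + 1) / (1 + q ^ (2 * (k + 1)))))"
proof -
  have Q: "\<bar>q ^ (k + 1)\<bar> < 1" for k
    using assms unfolding power_abs by (simp add: power_less_one_iff del: power_Suc)
  have "summable (\<lambda>k. real (k + 1) ^ (t - 1) * (q ^ (k + 1) / (1 + q ^ (2 * (k + 1)))))"
  proof (rule summable_comparison_test')
    show "summable (\<lambda>k. real (k + 1) ^ (t - 1) * \<bar>q\<bar> ^ (k + 1))"
      using polylog_neg_sums[of "\<bar>q\<bar>" t] assms by (simp add: sums_iff)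
    fix k :: nat
    have "q ^ (2 * (k + 1)) = (q ^ (k + 1)) ^ 2" by (simp only: power_mult[symmetric] mult.commute)
    hence "q ^ (2 * (k + 1)) \<ge> 0" by (simp only: zero_le_power2)
    hence "1 \<le> \<bar>1 + q ^ (2 * (k + 1))\<bar>" by linarith
    hence "\<bar>q ^ (k + 1)\<bar> / \<bar>1 + q ^ (2 * (k + 1))\<bar> \<le> \<bar>q ^ (k + 1)\<bar> / 1"
      by (intro divide_left_mono) auto
    hence "real (k + 1) ^ (t - 1) * (\<bar>q ^ (k + 1)\<bar> / \<bar>1 + q ^ (2 * (k + 1))\<bar>) \<le> real (k + 1) ^ (t - 1) * \<bar>q\<bar> ^ (k + 1)"
      unfolding power_abs by (intro mult_left_mono) auto
    thus "norm (real (k + 1) ^ (t - 1) * (q ^ (k + 1) / (1 + q ^ (2 * (k + 1))))) \<le> real (k + 1) ^ (t - 1) * \<bar>q\<bar> ^ (k + 1)"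
      by (simp only: real_norm_def abs_mult abs_divide abs_of_nonneg zero_le_power of_nat_0_le_iff)
  qed
  from suminf_of_real[OF this, where 'a = complex, symmetric] show ?thesis
    unfolding beta_q_def by simp
qed

section \<open>The rational function\<close>

lemma fps_of_poly_linear_scale:
  "fps_of_poly [:w * a, w * b:] = fps_const w * fps_of_poly [:a, b:]" for w :: "'a::comm_ring_1"
  by (rule fps_ext) (simp add: coeff_pCons split: nat.split)

lemma fps_const_prod: "fps_const (\<Prod>i\<in>S. f i) = (\<Prod>i\<in>S. fps_const (f i))" for f :: "'i \<Rightarrow> 'a::comm_ring_1"
  by (induction S rule: infinite_finite_induct) (simp_all flip: fps_const_mult)

lemma fps_inverse_const_mult:
  "inverse (fps_const a * f) = fps_const (1 / a) * inverse f" for a :: "'a::field"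
  by (simp add: fps_inverse_mult fps_const_inverse divide_inverse)

lemma inverse_fps_prod: "inverse (\<Prod>i\<in>S. f i) = (\<Prod>i\<in>S. inverse (f i))" for f :: "'i \<Rightarrow> 'a::field fps"
  by (induction S rule: infinite_finite_induct) (simp_all add: fps_inverse_mult)

lemma inverse_fps_prod_scaled:
  "inverse (\<Prod>i\<in>S. fps_const (w i) * f i) = fps_const (1 / (\<Prod>i\<in>S. w i)) * (\<Prod>i\<in>S. inverse (f i))"
  for w :: "'i \<Rightarrow> 'a::field"
  unfolding prod.distrib fps_const_prod[symmetric] fps_inverse_const_mult inverse_fps_prod ..

lemma fps_const_mult_mult:
  "(fps_const a * f) * (fps_const b * g) = fps_const (a * b) * (f * g)" for a b :: "'a::comm_ring_1"
  unfolding fps_const_mult[symmetric] by (simp only: mult.assoc mult.left_commute)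

text \<open>The parameter n is taken as 2 m: the degree balance defining e needs A (n + 1) odd, and
  for even n the signs (-1)^(n - j) and (-1)^j agree, so that two expansions of the sum can be
  combined.\<close>

locale beta_form =
  fixes p :: int and A r m :: nat
  assumes p: "\<bar>p\<bar> \<ge> 2" and A: "odd A" and r: "1 \<le> r" "2 * r < A" and m: "1 \<le> m"
begin

definition z :: real where "z = real_of_int p"
definition n :: nat where "n = 2 * m"

text \<open>
  The exponent \<open>e\<close> makes \<open>R\<close> invariant under \<open>X \<mapsto> z ^ (2 * n) / X\<close>, given the factor \<open>X - z ^ n\<close> that
  fixes the parity of the degree. The subtraction does not truncate, as \<open>2 * r < A\<close>.
\<close>

definition e :: nat where "e = (A div 2) * (2 * m + 1) + m - 2 * r * m"
definition P :: real where "P = (\<Prod>i=1..n. z ^ (2 * i) - 1)"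
definition Y :: real where "Y = real (Yodd p n)"
definition D :: real where "D = real (Dall p (2 * n))"

text \<open>
  The factors \<open>P ^ A\<close> and \<open>z ^ (A * m ^ 2)\<close> clear the denominators of \<open>g j\<close> at \<open>x = 0\<close>, while
  \<open>Y ^ (2 * r)\<close> is a common divisor contributed by the two products over \<open>i < r * n\<close> in \<open>N\<close>.
\<close>

definition \<kappa> :: real where "\<kappa> = P ^ A * z ^ (A * m ^ 2) / Y ^ (2 * r)"
definition N :: "real poly" where
  "N = smult \<kappa> ([:0, 1:] ^ e * [:- (z ^ n), 1:] * (\<Prod>i<r * n. [:- (z ^ (2 * n + 2 * i + 1)), 1:]) *
     (\<Prod>i<r * n. [:- 1, z ^ (2 * i + 1):]))"
definition R :: "real \<Rightarrow> real" where
  "R X = poly N X / (\<Prod>i\<le>n. X - z ^ (2 * i)) ^ A"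

text \<open>
  Expansion of \<open>(X - z ^ (2 * j)) ^ A * R X\<close> in \<open>x\<close>, where \<open>X = z ^ (2 * j) * (1 + x)\<close>, up to the power of
  \<open>z ^ (2 * j)\<close> restored in \<open>gn\<close>.
\<close>

definition g :: "nat \<Rightarrow> real fps" where
  "g j = fps_of_poly (pcompose N [:z ^ (2 * j), z ^ (2 * j):]) *
     inverse (\<Prod>i\<in>{..n} - {j}. fps_of_poly [:z ^ (2 * j) - z ^ (2 * i), z ^ (2 * j):]) ^ A"
definition gn :: "nat \<Rightarrow> real fps" where
  "gn j = fps_const (1 / (z ^ (2 * j)) ^ A) * g j"

lemma z_abs: "\<bar>z\<bar> \<ge> 2"
  using p unfolding z_def by linarith

lemma z_nz: "z \<noteq> 0"
  using z_abs by auto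

lemma z_Ints: "z \<in> \<int>"
  by (simp add: z_def)

lemma abs_a: "l > 0 \<Longrightarrow> \<bar>z ^ l - 1\<bar> = real (abs_pm1 p l)"
  by (simp add: real_abs_pm1 z_def)

lemma a_nz: "l > 0 \<Longrightarrow> z ^ l - 1 \<noteq> 0"
  using abs_pm1_pos[OF p, of l] abs_a[of l] by auto

lemma inj_powers: "inj_on (\<lambda>i. z ^ (2 * i)) UNIV"
proof (rule injI)
  fix i j assume "z ^ (2 * i) = z ^ (2 * j)"
  hence "\<bar>z\<bar> ^ (2 * i) = \<bar>z\<bar> ^ (2 * j)" by (metis power_abs)
  thus "i = j" using z_abs by (subst (asm) power_inject_exp) auto
qed

lemma e_eq: "e + 2 * r * m = (A div 2) * (2 * m + 1) + m"
proof -
  have "r \<le> A div 2" using r by simp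
  hence "r * (2 * m) \<le> (A div 2) * (2 * m)" by (intro mult_right_mono) auto
  moreover have "(A div 2) * (2 * m + 1) + m = (A div 2) * (2 * m) + (A div 2 + m)" by (simp add: distrib_left)
  ultimately have "2 * r * m \<le> (A div 2) * (2 * m + 1) + m" by (simp only: ac_simps)
  thus ?thesis unfolding e_def by simp
qed

lemma A_eq: "A = 2 * (A div 2) + 1"
  using A by presburger

text \<open>This balance of degrees makes R invariant under X \<mapsto> z^(2 n) / X; it also makes R
  decay like X^(-e) at infinity.\<close>

lemma two_e: "2 * e + 2 * r * n + 1 = A * (n + 1)"
proof -
  have "2 * e + 2 * r * n + 1 = 2 * (e + 2 * r * m) + 1" by (simp add: n_def)
  also have "\<dots> = 2 * ((A div 2) * (2 * m + 1) + m) + 1" by (simp only: e_eq)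
  also have "\<dots> = (2 * (A div 2) + 1) * (2 * m + 1)" by (simp add: algebra_simps)
  also have "\<dots> = A * (n + 1)" using A_eq by (simp add: n_def)
  finally show ?thesis .
qed

lemma e_ge: "e \<ge> m"
proof -
  have "2 * r * n \<le> (A - 1) * n" using r by (intro mult_right_mono) auto
  moreover have "A * n = (A - 1) * n + n" using r by (cases A) simp_all
  ultimately have "2 * r * n + n \<le> A * n" by linarith
  moreover have "A * (n + 1) = A * n + A" by simp
  moreover have "A \<ge> 1" using r by simp
  ultimately have "2 * e \<ge> n" using two_e by linarith
  thus ?thesis by (simp add: n_def)
qed

lemma Y_pos: "Y > 0"
  unfolding Y_def using Yodd_pos[OF p] by simp

lemma P_nz: "P \<noteq> 0"
  unfolding P_def using a_nz by auto

lemma degree_N: "degree N < A * (n + 1)"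
proof -
  have lin: "degree [:a, b:] \<le> 1" for a b :: real by simp
  have pr: "degree (\<Prod>i<k. [:a i, b i:]) \<le> k" for k and a b :: "nat \<Rightarrow> real"
  proof (induction k)
    case (Suc k)
    have "degree ((\<Prod>i<k. [:a i, b i:]) * [:a k, b k:]) \<le> degree (\<Prod>i<k. [:a i, b i:]) + degree [:a k, b k:]"
      by (rule degree_mult_le)
    also have "\<dots> \<le> k + 1" using Suc lin[of "a k" "b k"] by linarith
    finally show ?case by simp
  qed simp
  have "degree N \<le> degree ([:0, 1:] ^ e * [:- (z ^ n), 1:] * (\<Prod>i<r * n. [:- (z ^ (2 * n + 2 * i + 1)), 1:]) *
     (\<Prod>i<r * n. [:- 1, z ^ (2 * i + 1):]))"
    unfolding N_def by (rule degree_smult_le)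
  also have "\<dots> \<le> degree ([:0, 1:] ^ e * [:- (z ^ n), 1:] * (\<Prod>i<r * n. [:- (z ^ (2 * n + 2 * i + 1)), 1:])) +
      degree (\<Prod>i<r * n. [:- 1, z ^ (2 * i + 1):])"
    by (rule degree_mult_le)
  also have "\<dots> \<le> degree ([:0, 1:] ^ e * [:- (z ^ n), 1:]) + degree (\<Prod>i<r * n. [:- (z ^ (2 * n + 2 * i + 1)), 1:]) + r * n"
    by (intro add_mono degree_mult_le pr)
  also have "\<dots> \<le> (degree ([:0, 1:] ^ e :: real poly) + degree [:- (z ^ n), 1:]) + r * n + r * n"
    by (intro add_mono degree_mult_le pr order.refl)
  also have "\<dots> \<le> e + 1 + r * n + r * n"
    by (intro add_mono order.refl) (simp_all add: degree_power_eq)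
  also have "\<dots> < A * (n + 1)"
  proof -
    have "2 * r * n + 1 < (2 * r + 1) * (n + 1)" using r by simp
    also have "\<dots> \<le> A * (n + 1)" using r by (intro mult_right_mono) auto
    finally show ?thesis using two_e by linarith
  qed
  finally show ?thesis .
qed

lemma R_partial_fractions:
  assumes X: "\<And>i. i \<le> n \<Longrightarrow> X \<noteq> z ^ (2 * i)"
  shows "R X = (\<Sum>j\<le>n. \<Sum>s=1..A. fps_nth (gn j) (A - s) / (X / z ^ (2 * j) - 1) ^ s)"
proof -
  have "R X = (\<Sum>j\<le>n. \<Sum>k<A. fps_nth (g j) k / (z ^ (2 * j)) ^ A / ((X - z ^ (2 * j)) / z ^ (2 * j)) ^ (A - k))"
    unfolding R_def
  proof (rule partial_fractions[OF _ _ degree_N])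
    show "inj_on (\<lambda>i. z ^ (2 * i)) {..n}" using inj_powers by (rule inj_on_subset) auto
    show "X \<notin> (\<lambda>i. z ^ (2 * i)) ` {..n}" using X by auto
  qed (use z_nz in \<open>auto simp: g_def\<close>)
  also have "\<dots> = (\<Sum>j\<le>n. \<Sum>s=1..A. fps_nth (gn j) (A - s) / (X / z ^ (2 * j) - 1) ^ s)"
  proof (rule sum.cong[OF refl])
    fix j
    have "(\<Sum>k<A. fps_nth (g j) k / (z ^ (2 * j)) ^ A / ((X - z ^ (2 * j)) / z ^ (2 * j)) ^ (A - k)) =
       (\<Sum>s=1..A. fps_nth (g j) (A - s) / (z ^ (2 * j)) ^ A / ((X - z ^ (2 * j)) / z ^ (2 * j)) ^ s)"
      by (rule sum.reindex_bij_witness[where i = "\<lambda>s. A - s" and j = "\<lambda>k. A - k"]) auto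
    also have "\<dots> = (\<Sum>s=1..A. fps_nth (gn j) (A - s) / (X / z ^ (2 * j) - 1) ^ s)"
      using z_nz by (simp add: gn_def diff_divide_distrib)
    finally show "(\<Sum>k<A. fps_nth (g j) k / (z ^ (2 * j)) ^ A / ((X - z ^ (2 * j)) / z ^ (2 * j)) ^ (A - k)) =
       (\<Sum>s=1..A. fps_nth (gn j) (A - s) / (X / z ^ (2 * j) - 1) ^ s)" .
  qed
  finally show ?thesis .
qed

lemma poly_N: "poly N X = \<kappa> * (X ^ e * (X - z ^ n) * (\<Prod>i<r * n. X - z ^ (2 * n + 2 * i + 1)) *
     (\<Prod>i<r * n. z ^ (2 * i + 1) * X - 1))"
  unfolding N_def poly_smult poly_mult poly_power poly_prod by (simp add: mult.commute)

lemma g_raw: "g j = fps_const (\<kappa> * (z ^ (2 * j)) ^ e) * fps_of_poly [:1, 1:] ^ e *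
    fps_of_poly [:z ^ (2 * j) - z ^ n, z ^ (2 * j):] *
    (\<Prod>i<r * n. fps_of_poly [:z ^ (2 * j) - z ^ (2 * n + 2 * i + 1), z ^ (2 * j):]) *
    (\<Prod>i<r * n. fps_of_poly [:z ^ (2 * i + 1 + 2 * j) - 1, z ^ (2 * i + 1 + 2 * j):]) *
    inverse (\<Prod>i\<in>{..n} - {j}. fps_of_poly [:z ^ (2 * j) - z ^ (2 * i), z ^ (2 * j):]) ^ A"
proof -
  define q where "q = [:z ^ (2 * j), z ^ (2 * j):]"
  have lin0: "pcompose [:0, 1:] q = smult (z ^ (2 * j)) [:1, 1:]" by (simp add: q_def pcompose_pCons)
  have lin1: "pcompose [:- c, 1:] q = [:z ^ (2 * j) - c, z ^ (2 * j):]" for c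
    by (simp add: q_def pcompose_pCons)
  have lin2: "pcompose [:- 1, z ^ k:] q = [:z ^ (k + 2 * j) - 1, z ^ (k + 2 * j):]" for k
    by (simp add: q_def pcompose_pCons power_add)
  have "pcompose N q = smult (\<kappa> * (z ^ (2 * j)) ^ e) ([:1, 1:] ^ e * [:z ^ (2 * j) - z ^ n, z ^ (2 * j):] *
     (\<Prod>i<r * n. [:z ^ (2 * j) - z ^ (2 * n + 2 * i + 1), z ^ (2 * j):]) *
     (\<Prod>i<r * n. [:z ^ (2 * i + 1 + 2 * j) - 1, z ^ (2 * i + 1 + 2 * j):]))"
    unfolding N_def pcompose_smult pcompose_mult pcompose_power pcompose_prod lin0 lin1 lin2 smult_power
    by (simp only: mult_smult_left smult_smult)
  thus ?thesis unfolding g_def q_def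
    by (simp only: fps_of_poly_smult fps_of_poly_mult fps_of_poly_power fps_of_poly_prod mult.assoc)
qed

section \<open>Integrality of the expansions at the poles\<close>

lemma scaled_int_blocks:
  fixes c b :: "nat \<Rightarrow> real"
  assumes l: "odd l" and b: "\<And>i. b i \<in> \<int>" and c: "\<And>i. \<bar>c i\<bar> = real (abs_pm1 p (l + 2 * i))"
  shows "scaled_int D (fps_const ((1 / Y) ^ r) * (\<Prod>i<r * n. fps_of_poly [:c i, b i:]))"
proof -
  \<comment> \<open>Cutting the r n factors into r blocks of length n yields one divisor
    \<open>Y\<close> per block.\<close>
  have "(\<Prod>i<r * n. fps_of_poly [:c i, b i:]) = (\<Prod>k<r. \<Prod>i\<in>{k * n..<k * n + n}. fps_of_poly [:c i, b i:])"
    by (rule prod.nat_group[symmetric])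
  also have "\<dots> = (\<Prod>k<r. \<Prod>i<n. fps_of_poly [:c (k * n + i), b (k * n + i):])"
  proof (rule prod.cong[OF refl])
    fix k
    show "(\<Prod>i\<in>{k * n..<k * n + n}. fps_of_poly [:c i, b i:]) = (\<Prod>i<n. fps_of_poly [:c (k * n + i), b (k * n + i):])"
      by (rule prod.reindex_bij_witness[where i = "\<lambda>i. k * n + i" and j = "\<lambda>i. i - k * n"]) auto
  qed
  finally have "fps_const ((1 / Y) ^ r) * (\<Prod>i<r * n. fps_of_poly [:c i, b i:]) =
     (\<Prod>k<r. fps_const (1 / Y) * (\<Prod>i<n. fps_of_poly [:c (k * n + i), b (k * n + i):]))"
    by (simp add: prod.distrib)
  also have "scaled_int D \<dots>"
  proof (rule scaled_int_prod)
    fix k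
    show "scaled_int D (fps_const (1 / Y) * (\<Prod>i<n. fps_of_poly [:c (k * n + i), b (k * n + i):]))"
      unfolding D_def Y_def
    proof (rule scaled_int_block[OF p])
      show "odd (l + 2 * (k * n))" using l by simp
      show "\<bar>c (k * n + i)\<bar> = real (abs_pm1 p (l + 2 * (k * n) + 2 * i))" for i
        unfolding c by (simp add: algebra_simps)
    qed (use b in auto)
  qed
  finally show ?thesis .
qed

lemma D_div_a: "1 \<le> l \<Longrightarrow> l \<le> 2 * n \<Longrightarrow> D / (z ^ l - 1) \<in> \<int>"
proof -
  assume l: "1 \<le> l" "l \<le> 2 * n"
  hence "abs_pm1 p l dvd Dall p (2 * n)" by (rule abs_pm1_dvd_Dall[OF p])
  then obtain q where "Dall p (2 * n) = abs_pm1 p l * q" by (rule dvdE)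
  hence "D = \<bar>z ^ l - 1\<bar> * real q" using abs_a[of l] l by (simp add: D_def)
  hence "\<bar>D / (z ^ l - 1)\<bar> = real q" using a_nz[of l] l by (simp add: abs_mult)
  thus ?thesis by (metis Ints_of_nat minus_in_Ints_iff abs_if)
qed

text \<open>Each difference z^(2 j) - z^(2 i) is, up to sign, a power of z times z^(2 |i - j|) - 1.
  The latter multiply to \<open>B j * B (n - j)\<close>, and the quotient of \<open>P\<close> by
  this is a Gaussian binomial coefficient in z^2, hence an integer. The powers of z add up to j (j -
  1) from i < j and to 2 j (n - j) from i > j.\<close>

lemma scaled_int_denominator:
  assumes j: "j \<le> n"
  shows "scaled_int D (fps_const (P * z ^ (j * (j - 1) + 2 * j * (n - j))) *
    inverse (\<Prod>i\<in>{..n} - {j}. fps_of_poly [:z ^ (2 * j) - z ^ (2 * i), z ^ (2 * j):]))"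
proof -
  define a where "a k = z ^ (2 * k) - 1" for k
  have a0: "a k \<noteq> 0" if "k \<ge> 1" for k using a_nz[of "2 * k"] that by (simp add: a_def)
  define F1 where "F1 k = fps_of_poly [:1, z ^ (2 * k) / a k:]" for k
  define F2 where "F2 k = fps_of_poly [:1, - 1 / a k:]" for k
  have split: "{..n} - {j} = {..<j} \<union> {j<..n}" using j by auto
  have "(\<Prod>i\<in>{..n} - {j}. fps_of_poly [:z ^ (2 * j) - z ^ (2 * i), z ^ (2 * j):]) =
     (\<Prod>i\<in>{..<j}. fps_of_poly [:z ^ (2 * j) - z ^ (2 * i), z ^ (2 * j):]) *
     (\<Prod>i\<in>{j<..n}. fps_of_poly [:z ^ (2 * j) - z ^ (2 * i), z ^ (2 * j):])"
    unfolding split by (rule prod.union_disjoint) auto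
  also have "(\<Prod>i\<in>{..<j}. fps_of_poly [:z ^ (2 * j) - z ^ (2 * i), z ^ (2 * j):]) =
      (\<Prod>k=1..j. fps_const (z ^ (2 * (j - k)) * a k) * F1 k)"
  proof (rule prod.reindex_bij_witness[where i = "\<lambda>k. j - k" and j = "\<lambda>i. j - i"])
    fix i assume "i \<in> {..<j}"
    hence i: "i < j" by simp
    define k where "k = j - i"
    have k: "j = i + k" "k \<ge> 1" using i by (auto simp: k_def)
    have 1: "z ^ (2 * j) - z ^ (2 * i) = (z ^ (2 * i) * a k) * 1"
      unfolding k(1) a_def by (simp add: power_add algebra_simps)
    have 2: "z ^ (2 * j) = (z ^ (2 * i) * a k) * (z ^ (2 * k) / a k)"
      using a0[OF k(2)] unfolding k(1) by (simp add: power_add algebra_simps)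
    have 3: "j - k = i" using k by simp
    show "fps_const (z ^ (2 * (j - (j - i))) * a (j - i)) * F1 (j - i) = fps_of_poly [:z ^ (2 * j) - z ^ (2 * i), z ^ (2 * j):]"
      unfolding k_def[symmetric] 3 F1_def fps_of_poly_linear_scale[symmetric]
      by (rule arg_cong2[where f = "\<lambda>a b. fps_of_poly [:a, b:]", OF 1[symmetric] 2[symmetric]])
  qed auto
  also have "(\<Prod>i\<in>{j<..n}. fps_of_poly [:z ^ (2 * j) - z ^ (2 * i), z ^ (2 * j):]) =
      (\<Prod>k=1..n-j. fps_const (- (z ^ (2 * j)) * a k) * F2 k)"
  proof (rule prod.reindex_bij_witness[where i = "\<lambda>k. j + k" and j = "\<lambda>i. i - j"])
    fix i assume "i \<in> {j<..n}"
    hence i: "j < i" by simp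
    define k where "k = i - j"
    have k: "i = j + k" "k \<ge> 1" using i by (auto simp: k_def)
    have 1: "z ^ (2 * j) - z ^ (2 * i) = (- (z ^ (2 * j)) * a k) * 1"
      unfolding k(1) a_def by (simp add: power_add algebra_simps)
    have 2: "z ^ (2 * j) = (- (z ^ (2 * j)) * a k) * (- 1 / a k)"
      using a0[OF k(2)] by simp
    show "fps_const (- (z ^ (2 * j)) * a (i - j)) * F2 (i - j) = fps_of_poly [:z ^ (2 * j) - z ^ (2 * i), z ^ (2 * j):]"
      unfolding k_def[symmetric] F2_def fps_of_poly_linear_scale[symmetric]
      by (rule arg_cong2[where f = "\<lambda>a b. fps_of_poly [:a, b:]", OF 1[symmetric] 2[symmetric]])
  qed (use j in auto)
  finally have prod_eq: "(\<Prod>i\<in>{..n} - {j}. fps_of_poly [:z ^ (2 * j) - z ^ (2 * i), z ^ (2 * j):]) =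
     (\<Prod>k=1..j. fps_const (z ^ (2 * (j - k)) * a k) * F1 k) *
     (\<Prod>k=1..n-j. fps_const (- (z ^ (2 * j)) * a k) * F2 k)" .
  have eq: "inverse (\<Prod>i\<in>{..n} - {j}. fps_of_poly [:z ^ (2 * j) - z ^ (2 * i), z ^ (2 * j):]) =
     fps_const (1 / ((\<Prod>k=1..j. z ^ (2 * (j - k)) * a k) * (\<Prod>k=1..n-j. - (z ^ (2 * j)) * a k))) *
     ((\<Prod>k=1..j. inverse (F1 k)) * (\<Prod>k=1..n-j. inverse (F2 k)))"
    unfolding prod_eq fps_inverse_mult inverse_fps_prod_scaled fps_const_mult_mult by simp
  define B where "B k = (\<Prod>i=1..k. a i)" for k
  have "P * z ^ (j * (j - 1) + 2 * j * (n - j)) * (1 / ((\<Prod>k=1..j. z ^ (2 * (j - k)) * a k) * (\<Prod>k=1..n-j. - (z ^ (2 * j)) * a k)))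
      = (-1) ^ (n - j) * (P / (B j * B (n - j)))"
  proof -
    have "(\<Prod>k=1..j. z ^ (2 * (j - k)) * a k) = z ^ (j * (j - 1)) * B j"
    proof -
      have "(\<Prod>k=1..j. z ^ (2 * (j - k))) = z ^ (\<Sum>k=1..j. 2 * (j - k))" by (simp add: power_sum)
      also have "(\<Sum>k=1..j. 2 * (j - k)) = (\<Sum>k<j. 2 * k)"
        by (rule sum.reindex_bij_witness[where i = "\<lambda>k. j - k" and j = "\<lambda>k. j - k"]) auto
      also have "\<dots> = j * (j - 1)"
      proof (induction j)
        case (Suc j)
        thus ?case by (cases j) simp_all
      qed simp
      finally show ?thesis by (simp only: prod.distrib B_def)
    qed
    moreover have "(\<Prod>k=1..n-j. - (z ^ (2 * j)) * a k) = (-1) ^ (n - j) * z ^ (2 * j * (n - j)) * B (n - j)"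
    proof -
      have "(\<Prod>k=1..n-j. - (z ^ (2 * j)) * a k) = (- (z ^ (2 * j))) ^ (n - j) * B (n - j)"
        unfolding prod.distrib B_def by simp
      also have "(- (z ^ (2 * j))) ^ (n - j) = (-1) ^ (n - j) * (z ^ (2 * j)) ^ (n - j)" by (rule power_minus)
      finally show ?thesis by (simp only: power_mult)
    qed
    moreover have "((-1) ^ (n - j) :: real) * (-1) ^ (n - j) = 1" by (simp flip: power_mult_distrib)
    ultimately show ?thesis using z_nz
      by (simp add: power_add divide_simps)
  qed
  hence "fps_const (P * z ^ (j * (j - 1) + 2 * j * (n - j))) *
    inverse (\<Prod>i\<in>{..n} - {j}. fps_of_poly [:z ^ (2 * j) - z ^ (2 * i), z ^ (2 * j):]) =
    fps_const ((-1) ^ (n - j) * (P / (B j * B (n - j)))) * ((\<Prod>k=1..j. inverse (F1 k)) * (\<Prod>k=1..n-j. inverse (F2 k)))"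
    unfolding eq by (simp only: mult.assoc[symmetric] fps_const_mult)
  also have "scaled_int D \<dots>"
  proof (intro scaled_int_mult scaled_int_const scaled_int_prod)
    have "(\<Prod>i=1..j. (p ^ 2) ^ i - 1) * (\<Prod>i=1..n - j. (p ^ 2) ^ i - 1) dvd (\<Prod>i=1..j + (n - j). (p ^ 2) ^ i - 1)"
      by (rule q_binomial_dvd)
    then obtain t where t: "(\<Prod>i=1..j + (n - j). (p ^ 2) ^ i - 1) = (\<Prod>i=1..j. (p ^ 2) ^ i - 1) * (\<Prod>i=1..n - j. (p ^ 2) ^ i - 1) * t"
      by (rule dvdE)
    have rB: "real_of_int (\<Prod>i=1..k. (p ^ 2) ^ i - 1) = B k" for k
      unfolding B_def a_def z_def by (simp add: power_mult)
    have "B n = B j * B (n - j) * of_int t"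
      using arg_cong[OF t, of real_of_int] j unfolding of_int_mult rB by simp
    moreover have "B n = P" unfolding B_def P_def a_def ..
    moreover have "B k \<noteq> 0" for k unfolding B_def using a0 by auto
    ultimately have "P / (B j * B (n - j)) = of_int t" by simp
    thus "(-1) ^ (n - j) * (P / (B j * B (n - j))) \<in> \<int>" by (simp add: Ints_power)
  next
    fix k assume k: "k \<in> {1..j}"
    have "D / (z ^ (2 * k) - 1) \<in> \<int>" using k j by (intro D_div_a) auto
    hence "D / a k * z ^ (2 * k) \<in> \<int>" unfolding a_def by (intro Ints_mult Ints_power z_Ints)
    thus "scaled_int D (inverse (F1 k))" unfolding F1_def by (intro scaled_int_inverse_linear) simp
  next
    fix k assume k: "k \<in> {1..n-j}"
    have "D / (z ^ (2 * k) - 1) \<in> \<int>" using k j by (intro D_div_a) auto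
    thus "scaled_int D (inverse (F2 k))" unfolding F2_def a_def by (intro scaled_int_inverse_linear) simp
  qed
  finally show ?thesis .
qed

text \<open>The difference of the two sides without E is A (m - j)^2 + (min (2 j) n - j), which is
  non-negative. The term A m^2, put into \<open>\<kappa>\<close> for this purpose, completes the
  square; the deficit it repairs is largest near the middle pole j = m.\<close>

lemma exponent_balance:
  assumes j: "j \<le> n"
  obtains E where "A * m ^ 2 + 2 * j * e + 2 * j * (r * n) + min (2 * j) n = 2 * j * A + (j * (j - 1) + 2 * j * (n - j)) * A + E"
proof -
  define T where "T = j * (j - 1)"
  have jj: "int T = int j * int j - int j" unfolding T_def by (cases j) (simp_all add: algebra_simps)
  have nj: "int (n - j) = int n - int j" using j by simp
  have te: "2 * int e + 2 * int r * int n + 1 = int A * (int n + 1)"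
    using arg_cong[OF two_e, of int] by (simp add: algebra_simps)
  have te': "2 * int j * int e + 2 * int j * (int r * int n) = int j * (int A * (int n + 1)) - int j"
  proof -
    have "2 * int j * int e + 2 * int j * (int r * int n) = int j * (2 * int e + 2 * int r * int n + 1) - int j"
      by (simp add: algebra_simps)
    thus ?thesis by (simp only: te)
  qed
  have "int (A * m ^ 2 + 2 * j * e + 2 * j * (r * n) + min (2 * j) n) - int (2 * j * A + (T + 2 * j * (n - j)) * A)
     = int A * (int m - int j) ^ 2 + (int (min (2 * j) n) - int j)"
    unfolding of_nat_add of_nat_mult jj nj using te'
    by (simp add: algebra_simps power2_eq_square n_def)
  also have "\<dots> \<ge> 0"
  proof -
    have "int (min (2 * j) n) - int j \<ge> 0" using j by simp
    thus ?thesis by simp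
  qed
  finally have "2 * j * A + (T + 2 * j * (n - j)) * A \<le> A * m ^ 2 + 2 * j * e + 2 * j * (r * n) + min (2 * j) n"
    by linarith
  thus ?thesis using that le_Suc_ex unfolding T_def by blast
qed

text \<open>The constant of \<open>gn j\<close> is distributed over the factors: P^A and a power of
  z go to the A inverse products, and Y^(-r) goes to each of the two products over i < r n. By
  \<open>exponent_balance\<close> a non-negative power of z remains.\<close>

lemma scaled_int_gn:
  assumes j: "j \<le> n"
  shows "scaled_int D (gn j)"
proof -
  obtain E where E: "A * m ^ 2 + 2 * j * e + 2 * j * (r * n) + min (2 * j) n = 2 * j * A + (j * (j - 1) + 2 * j * (n - j)) * A + E"
    using exponent_balance[OF j] .
  define W where "W = j * (j - 1) + 2 * j * (n - j)"
  define Q where "Q = inverse (\<Prod>i\<in>{..n} - {j}. fps_of_poly [:z ^ (2 * j) - z ^ (2 * i), z ^ (2 * j):])"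
  \<comment> \<open>The smaller of the powers z^(2 j) and z^n is taken out of the factor X - z^n,
    which leaves integer coefficients in either case.\<close>
  define L where "L = (if 2 * j \<le> n then fps_of_poly [:1 - z ^ (n - 2 * j), 1:] else fps_of_poly [:z ^ (2 * j - n) - 1, z ^ (2 * j - n):])"
  have L: "fps_of_poly [:z ^ (2 * j) - z ^ n, z ^ (2 * j):] = fps_const (z ^ min (2 * j) n) * L"
  proof (cases "2 * j \<le> n")
    case True
    have "z ^ n = z ^ (2 * j) * z ^ (n - 2 * j)" using True by (simp flip: power_add)
    thus ?thesis using True unfolding L_def by (simp add: algebra_simps flip: fps_of_poly_linear_scale)
  next
    case False
    hence "z ^ (2 * j) = z ^ n * z ^ (2 * j - n)" by (simp flip: power_add)
    thus ?thesis using False unfolding L_def by (simp add: algebra_simps flip: fps_of_poly_linear_scale)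
  qed
  define B1 where "B1 = (\<Prod>i<r * n. fps_of_poly [:- (z ^ (2 * (n - j) + 1 + 2 * i) - 1), 1:])"
  define B2 where "B2 = (\<Prod>i<r * n. fps_of_poly [:z ^ (2 * i + 1 + 2 * j) - 1, z ^ (2 * i + 1 + 2 * j):])"
  have B1: "(\<Prod>i<r * n. fps_of_poly [:z ^ (2 * j) - z ^ (2 * n + 2 * i + 1), z ^ (2 * j):]) = fps_const (z ^ (2 * j * (r * n))) * B1"
  proof -
    have "fps_of_poly [:z ^ (2 * j) - z ^ (2 * n + 2 * i + 1), z ^ (2 * j):] =
       fps_const (z ^ (2 * j)) * fps_of_poly [:- (z ^ (2 * (n - j) + 1 + 2 * i) - 1), 1:]" for i
    proof -
      have "2 * n + 2 * i + 1 = 2 * j + (2 * (n - j) + 1 + 2 * i)" using j by simp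
      hence "z ^ (2 * n + 2 * i + 1) = z ^ (2 * j) * z ^ (2 * (n - j) + 1 + 2 * i)" by (simp only: power_add)
      hence "z ^ (2 * j) - z ^ (2 * n + 2 * i + 1) = z ^ (2 * j) * (- (z ^ (2 * (n - j) + 1 + 2 * i) - 1))"
        by (simp only: right_diff_distrib minus_diff_eq mult_1_right)
      thus ?thesis unfolding fps_of_poly_linear_scale[symmetric] by (simp only: mult_1_right)
    qed
    hence "(\<Prod>i<r * n. fps_of_poly [:z ^ (2 * j) - z ^ (2 * n + 2 * i + 1), z ^ (2 * j):]) = fps_const (z ^ (2 * j)) ^ (r * n) * B1"
      unfolding B1_def by (simp only: prod.distrib prod_constant card_lessThan)
    also have "fps_const (z ^ (2 * j)) ^ (r * n) = fps_const (z ^ (2 * j * (r * n)))"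
      unfolding fps_const_power power_mult[of z "2 * j" "r * n"] ..
    finally show ?thesis .
  qed
  have c: "z ^ (A * m ^ 2) * (z ^ (2 * j)) ^ e * z ^ min (2 * j) n * z ^ (2 * j * (r * n)) / (z ^ (2 * j)) ^ A = (z ^ W) ^ A * z ^ E"
  proof -
    have "z ^ (A * m ^ 2) * (z ^ (2 * j)) ^ e * z ^ min (2 * j) n * z ^ (2 * j * (r * n)) =
       z ^ (A * m ^ 2 + 2 * j * e + 2 * j * (r * n) + min (2 * j) n)"
      unfolding power_add power_mult[of z "2 * j" e] by (simp only: ac_simps)
    also have "\<dots> = (z ^ (2 * j)) ^ A * ((z ^ W) ^ A * z ^ E)"
      unfolding E W_def[symmetric] power_add power_mult[of z "2 * j" A] power_mult[of z W A] by (simp only: ac_simps)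
    finally show ?thesis using z_nz by simp
  qed
  have "gn j = fps_const (1 / (z ^ (2 * j)) ^ A * (\<kappa> * (z ^ (2 * j)) ^ e) * z ^ min (2 * j) n * z ^ (2 * j * (r * n))) *
     (fps_of_poly [:1, 1:] ^ e * L * B1 * B2 * Q ^ A)"
    unfolding gn_def g_raw L B1 Q_def[symmetric] B2_def[symmetric]
    unfolding fps_const_mult[symmetric] by (simp only: ac_simps)
  also have "1 / (z ^ (2 * j)) ^ A * (\<kappa> * (z ^ (2 * j)) ^ e) * z ^ min (2 * j) n * z ^ (2 * j * (r * n)) =
     z ^ E * (1 / Y) ^ r * (1 / Y) ^ r * (P * z ^ W) ^ A"
  proof -
    have "1 / (z ^ (2 * j)) ^ A * (\<kappa> * (z ^ (2 * j)) ^ e) * z ^ min (2 * j) n * z ^ (2 * j * (r * n)) =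
      P ^ A / Y ^ (2 * r) * (z ^ (A * m ^ 2) * (z ^ (2 * j)) ^ e * z ^ min (2 * j) n * z ^ (2 * j * (r * n)) / (z ^ (2 * j)) ^ A)"
      unfolding \<kappa>_def by (simp add: mult.commute)
    also have "\<dots> = P ^ A / Y ^ (2 * r) * ((z ^ W) ^ A * z ^ E)" by (simp only: c)
    also have "\<dots> = z ^ E * (1 / Y) ^ r * (1 / Y) ^ r * (P * z ^ W) ^ A"
      by (simp add: power_mult_distrib power_divide mult_2 power_add)
    finally show ?thesis .
  qed
  also have "fps_const (z ^ E * (1 / Y) ^ r * (1 / Y) ^ r * (P * z ^ W) ^ A) * (fps_of_poly [:1, 1:] ^ e * L * B1 * B2 * Q ^ A) =
     fps_const (z ^ E) * fps_of_poly [:1, 1:] ^ e * L * (fps_const ((1 / Y) ^ r) * B1) * (fps_const ((1 / Y) ^ r) * B2) *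
     (fps_const (P * z ^ W) * Q) ^ A"
    unfolding power_mult_distrib[of "fps_const _"] fps_const_power
    by (simp only: fps_const_mult[symmetric] ac_simps)
  also have "scaled_int D \<dots>"
  proof -
    have DZ: "D \<in> \<int>" by (simp add: D_def)
    have d1: "scaled_int D (fps_const (z ^ E))" by (intro scaled_int_const Ints_power z_Ints)
    have d2: "scaled_int D (fps_of_poly [:1, 1:] ^ e)" using DZ by (intro scaled_int_power scaled_int_linear) auto
    have d3: "scaled_int D L" unfolding L_def using DZ z_Ints
      by (auto intro!: scaled_int_linear Ints_mult Ints_diff Ints_power)
    have d4: "scaled_int D (fps_const ((1 / Y) ^ r) * B1)" unfolding B1_def
    proof (rule scaled_int_blocks[where l = "2 * (n - j) + 1"])
      show "\<bar>- (z ^ (2 * (n - j) + 1 + 2 * i) - 1)\<bar> = real (abs_pm1 p (2 * (n - j) + 1 + 2 * i))" for i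
        unfolding abs_minus_cancel by (rule abs_a) simp
    qed auto
    have d5: "scaled_int D (fps_const ((1 / Y) ^ r) * B2)" unfolding B2_def
    proof (rule scaled_int_blocks[where l = "2 * j + 1"])
      fix i
      have "2 * i + 1 + 2 * j = 2 * j + 1 + 2 * i" by simp
      moreover have "\<bar>z ^ (2 * j + 1 + 2 * i) - 1\<bar> = real (abs_pm1 p (2 * j + 1 + 2 * i))" by (rule abs_a) simp
      ultimately show "\<bar>z ^ (2 * i + 1 + 2 * j) - 1\<bar> = real (abs_pm1 p (2 * j + 1 + 2 * i))" by (simp only:)
    qed (auto intro!: Ints_mult Ints_power z_Ints)
    have d6: "scaled_int D (fps_const (P * z ^ W) * Q)" unfolding W_def Q_def by (rule scaled_int_denominator[OF j])
    show ?thesis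
      by (rule scaled_int_mult[OF scaled_int_mult[OF scaled_int_mult[OF scaled_int_mult[OF scaled_int_mult[OF d1 d2] d3] d4] d5] scaled_int_power[OF d6]])
  qed
  finally show ?thesis .
qed

end

section \<open>The linear forms\<close>

definition beta_real :: "real \<Rightarrow> nat \<Rightarrow> real" where
  "beta_real q t = (\<Sum>k. real (k + 1) ^ (t - 1) * (q ^ (k + 1) / (1 + q ^ (2 * (k + 1)))))"

text \<open>Absolute Stirling numbers of the first kind, summed crudely over s and t so that the
  bound depends on A alone.\<close>

definition stirling_bound :: "nat \<Rightarrow> real" where
  "stirling_bound A = 2 * fact (A - 1) * (\<Sum>s=1..A. \<Sum>t=1..A. \<bar>coeff (falling_poly s) (t - 1)\<bar>)"

lemma sum_falling_poly_extend:
  assumes "s \<in> {1..A}"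
  shows "(\<Sum>t=1..s. coeff (falling_poly s) (t - 1) * f t) = (\<Sum>t=1..A. coeff (falling_poly s) (t - 1) * f t)"
proof (rule sum.mono_neutral_left)
  show "\<forall>t\<in>{1..A} - {1..s}. coeff (falling_poly s) (t - 1) * f t = 0"
  proof
    fix t assume "t \<in> {1..A} - {1..s}"
    hence "t - 1 > degree (falling_poly s)" using assms by (auto simp: degree_falling_poly)
    thus "coeff (falling_poly s) (t - 1) * f t = 0" by (simp add: coeff_eq_0)
  qed
qed (use assms in auto)

text \<open>A pole at z^(2 j) shifts the index of the alternating series. The tail is the full value
  \<open>beta_real q t\<close> less an initial segment, and these segments later form the constant
  term.\<close>

lemma polylog_neg_alternating_tail_sums:
  assumes "\<bar>q\<bar> < 1"
  shows "(\<lambda>i. (-1) ^ i * polylog_neg t (q ^ (2 * (i + k) + 1))) sums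
    ((-1) ^ k * (beta_real q t - (\<Sum>i<k. (-1) ^ i * polylog_neg t (q ^ (2 * i + 1)))))"
proof -
  have "(\<lambda>i. (-1) ^ (i + k) * polylog_neg t (q ^ (2 * (i + k) + 1))) sums (beta_real q t - (\<Sum>i<k. (-1) ^ i * polylog_neg t (q ^ (2 * i + 1))))"
    using sums_split_initial_segment[OF polylog_neg_alternating_sums[OF assms, of t], of k] by (simp add: beta_real_def)
  hence "(\<lambda>i. (-1) ^ k * ((-1) ^ (i + k) * polylog_neg t (q ^ (2 * (i + k) + 1)))) sums
    ((-1) ^ k * (beta_real q t - (\<Sum>i<k. (-1) ^ i * polylog_neg t (q ^ (2 * i + 1)))))"
    by (rule sums_mult)
  moreover have "(-1) ^ k * ((-1) ^ (i + k) * x) = (-1) ^ i * x" for i and x :: real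
    by (cases "even k") (simp_all add: power_add)
  ultimately show ?thesis by (simp only:)
qed

section \<open>The sum of values of R as a linear form\<close>

context beta_form
begin

definition q :: real where "q = 1 / z"
definition H :: "nat \<Rightarrow> real" where "H l = q ^ l / (1 - q ^ l)"
definition c :: "nat \<Rightarrow> nat \<Rightarrow> real" where "c j s = fps_nth (gn j) (A - s)"

text \<open>
  One factor \<open>D\<close> may be replaced by its odd part because the finite sums in \<open>Bconst\<close> only involve
  \<open>z ^ l - 1\<close> for odd \<open>l\<close>.
\<close>

definition G :: real where "G = D ^ (A - 1) * real (Dodd p (2 * n))"
definition S :: real where "S = (\<Sum>i. (-1) ^ i * R (z ^ (2 * n + 2 * i + 1)))"

lemma q_abs: "\<bar>q\<bar> \<le> 1 / 2"
  using z_abs unfolding q_def by (simp add: divide_le_eq)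

lemma q_lt_1: "\<bar>q\<bar> < 1"
  using q_abs by simp

lemma q_pow_abs: "l \<ge> 1 \<Longrightarrow> \<bar>q ^ l\<bar> < 1"
  using q_lt_1 unfolding power_abs by (subst power_less_one_iff) auto

lemma H_eq: "l \<ge> 1 \<Longrightarrow> H l = 1 / (z ^ l - 1)"
  using a_nz[of l] z_nz q_pow_abs[of l] unfolding H_def q_def by (simp add: power_divide field_simps)

text \<open>The substitution exchanges the two products over i < r n and reverses the order of the
  poles. The factor X - z^n brings one sign and the odd number A (n + 1) of pole factors another,
  and they cancel; the powers of X and z match by \<open>two_e\<close>.\<close>

lemma R_symmetric:
  assumes X: "X \<noteq> 0"
  shows "R (z ^ (2 * n) / X) = R X"
proof -
  define X' where "X' = z ^ (2 * n) / X"
  define K where "K = 2 * e + 2 * r * n + 1"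
  define Den where "Den X = (\<Prod>i\<le>n. X - z ^ (2 * i))" for X
  have ev: "even (r * n)" by (simp add: n_def)
  have 1: "X' - z ^ n = (- (z ^ n) / X) * (X - z ^ n)"
    using X unfolding X'_def mult_2 power_add by (simp add: field_simps)
  have 2: "X' - z ^ (2 * n + 2 * i + 1) = (- (z ^ (2 * n)) / X) * (z ^ (2 * i + 1) * X - 1)" for i
    using X unfolding X'_def by (simp add: field_simps power_add)
  have 3: "z ^ (2 * i + 1) * X' - 1 = (- 1 / X) * (X - z ^ (2 * n + 2 * i + 1))" for i
    using X unfolding X'_def by (simp add: field_simps power_add)
  have "poly N X' = \<kappa> * (X' ^ e * ((- (z ^ n) / X) * (X - z ^ n)) * ((- (z ^ (2 * n)) / X) ^ (r * n) * (\<Prod>i<r * n. z ^ (2 * i + 1) * X - 1)) *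
     ((- 1 / X) ^ (r * n) * (\<Prod>i<r * n. X - z ^ (2 * n + 2 * i + 1))))"
    unfolding poly_N 1 2 3 prod.distrib by simp
  also have "X' ^ e = z ^ (2 * n * e) / X ^ (2 * e) * X ^ e"
  proof -
    have "X ^ (2 * e) = X ^ e * X ^ e" by (simp add: mult_2 power_add)
    thus ?thesis using X by (simp add: X'_def power_divide power_mult)
  qed
  also have "(- (z ^ (2 * n)) / X) ^ (r * n) = z ^ (2 * n * (r * n)) / X ^ (r * n)"
    using ev unfolding minus_divide_left[symmetric] power_mult[of z "2 * n" "r * n"]
    by (simp add: power_divide power_minus_even)
  also have "(- 1 / X) ^ (r * n) = 1 / X ^ (r * n)"
    using ev unfolding minus_divide_left[symmetric] by (simp add: power_divide power_minus_even)
  also have "\<kappa> * (z ^ (2 * n * e) / X ^ (2 * e) * X ^ e * (- (z ^ n) / X * (X - z ^ n)) *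
       (z ^ (2 * n * (r * n)) / X ^ (r * n) * (\<Prod>i<r * n. z ^ (2 * i + 1) * X - 1)) *
       (1 / X ^ (r * n) * (\<Prod>i<r * n. X - z ^ (2 * n + 2 * i + 1)))) =
     z ^ (2 * n * e) * z ^ n * z ^ (2 * n * (r * n)) / (X ^ (2 * e) * X * (X ^ (r * n) * X ^ (r * n))) * (- poly N X)"
  proof -
    have "\<kappa> * (a / b * x * (- u / X * d) * (a' / v * p2) * (1 / v * p1)) = a * u * a' / (b * X * (v * v)) * (- (\<kappa> * (x * d * p1 * p2)))"
      for a b x u d a' v p1 p2 :: real
      by (simp add: divide_inverse ac_simps)
    thus ?thesis unfolding poly_N .
  qed
  also have "z ^ (2 * n * e) * z ^ n * z ^ (2 * n * (r * n)) = z ^ (n * K)"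
    unfolding K_def power_add[symmetric] by (simp add: algebra_simps)
  also have "X ^ (2 * e) * X * (X ^ (r * n) * X ^ (r * n)) = X ^ K"
    unfolding K_def by (simp add: power_add mult_2 distrib_right mult.assoc)
  finally have N': "poly N X' = - (z ^ (n * K) / X ^ K * poly N X)" by simp
  have "Den X' = (\<Prod>i\<le>n. (- (z ^ (2 * i)) / X) * (X - z ^ (2 * (n - i))))"
    unfolding Den_def
  proof (rule prod.cong[OF refl])
    fix i assume "i \<in> {..n}"
    hence "2 * n = 2 * i + 2 * (n - i)" by simp
    hence "z ^ (2 * n) = z ^ (2 * i) * z ^ (2 * (n - i))" by (simp only: power_add)
    thus "X' - z ^ (2 * i) = (- (z ^ (2 * i)) / X) * (X - z ^ (2 * (n - i)))"
      using X unfolding X'_def by (simp add: field_simps)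
  qed
  also have "\<dots> = (\<Prod>i\<le>n. - (z ^ (2 * i)) / X) * (\<Prod>i\<le>n. X - z ^ (2 * (n - i)))" by (rule prod.distrib)
  also have "(\<Prod>i\<le>n. X - z ^ (2 * (n - i))) = Den X" unfolding Den_def
    by (rule prod.reindex_bij_witness[where i = "\<lambda>i. n - i" and j = "\<lambda>i. n - i"]) auto
  also have "(\<Prod>i\<le>n. - (z ^ (2 * i)) / X) = - (z ^ (n * (n + 1)) / X ^ (n + 1))"
  proof -
    have "(\<Prod>i\<le>n. - (z ^ (2 * i)) / X) = (\<Prod>i\<le>n. (- 1 / X) * z ^ (2 * i))" by (intro prod.cong refl) simp
    also have "\<dots> = (- 1 / X) ^ (n + 1) * z ^ (\<Sum>i\<le>n. 2 * i)"
      by (simp only: prod.distrib prod_constant card_atMost power_sum Suc_eq_plus1)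
    also have "(\<Sum>i\<le>k. 2 * i) = k * (k + 1)" for k :: nat by (induction k) auto
    also have "(- 1 / X) ^ (n + 1) = - (1 / X ^ (n + 1))"
      unfolding minus_divide_left[symmetric] by (subst power_minus_odd) (simp_all add: power_divide n_def)
    finally show ?thesis by (simp add: mult.commute)
  qed
  finally have "Den X' ^ A = (- (z ^ (n * (n + 1)) / X ^ (n + 1) * Den X)) ^ A" by simp
  also have "\<dots> = - ((z ^ (n * (n + 1)) / X ^ (n + 1) * Den X) ^ A)" using A by (rule power_minus_odd)
  also have "(z ^ (n * (n + 1)) / X ^ (n + 1) * Den X) ^ A = z ^ (n * (n + 1) * A) / X ^ ((n + 1) * A) * Den X ^ A"
    by (simp only: power_mult_distrib power_divide power_mult)
  also have "n * (n + 1) * A = n * K" unfolding K_def two_e by (simp only: ac_simps)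
  also have "(n + 1) * A = K" unfolding K_def two_e by (simp only: ac_simps)
  finally have D': "Den X' ^ A = - (z ^ (n * K) / X ^ K * Den X ^ A)" .
  have "z ^ (n * K) / X ^ K \<noteq> 0" using X z_nz by simp
  hence "(- (w * a)) / (- (w * b)) = a / b" if "w = z ^ (n * K) / X ^ K" for w a b
    unfolding that by (metis minus_divide_divide mult_divide_mult_cancel_left)
  hence "poly N X' / Den X' ^ A = poly N X / Den X ^ A" unfolding N' D' by blast
  thus ?thesis by (simp add: R_def Den_def X'_def)
qed

lemma R_expand1: "R (z ^ (2 * n + 2 * i + 1)) = (\<Sum>j\<le>n. \<Sum>s=1..A. c j s * H (2 * (i + (n - j)) + 1) ^ s)"
proof -
  have "R (z ^ (2 * n + 2 * i + 1)) = (\<Sum>j\<le>n. \<Sum>s=1..A. c j s / (z ^ (2 * n + 2 * i + 1) / z ^ (2 * j) - 1) ^ s)"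
    unfolding c_def
  proof (rule R_partial_fractions)
    fix k assume k: "k \<le> n"
    show "z ^ (2 * n + 2 * i + 1) \<noteq> z ^ (2 * k)"
    proof
      assume "z ^ (2 * n + 2 * i + 1) = z ^ (2 * k)"
      hence "\<bar>z\<bar> ^ (2 * n + 2 * i + 1) = \<bar>z\<bar> ^ (2 * k)" by (metis power_abs)
      hence "2 * n + 2 * i + 1 = 2 * k" using z_abs by (subst (asm) power_inject_exp) auto
      thus False using k by simp
    qed
  qed
  also have "\<dots> = (\<Sum>j\<le>n. \<Sum>s=1..A. c j s * H (2 * (i + (n - j)) + 1) ^ s)"
  proof (rule sum.cong[OF refl], rule sum.cong[OF refl])
    fix j s assume "j \<in> {..n}"
    hence "2 * n + 2 * i + 1 = (2 * (i + (n - j)) + 1) + 2 * j" by simp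
    hence "z ^ (2 * n + 2 * i + 1) / z ^ (2 * j) = z ^ (2 * (i + (n - j)) + 1)"
      using z_nz by (simp only: power_add) simp
    thus "c j s / (z ^ (2 * n + 2 * i + 1) / z ^ (2 * j) - 1) ^ s = c j s * H (2 * (i + (n - j)) + 1) ^ s"
      by (simp add: H_eq power_divide)
  qed
  finally show ?thesis .
qed

text \<open>By the symmetry the value at z^(2 n + 2 i + 1) is also the value at q^(2 i + 1). There 1
  / (X / z^(2 j) - 1) equals -1 - H l with l = 2 (i + j) + 1, which is what H l becomes under q^l
  \<mapsto> q^(-l).\<close>

lemma R_expand2: "R (z ^ (2 * n + 2 * i + 1)) = (\<Sum>j\<le>n. \<Sum>s=1..A. c j s * (-1 - H (2 * (i + j) + 1)) ^ s)"
proof -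
  define X where "X = q ^ (2 * i + 1)"
  have "z ^ (2 * n) / z ^ (2 * n + 2 * i + 1) = X" unfolding X_def q_def using z_nz by (simp add: power_add power_divide)
  hence "R (z ^ (2 * n + 2 * i + 1)) = R X" using R_symmetric[of "z ^ (2 * n + 2 * i + 1)"] z_nz by simp
  also have "\<dots> = (\<Sum>j\<le>n. \<Sum>s=1..A. c j s / (X / z ^ (2 * j) - 1) ^ s)"
    unfolding c_def
  proof (rule R_partial_fractions)
    fix k
    have "\<bar>X\<bar> < 1" unfolding X_def by (rule q_pow_abs) simp
    moreover have "\<bar>z ^ (2 * k)\<bar> \<ge> 1" unfolding power_abs using z_abs by (intro one_le_power) simp
    ultimately show "X \<noteq> z ^ (2 * k)" by auto
  qed
  also have "\<dots> = (\<Sum>j\<le>n. \<Sum>s=1..A. c j s * (-1 - H (2 * (i + j) + 1)) ^ s)"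
  proof (rule sum.cong[OF refl], rule sum.cong[OF refl])
    fix j s
    define Q where "Q = q ^ (2 * (i + j) + 1)"
    have Q: "1 - Q \<noteq> 0" using q_pow_abs[of "2 * (i + j) + 1"] by (auto simp: Q_def)
    have "2 * (i + j) + 1 = (2 * i + 1) + 2 * j" by simp
    hence "X / z ^ (2 * j) = Q" unfolding X_def Q_def q_def using z_nz by (simp only: power_add power_divide) simp
    moreover have "-1 - H (2 * (i + j) + 1) = 1 / (Q - 1)" using Q unfolding H_def Q_def[symmetric]
      by (simp add: field_simps)
    ultimately show "c j s / (X / z ^ (2 * j) - 1) ^ s = c j s * (-1 - H (2 * (i + j) + 1)) ^ s"
      by (simp add: power_divide)
  qed
  finally show ?thesis .
qed

lemma H_tendsto: "(\<lambda>i. H (2 * (i + k) + 1)) \<longlonglongrightarrow> 0"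
proof -
  have "(\<lambda>l. q ^ l / (1 - q ^ l)) \<longlonglongrightarrow> 0 / (1 - 0)"
    using q_lt_1 by (intro tendsto_intros LIMSEQ_power_zero) auto
  hence "H \<longlonglongrightarrow> 0" by (simp add: H_def[abs_def])
  moreover have "filterlim (\<lambda>i. 2 * (i + k) + 1) at_top sequentially"
    by (intro filterlim_subseq) (auto simp: strict_mono_def)
  ultimately show ?thesis by (rule filterlim_compose)
qed

text \<open>As i grows, the first expansion of the same value tends to 0 and the second to this sum.
  The identity allows (-1)^s to be subtracted in the second expansion, as
  \<open>sum_falling_poly_Li_alternating\<close> requires.\<close>

lemma sum_c_alternating: "(\<Sum>j\<le>n. \<Sum>s=1..A. c j s * (-1) ^ s) = 0"
proof -
  have "(\<lambda>i. \<Sum>j\<le>n. \<Sum>s=1..A. c j s * H (2 * (i + (n - j)) + 1) ^ s) \<longlonglongrightarrow> (\<Sum>j\<le>n. \<Sum>s=1..A. c j s * 0 ^ s)"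
    by (intro tendsto_sum tendsto_mult tendsto_const tendsto_power H_tendsto)
  moreover have "(\<Sum>j\<le>n. \<Sum>s=1..A. c j s * 0 ^ s) = 0"
    by (intro sum.neutral ballI) (auto simp: power_0_left)
  ultimately have 1: "(\<lambda>i. R (z ^ (2 * n + 2 * i + 1))) \<longlonglongrightarrow> 0" unfolding R_expand1 by simp
  have "(\<lambda>i. \<Sum>j\<le>n. \<Sum>s=1..A. c j s * (-1 - H (2 * (i + j) + 1)) ^ s) \<longlonglongrightarrow> (\<Sum>j\<le>n. \<Sum>s=1..A. c j s * (-1 - 0) ^ s)"
    by (intro tendsto_sum tendsto_mult tendsto_const tendsto_power tendsto_diff H_tendsto)
  hence 2: "(\<lambda>i. R (z ^ (2 * n + 2 * i + 1))) \<longlonglongrightarrow> (\<Sum>j\<le>n. \<Sum>s=1..A. c j s * (-1) ^ s)" unfolding R_expand2 by simp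
  show ?thesis using LIMSEQ_unique[OF 2 1] .
qed

text \<open>The quotient of factorials is an integer and absorbs the (s - 1)! of the polylogarithm
  identities, so that (A - 1)! is a common factor for all s.\<close>

definition cc :: "nat \<Rightarrow> nat \<Rightarrow> real" where
  "cc j s = c j s * (fact (A - 1) / fact (s - 1))"

definition T :: "nat \<Rightarrow> nat \<Rightarrow> real" where
  "T t k = (\<Sum>i<k. (-1) ^ i * polylog_neg t (q ^ (2 * i + 1)))"

text \<open>The sum of the two expansions, rewritten in polylogarithms. Their weights 1 and (-1)^t
  are the source of the cancellation for odd t, and the doubling is the price.\<close>

lemma twice_R_expand:
  "2 * fact (A - 1) * R (z ^ (2 * n + 2 * i + 1)) =
    (\<Sum>j\<le>n. \<Sum>s=1..A. \<Sum>t=1..A. cc j s * (coeff (falling_poly s) (t - 1) *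
       (polylog_neg t (q ^ (2 * (i + (n - j)) + 1)) + (-1) ^ t * polylog_neg t (q ^ (2 * (i + j) + 1)))))"
proof -
  have Lis: "fact (A - 1) * (c j s * (H l ^ s + ((-1 - H l') ^ s - (-1) ^ s))) =
    (\<Sum>t=1..A. cc j s * (coeff (falling_poly s) (t - 1) * (polylog_neg t (q ^ l) + (-1) ^ t * polylog_neg t (q ^ l'))))"
    if s: "s \<in> {1..A}" and l: "l \<ge> 1" "l' \<ge> 1" for j s l l'
  proof -
    have s1: "s \<ge> 1" using s by simp
    have 1: "(\<Sum>t=1..A. coeff (falling_poly s) (t - 1) * polylog_neg t (q ^ l)) = fact (s - 1) * H l ^ s"
      using sum_falling_poly_Li[OF q_pow_abs[OF l(1)] s1] unfolding sum_falling_poly_extend[OF s] H_def .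
    have 2: "(\<Sum>t=1..A. coeff (falling_poly s) (t - 1) * ((-1) ^ t * polylog_neg t (q ^ l'))) = fact (s - 1) * ((-1 - H l') ^ s - (-1) ^ s)"
      using sum_falling_poly_Li_alternating[OF q_pow_abs[OF l(2)] s1] unfolding sum_falling_poly_extend[OF s] H_def
      by (simp add: algebra_simps)
    have "(\<Sum>t=1..A. cc j s * (coeff (falling_poly s) (t - 1) * (polylog_neg t (q ^ l) + (-1) ^ t * polylog_neg t (q ^ l')))) =
      cc j s * (fact (s - 1) * H l ^ s + fact (s - 1) * ((-1 - H l') ^ s - (-1) ^ s))"
      unfolding 1[symmetric] 2[symmetric] sum.distrib[symmetric] sum_distrib_left by (simp only: distrib_left)
    also have "\<dots> = (cc j s * fact (s - 1)) * (H l ^ s + ((-1 - H l') ^ s - (-1) ^ s))"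
      by (simp only: distrib_left mult.assoc)
    also have "cc j s * fact (s - 1) = fact (A - 1) * c j s" by (simp add: cc_def)
    finally show ?thesis by (simp only: mult.assoc)
  qed
  have e2: "R (z ^ (2 * n + 2 * i + 1)) = (\<Sum>j\<le>n. \<Sum>s=1..A. c j s * ((-1 - H (2 * (i + j) + 1)) ^ s - (-1) ^ s))"
  proof -
    have "(\<Sum>j\<le>n. \<Sum>s=1..A. c j s * ((-1 - H (2 * (i + j) + 1)) ^ s - (-1) ^ s)) =
      (\<Sum>j\<le>n. \<Sum>s=1..A. c j s * (-1 - H (2 * (i + j) + 1)) ^ s) - (\<Sum>j\<le>n. \<Sum>s=1..A. c j s * (-1) ^ s)"
      by (simp only: right_diff_distrib sum_subtractf)
    thus ?thesis unfolding sum_c_alternating R_expand2 by simp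
  qed
  have "2 * fact (A - 1) * R (z ^ (2 * n + 2 * i + 1)) =
     fact (A - 1) * (R (z ^ (2 * n + 2 * i + 1)) + R (z ^ (2 * n + 2 * i + 1)))" by simp
  also have "R (z ^ (2 * n + 2 * i + 1)) + R (z ^ (2 * n + 2 * i + 1)) =
    (\<Sum>j\<le>n. \<Sum>s=1..A. c j s * (H (2 * (i + (n - j)) + 1) ^ s + ((-1 - H (2 * (i + j) + 1)) ^ s - (-1) ^ s)))"
    by (subst R_expand1, subst e2) (simp only: distrib_left sum.distrib)
  also have "fact (A - 1) * \<dots> = (\<Sum>j\<le>n. \<Sum>s=1..A. fact (A - 1) * (c j s * (H (2 * (i + (n - j)) + 1) ^ s + ((-1 - H (2 * (i + j) + 1)) ^ s - (-1) ^ s))))"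
    by (simp only: sum_distrib_left)
  also have "\<dots> = (\<Sum>j\<le>n. \<Sum>s=1..A. \<Sum>t=1..A. cc j s * (coeff (falling_poly s) (t - 1) *
       (polylog_neg t (q ^ (2 * (i + (n - j)) + 1)) + (-1) ^ t * polylog_neg t (q ^ (2 * (i + j) + 1)))))"
    by (rule sum.cong[OF refl], rule sum.cong[OF refl], rule Lis) auto
  finally show ?thesis .
qed

definition Bcoef :: "nat \<Rightarrow> real" where
  "Bcoef t = (\<Sum>j\<le>n. \<Sum>s=1..A. cc j s * (coeff (falling_poly s) (t - 1) * ((-1) ^ j * (1 + (-1) ^ t))))"

text \<open>Collects the initial segments \<open>T t (n - j)\<close> and \<open>T t j\<close> left
  by the shifts, converted back from polylogarithms into powers of \<open>H\<close> at odd indices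
  below 2 n.\<close>

definition Bconst :: real where
  "Bconst = - (\<Sum>j\<le>n. \<Sum>s=1..A. cc j s * ((-1) ^ j *
     ((\<Sum>i<n-j. (-1) ^ i * (fact (s - 1) * H (2 * i + 1) ^ s)) +
      (\<Sum>i<j. (-1) ^ i * (fact (s - 1) * ((-1 - H (2 * i + 1)) ^ s - (-1) ^ s))))))"

text \<open>The index shifts by n - j and by j bring out the signs (-1)^(n - j) and (-1)^j, which
  are equal because n is even; hence \<open>beta_real q t\<close> receives the weight 1 +
  (-1)^t.\<close>

lemma series_sums:
  "(\<lambda>i. 2 * fact (A - 1) * ((-1) ^ i * R (z ^ (2 * n + 2 * i + 1)))) sums
     (Bconst + (\<Sum>t=1..A. Bcoef t * beta_real q t))"
proof -
  have sgn: "(-1) ^ (n - j) = ((-1) ^ j :: real)" if "j \<le> n" for j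
  proof -
    have "even (n - j) \<longleftrightarrow> even j" using that by (simp add: n_def)
    thus ?thesis by (cases "even j") simp_all
  qed
  have "(\<lambda>i. \<Sum>j\<le>n. \<Sum>s=1..A. \<Sum>t=1..A. cc j s * (coeff (falling_poly s) (t - 1) *
       ((-1) ^ i * polylog_neg t (q ^ (2 * (i + (n - j)) + 1)) + (-1) ^ t * ((-1) ^ i * polylog_neg t (q ^ (2 * (i + j) + 1)))))) sums
     (\<Sum>j\<le>n. \<Sum>s=1..A. \<Sum>t=1..A. cc j s * (coeff (falling_poly s) (t - 1) *
       ((-1) ^ (n - j) * (beta_real q t - T t (n - j)) + (-1) ^ t * ((-1) ^ j * (beta_real q t - T t j)))))"
    unfolding T_def by (intro sums_sum sums_mult sums_add polylog_neg_alternating_tail_sums q_lt_1)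
  also have "(\<lambda>i. \<Sum>j\<le>n. \<Sum>s=1..A. \<Sum>t=1..A. cc j s * (coeff (falling_poly s) (t - 1) *
       ((-1) ^ i * polylog_neg t (q ^ (2 * (i + (n - j)) + 1)) + (-1) ^ t * ((-1) ^ i * polylog_neg t (q ^ (2 * (i + j) + 1)))))) =
     (\<lambda>i. 2 * fact (A - 1) * ((-1) ^ i * R (z ^ (2 * n + 2 * i + 1))))"
  proof
    fix i
    have "2 * fact (A - 1) * ((-1) ^ i * R (z ^ (2 * n + 2 * i + 1))) = (-1) ^ i * (2 * fact (A - 1) * R (z ^ (2 * n + 2 * i + 1)))"
      by (simp only: ac_simps)
    also have "\<dots> = (\<Sum>j\<le>n. \<Sum>s=1..A. \<Sum>t=1..A. (-1) ^ i * (cc j s * (coeff (falling_poly s) (t - 1) *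
       (polylog_neg t (q ^ (2 * (i + (n - j)) + 1)) + (-1) ^ t * polylog_neg t (q ^ (2 * (i + j) + 1))))))"
      unfolding twice_R_expand by (simp only: sum_distrib_left)
    also have "\<dots> = (\<Sum>j\<le>n. \<Sum>s=1..A. \<Sum>t=1..A. cc j s * (coeff (falling_poly s) (t - 1) *
       ((-1) ^ i * polylog_neg t (q ^ (2 * (i + (n - j)) + 1)) + (-1) ^ t * ((-1) ^ i * polylog_neg t (q ^ (2 * (i + j) + 1))))))"
      by (simp only: distrib_left ac_simps)
    finally show "(\<Sum>j\<le>n. \<Sum>s=1..A. \<Sum>t=1..A. cc j s * (coeff (falling_poly s) (t - 1) *
       ((-1) ^ i * polylog_neg t (q ^ (2 * (i + (n - j)) + 1)) + (-1) ^ t * ((-1) ^ i * polylog_neg t (q ^ (2 * (i + j) + 1)))))) =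
       2 * fact (A - 1) * ((-1) ^ i * R (z ^ (2 * n + 2 * i + 1)))" by (rule sym)
  qed
  also have "(\<Sum>j\<le>n. \<Sum>s=1..A. \<Sum>t=1..A. cc j s * (coeff (falling_poly s) (t - 1) *
       ((-1) ^ (n - j) * (beta_real q t - T t (n - j)) + (-1) ^ t * ((-1) ^ j * (beta_real q t - T t j))))) =
     (\<Sum>j\<le>n. \<Sum>s=1..A. \<Sum>t=1..A. cc j s * (coeff (falling_poly s) (t - 1) * ((-1) ^ j * (1 + (-1) ^ t))) * beta_real q t) -
     (\<Sum>j\<le>n. \<Sum>s=1..A. cc j s * ((-1) ^ j * (\<Sum>t=1..A. coeff (falling_poly s) (t - 1) * (T t (n - j) + (-1) ^ t * T t j))))"
    unfolding sum_subtractf[symmetric] sum_distrib_left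
  proof (rule sum.cong[OF refl], rule sum.cong[OF refl], rule sum.cong[OF refl])
    fix j s t assume "j \<in> {..n}"
    hence "(-1) ^ (n - j) = ((-1) ^ j :: real)" by (intro sgn) simp
    thus "cc j s * (coeff (falling_poly s) (t - 1) * ((-1) ^ (n - j) * (beta_real q t - T t (n - j)) + (-1) ^ t * ((-1) ^ j * (beta_real q t - T t j)))) =
      cc j s * (coeff (falling_poly s) (t - 1) * ((-1) ^ j * (1 + (-1) ^ t))) * beta_real q t -
      cc j s * ((-1) ^ j * (coeff (falling_poly s) (t - 1) * (T t (n - j) + (-1) ^ t * T t j)))"
      by (simp add: algebra_simps)
  qed
  also have "(\<Sum>j\<le>n. \<Sum>s=1..A. \<Sum>t=1..A. cc j s * (coeff (falling_poly s) (t - 1) * ((-1) ^ j * (1 + (-1) ^ t))) * beta_real q t) =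
     (\<Sum>t=1..A. Bcoef t * beta_real q t)"
  proof -
    have "(\<Sum>j\<le>n. \<Sum>s=1..A. \<Sum>t=1..A. cc j s * (coeff (falling_poly s) (t - 1) * ((-1) ^ j * (1 + (-1) ^ t))) * beta_real q t) =
      (\<Sum>j\<le>n. \<Sum>t=1..A. \<Sum>s=1..A. cc j s * (coeff (falling_poly s) (t - 1) * ((-1) ^ j * (1 + (-1) ^ t))) * beta_real q t)"
      by (intro sum.cong refl sum.swap)
    also have "\<dots> = (\<Sum>t=1..A. \<Sum>j\<le>n. \<Sum>s=1..A. cc j s * (coeff (falling_poly s) (t - 1) * ((-1) ^ j * (1 + (-1) ^ t))) * beta_real q t)"
      by (rule sum.swap)
    finally show ?thesis unfolding Bcoef_def sum_distrib_right .
  qed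
  also have "(\<Sum>j\<le>n. \<Sum>s=1..A. cc j s * ((-1) ^ j * (\<Sum>t=1..A. coeff (falling_poly s) (t - 1) * (T t (n - j) + (-1) ^ t * T t j)))) = - Bconst"
    unfolding Bconst_def minus_minus
  proof (rule sum.cong[OF refl], rule sum.cong[OF refl])
    fix j s assume s: "s \<in> {1..A}"
    have s1: "s \<ge> 1" using s by simp
    have "(\<Sum>t=1..A. coeff (falling_poly s) (t - 1) * T t k) = (\<Sum>i<k. (-1) ^ i * (fact (s - 1) * H (2 * i + 1) ^ s))" for k
    proof -
      have "(\<Sum>t=1..A. coeff (falling_poly s) (t - 1) * T t k) = (\<Sum>t=1..A. \<Sum>i<k. (-1) ^ i * (coeff (falling_poly s) (t - 1) * polylog_neg t (q ^ (2 * i + 1))))"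
        unfolding T_def sum_distrib_left by (simp only: ac_simps)
      also have "\<dots> = (\<Sum>i<k. (-1) ^ i * (\<Sum>t=1..A. coeff (falling_poly s) (t - 1) * polylog_neg t (q ^ (2 * i + 1))))"
        by (subst sum.swap) (simp only: sum_distrib_left)
      also have "\<dots> = (\<Sum>i<k. (-1) ^ i * (fact (s - 1) * H (2 * i + 1) ^ s))"
      proof (rule sum.cong[OF refl])
        fix i
        have "(\<Sum>t=1..A. coeff (falling_poly s) (t - 1) * polylog_neg t (q ^ (2 * i + 1))) = fact (s - 1) * H (2 * i + 1) ^ s"
          using sum_falling_poly_Li[OF q_pow_abs[of "2 * i + 1"] s1] unfolding sum_falling_poly_extend[OF s] H_def by simp
        thus "(-1) ^ i * (\<Sum>t=1..A. coeff (falling_poly s) (t - 1) * polylog_neg t (q ^ (2 * i + 1))) = (-1) ^ i * (fact (s - 1) * H (2 * i + 1) ^ s)"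
          by (simp only:)
      qed
      finally show ?thesis .
    qed
    moreover have "(\<Sum>t=1..A. coeff (falling_poly s) (t - 1) * ((-1) ^ t * T t k)) = (\<Sum>i<k. (-1) ^ i * (fact (s - 1) * ((-1 - H (2 * i + 1)) ^ s - (-1) ^ s)))" for k
    proof -
      have "(\<Sum>t=1..A. coeff (falling_poly s) (t - 1) * ((-1) ^ t * T t k)) = (\<Sum>t=1..A. \<Sum>i<k. (-1) ^ i * (coeff (falling_poly s) (t - 1) * ((-1) ^ t * polylog_neg t (q ^ (2 * i + 1)))))"
        unfolding T_def sum_distrib_left by (simp only: ac_simps)
      also have "\<dots> = (\<Sum>i<k. (-1) ^ i * (\<Sum>t=1..A. coeff (falling_poly s) (t - 1) * ((-1) ^ t * polylog_neg t (q ^ (2 * i + 1)))))"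
        by (subst sum.swap) (simp only: sum_distrib_left)
      also have "\<dots> = (\<Sum>i<k. (-1) ^ i * (fact (s - 1) * ((-1 - H (2 * i + 1)) ^ s - (-1) ^ s)))"
      proof (rule sum.cong[OF refl])
        fix i
        have "(\<Sum>t=1..A. coeff (falling_poly s) (t - 1) * ((-1) ^ t * polylog_neg t (q ^ (2 * i + 1)))) = fact (s - 1) * ((-1 - H (2 * i + 1)) ^ s - (-1) ^ s)"
          using sum_falling_poly_Li_alternating[OF q_pow_abs[of "2 * i + 1"] s1] unfolding sum_falling_poly_extend[OF s] H_def
          by (simp add: algebra_simps)
        thus "(-1) ^ i * (\<Sum>t=1..A. coeff (falling_poly s) (t - 1) * ((-1) ^ t * polylog_neg t (q ^ (2 * i + 1)))) = (-1) ^ i * (fact (s - 1) * ((-1 - H (2 * i + 1)) ^ s - (-1) ^ s))"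
          by (simp only:)
      qed
      finally show ?thesis .
    qed
    ultimately show "cc j s * ((-1) ^ j * (\<Sum>t=1..A. coeff (falling_poly s) (t - 1) * (T t (n - j) + (-1) ^ t * T t j))) =
      cc j s * ((-1) ^ j * ((\<Sum>i<n-j. (-1) ^ i * (fact (s - 1) * H (2 * i + 1) ^ s)) +
      (\<Sum>i<j. (-1) ^ i * (fact (s - 1) * ((-1 - H (2 * i + 1)) ^ s - (-1) ^ s)))))"
      by (simp only: distrib_left sum.distrib)
  qed
  finally show ?thesis by (simp add: add.commute)
qed

lemma Bcoef_odd: "odd t \<Longrightarrow> Bcoef t = 0"
  by (simp add: Bcoef_def)

lemma linear_form_eq:
  "2 * fact (A - 1) * S = Bconst + (\<Sum>t | even t \<and> 2 \<le> t \<and> t \<le> A - 1. Bcoef t * beta_real q t)"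
proof -
  have "(\<lambda>i. (2 * fact (A - 1)) * ((-1) ^ i * R (z ^ (2 * n + 2 * i + 1)))) sums (Bconst + (\<Sum>t=1..A. Bcoef t * beta_real q t))"
    by (rule series_sums)
  from sums_divide[OF this, of "2 * fact (A - 1)"]
  have "(\<lambda>i. (-1) ^ i * R (z ^ (2 * n + 2 * i + 1))) sums ((Bconst + (\<Sum>t=1..A. Bcoef t * beta_real q t)) / (2 * fact (A - 1)))"
    by simp
  hence "2 * fact (A - 1) * S = Bconst + (\<Sum>t=1..A. Bcoef t * beta_real q t)"
    unfolding S_def by (simp add: sums_iff)
  also have "(\<Sum>t=1..A. Bcoef t * beta_real q t) = (\<Sum>t | even t \<and> 2 \<le> t \<and> t \<le> A - 1. Bcoef t * beta_real q t)"
  proof (rule sum.mono_neutral_right)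
    show "\<forall>t\<in>{1..A} - {t. even t \<and> 2 \<le> t \<and> t \<le> A - 1}. Bcoef t * beta_real q t = 0"
    proof
      fix t assume t: "t \<in> {1..A} - {t. even t \<and> 2 \<le> t \<and> t \<le> A - 1}"
      have "odd t"
      proof (rule ccontr)
        assume "\<not> odd t"
        hence "even t" "t \<noteq> A" "t \<ge> 2" using t A by (auto elim!: evenE)
        thus False using t by auto
      qed
      thus "Bcoef t * beta_real q t = 0" by (simp add: Bcoef_odd)
    qed
  qed auto
  finally show ?thesis .
qed

text \<open>Of the A - 1 factors \<open>D\<close>, A - s clear \<open>c j s\<close>. The other s - 1
  are multiples of the odd denominator and together with the last factor of \<open>G\<close> give
  its s-th power, as needed for an s-th power of some \<open>H l\<close>.\<close>

lemma G_c_Ints: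
  assumes j: "j \<le> n" and s: "s \<in> {1..A}" and w: "real (Dodd p (2 * n)) ^ s * w \<in> \<int>"
  shows "G * c j s * w \<in> \<int>"
proof -
  have "Dodd p (2 * n) dvd Dall p (2 * n)" unfolding Dodd_def Dall_def by (intro prod_dvd_prod_subset) auto
  then obtain d where d: "Dall p (2 * n) = Dodd p (2 * n) * d" by (rule dvdE)
  have "A - 1 = (A - s) + (s - 1)" using s by simp
  hence "D ^ (A - 1) = D ^ (A - s) * D ^ (s - 1)" by (simp only: power_add)
  also have "D ^ (s - 1) = real (Dodd p (2 * n)) ^ (s - 1) * real d ^ (s - 1)"
    by (simp add: D_def d power_mult_distrib)
  finally have "G = D ^ (A - s) * (real (Dodd p (2 * n)) ^ (s - 1) * real (Dodd p (2 * n))) * real d ^ (s - 1)"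
    unfolding G_def by (simp only: ac_simps)
  also have "real (Dodd p (2 * n)) ^ (s - 1) * real (Dodd p (2 * n)) = real (Dodd p (2 * n)) ^ s"
    using s by (cases s) simp_all
  finally have "G * c j s * w = (D ^ (A - s) * c j s) * (real (Dodd p (2 * n)) ^ s * w) * real d ^ (s - 1)"
    by (simp only: ac_simps)
  also have "\<dots> \<in> \<int>"
  proof (rule Ints_mult[OF Ints_mult])
    show "D ^ (A - s) * c j s \<in> \<int>" unfolding c_def by (rule scaled_intD[OF scaled_int_gn[OF j]])
  qed (use w in auto)
  finally show ?thesis .
qed

lemma fact_quotient_Ints: "s \<in> {1..A} \<Longrightarrow> (fact (A - 1) / fact (s - 1) :: real) \<in> \<int>"
proof -
  assume "s \<in> {1..A}"
  hence "(fact (s - 1) :: nat) dvd fact (A - 1)" by (intro fact_dvd) auto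
  then obtain k where "(fact (A - 1) :: nat) = fact (s - 1) * k" by (rule dvdE)
  hence "real (fact (A - 1)) = real (fact (s - 1)) * real k" by (metis of_nat_mult)
  thus ?thesis by simp
qed

lemma G_cc_Ints:
  assumes j: "j \<le> n" and s: "s \<in> {1..A}" and w: "real (Dodd p (2 * n)) ^ s * w \<in> \<int>"
  shows "G * (cc j s * w) \<in> \<int>"
proof -
  have "G * (cc j s * w) = (G * c j s * w) * (fact (A - 1) / fact (s - 1))" by (simp add: cc_def)
  also have "\<dots> \<in> \<int>" by (intro Ints_mult G_c_Ints[OF assms] fact_quotient_Ints s)
  finally show ?thesis .
qed

lemma Dodd_H_Ints:
  assumes i: "i < n"
  shows "real (Dodd p (2 * n)) * H (2 * i + 1) \<in> \<int>"
proof -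
  have "abs_pm1 p (2 * i + 1) dvd Dodd p (2 * n)" using i by (intro abs_pm1_dvd_Dodd[OF p]) auto
  then obtain k where k: "Dodd p (2 * n) = abs_pm1 p (2 * i + 1) * k" by (rule dvdE)
  have "real (Dodd p (2 * n)) = \<bar>z ^ (2 * i + 1) - 1\<bar> * real k" unfolding k using abs_a[of "2 * i + 1"] by simp
  hence "\<bar>real (Dodd p (2 * n)) * H (2 * i + 1)\<bar> = real k"
    using a_nz[of "2 * i + 1"] by (simp add: H_eq abs_mult)
  thus ?thesis by (metis Ints_of_nat minus_in_Ints_iff abs_if)
qed

lemma G_Bcoef_Ints: "G * Bcoef t \<in> \<int>"
  unfolding Bcoef_def sum_distrib_left
  by (intro Ints_sum G_cc_Ints Ints_mult Ints_power coeff_falling_poly_Ints) auto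

lemma G_Bconst_Ints: "G * Bconst \<in> \<int>"
proof -
  have "G * (\<Sum>j\<le>n. \<Sum>s=1..A. cc j s * ((-1) ^ j *
     ((\<Sum>i<n-j. (-1) ^ i * (fact (s - 1) * H (2 * i + 1) ^ s)) +
      (\<Sum>i<j. (-1) ^ i * (fact (s - 1) * ((-1 - H (2 * i + 1)) ^ s - (-1) ^ s)))))) \<in> \<int>"
    unfolding sum_distrib_left[of G]
  proof (rule Ints_sum, rule Ints_sum, rule G_cc_Ints)
    fix j s assume j: "j \<in> {..n}" and s: "s \<in> {1..A}"
    show "j \<le> n" using j by simp
    show "s \<in> {1..A}" by (rule s)
    define d where "d = real (Dodd p (2 * n))"
    have dZ: "d \<in> \<int>" by (simp add: d_def)
    have f: "(fact (s - 1) :: real) \<in> \<int>" by (metis Ints_of_nat of_nat_fact)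
    have dH: "d * H (2 * i + 1) \<in> \<int>" if "i < n" for i unfolding d_def by (rule Dodd_H_Ints[OF that])
    have 1: "d ^ s * H (2 * i + 1) ^ s \<in> \<int>" if "i < n" for i
      using dH[OF that] by (simp add: Ints_power flip: power_mult_distrib)
    have 2: "d ^ s * ((-1 - H (2 * i + 1)) ^ s - (-1) ^ s) \<in> \<int>" if "i < n" for i
    proof -
      have "d ^ s * ((-1 - H (2 * i + 1)) ^ s - (-1) ^ s) = (- d - d * H (2 * i + 1)) ^ s - d ^ s * (-1) ^ s"
        by (simp add: right_diff_distrib flip: power_mult_distrib)
      thus ?thesis using dH[OF that] dZ by (auto intro!: Ints_diff Ints_power Ints_mult)
    qed
    have "d ^ s * ((-1) ^ j * ((\<Sum>i<n-j. (-1) ^ i * (fact (s - 1) * H (2 * i + 1) ^ s)) +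
      (\<Sum>i<j. (-1) ^ i * (fact (s - 1) * ((-1 - H (2 * i + 1)) ^ s - (-1) ^ s))))) =
      (-1) ^ j * ((\<Sum>i<n-j. (-1) ^ i * (fact (s - 1) * (d ^ s * H (2 * i + 1) ^ s))) +
      (\<Sum>i<j. (-1) ^ i * (fact (s - 1) * (d ^ s * ((-1 - H (2 * i + 1)) ^ s - (-1) ^ s)))))"
      by (simp add: sum_distrib_left distrib_left mult.left_commute)
    also have "\<dots> \<in> \<int>" using j f
      by (intro Ints_mult[of "(-1) ^ _"] Ints_mult[of "fact _"] Ints_add Ints_sum Ints_power 1 2) auto
    finally show "real (Dodd p (2 * n)) ^ s * ((-1) ^ j * ((\<Sum>i<n-j. (-1) ^ i * (fact (s - 1) * H (2 * i + 1) ^ s)) +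
      (\<Sum>i<j. (-1) ^ i * (fact (s - 1) * ((-1 - H (2 * i + 1)) ^ s - (-1) ^ s))))) \<in> \<int>" by (simp only: d_def)
  qed
  thus ?thesis unfolding Bconst_def by simp
qed

lemma G_pos: "G > 0"
  unfolding G_def D_def using Dall_pos[OF p] Dodd_pos[OF p] by simp

lemma Bcoef_bound:
  assumes M: "\<And>j s. j \<le> n \<Longrightarrow> s \<in> {1..A} \<Longrightarrow> \<bar>c j s\<bar> \<le> M" and t: "t \<in> {1..A}"
  shows "\<bar>Bcoef t\<bar> \<le> real (n + 1) * M * stirling_bound A"
proof -
  have M0: "M \<ge> 0" using M[of 0 1] r by auto
  have "\<bar>Bcoef t\<bar> \<le> (\<Sum>j\<le>n. \<Sum>s=1..A. \<bar>cc j s * (coeff (falling_poly s) (t - 1) * ((-1) ^ j * (1 + (-1) ^ t)))\<bar>)"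
    unfolding Bcoef_def by (intro order.trans[OF sum_abs] sum_mono sum_abs)
  also have "\<dots> \<le> (\<Sum>j\<le>n. \<Sum>s=1..A. M * fact (A - 1) * (2 * (\<Sum>t=1..A. \<bar>coeff (falling_poly s) (t - 1)\<bar>)))"
  proof (intro sum_mono)
    fix j s assume j: "j \<in> {..n}" and s: "s \<in> {1..A}"
    have "\<bar>cc j s\<bar> \<le> M * fact (A - 1)"
      unfolding cc_def abs_mult using M[of j s] j s M0 by (intro mult_mono) (auto simp: divide_le_eq)
    moreover have "\<bar>coeff (falling_poly s) (t - 1)\<bar> \<le> (\<Sum>t=1..A. \<bar>coeff (falling_poly s) (t - 1)\<bar>)"
      using t by (intro member_le_sum[where f = "\<lambda>t. \<bar>coeff (falling_poly s) (t - 1)\<bar>"]) auto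
    moreover have "\<bar>(-1) ^ j * (1 + (-1) ^ t)\<bar> \<le> (2 :: real)" by (cases "even t") (auto simp: abs_mult power_abs)
    ultimately have "\<bar>cc j s\<bar> * (\<bar>coeff (falling_poly s) (t - 1)\<bar> * \<bar>(-1) ^ j * (1 + (-1) ^ t)\<bar>) \<le>
       M * fact (A - 1) * ((\<Sum>t=1..A. \<bar>coeff (falling_poly s) (t - 1)\<bar>) * 2)"
      using M0 by (intro mult_mono) (auto intro!: sum_nonneg)
    thus "\<bar>cc j s * (coeff (falling_poly s) (t - 1) * ((-1) ^ j * (1 + (-1) ^ t)))\<bar> \<le> M * fact (A - 1) * (2 * (\<Sum>t=1..A. \<bar>coeff (falling_poly s) (t - 1)\<bar>))"
      by (simp only: abs_mult mult.commute[of 2])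
  qed
  also have "\<dots> = real (n + 1) * M * stirling_bound A"
    unfolding stirling_bound_def by (simp add: sum_distrib_left ac_simps)
  finally show ?thesis .
qed

end

section \<open>Size of the linear forms\<close>

text \<open>Weierstrass' product inequality gives the lower bound, and 1 + x \<le> exp x the upper
  one.\<close>

lemma prod_one_minus_bounds:
  fixes x :: "nat \<Rightarrow> real"
  assumes "finite I" "(\<Sum>i\<in>I. \<bar>x i\<bar>) \<le> 1 / 2"
  shows "1 / 2 \<le> \<bar>\<Prod>i\<in>I. 1 - x i\<bar>" "\<bar>\<Prod>i\<in>I. 1 - x i\<bar> \<le> 2"
proof -
  have le: "\<bar>x i\<bar> \<le> 1" if "i \<in> I" for i
  proof -
    have "\<bar>x i\<bar> \<le> (\<Sum>i\<in>I. \<bar>x i\<bar>)" using assms that by (intro member_le_sum) auto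
    thus ?thesis using assms by linarith
  qed
  have "1 - (\<Sum>i\<in>I. \<bar>x i\<bar>) \<le> (\<Prod>i\<in>I. 1 - \<bar>x i\<bar>)"
    using assms(1) le
  proof (induction I rule: finite_induct)
    case (insert i I)
    have le1: "\<bar>x i\<bar> \<le> 1" and IH: "1 - (\<Sum>i\<in>I. \<bar>x i\<bar>) \<le> (\<Prod>i\<in>I. 1 - \<bar>x i\<bar>)"
      using insert.prems insert.IH by auto
    have P1: "(\<Prod>i\<in>I. 1 - \<bar>x i\<bar>) \<le> 1" using insert.prems by (intro prod_le_1) auto
    have "\<bar>x i\<bar> * (\<Prod>i\<in>I. 1 - \<bar>x i\<bar>) \<le> \<bar>x i\<bar> * 1" by (intro mult_left_mono P1) auto
    hence "1 - (\<Sum>i\<in>I. \<bar>x i\<bar>) - \<bar>x i\<bar> \<le> (\<Prod>i\<in>I. 1 - \<bar>x i\<bar>) - \<bar>x i\<bar> * (\<Prod>i\<in>I. 1 - \<bar>x i\<bar>)"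
      using IH by linarith
    thus ?case using insert.hyps by (simp add: algebra_simps)
  qed simp
  also have "\<dots> \<le> (\<Prod>i\<in>I. \<bar>1 - x i\<bar>)"
    using le by (intro prod_mono) (auto simp: abs_if)
  finally show "1 / 2 \<le> \<bar>\<Prod>i\<in>I. 1 - x i\<bar>" using assms(2) unfolding abs_prod by linarith
  have "(\<Prod>i\<in>I. \<bar>1 - x i\<bar>) \<le> (\<Prod>i\<in>I. exp \<bar>x i\<bar>)"
  proof (intro prod_mono conjI)
    fix i
    have "\<bar>1 - x i\<bar> \<le> 1 + \<bar>x i\<bar>" by linarith
    also have "\<dots> \<le> exp \<bar>x i\<bar>" by (rule exp_ge_add_one_self)
    finally show "\<bar>1 - x i\<bar> \<le> exp \<bar>x i\<bar>" .
  qed simp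
  also have "\<dots> = exp (\<Sum>i\<in>I. \<bar>x i\<bar>)" using assms(1) by (rule exp_sum[symmetric])
  also have "\<dots> \<le> exp (1 / 2)" using assms(2) by simp
  also have "exp (1 / 2) \<le> (2 :: real)" using exp_bound_half[of "1 / 2 :: real"] by simp
  finally show "\<bar>\<Prod>i\<in>I. 1 - x i\<bar> \<le> 2" unfolding abs_prod .
qed

lemma sum_quarter_powers: "(\<Sum>k<N. (1 / 4) ^ (N - k)) \<le> (1 / 3 :: real)"
proof (induction N)
  case (Suc N)
  have "(\<Sum>k<Suc N. (1 / 4) ^ (Suc N - k)) = (\<Sum>k<N. (1 / 4) * (1 / 4) ^ (N - k)) + (1 / 4 :: real)"
    by (simp add: Suc_diff_le)
  also have "\<dots> = (1 / 4) * (\<Sum>k<N. (1 / 4) ^ (N - k)) + 1 / 4" by (simp only: sum_distrib_left)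
  finally show ?case using Suc.IH by simp
qed simp

lemma sum_quarter_powers': "(\<Sum>k<N. (1 / 4) ^ k) \<le> (4 / 3 :: real)"
proof -
  have "(\<Sum>k<N. (1 / 4) ^ k) = (1 - (1 / 4) ^ N) / (1 - 1 / 4 :: real)" by (subst sum_gp_strict) simp
  thus ?thesis by simp
qed

section \<open>Upper bound for the partial fraction coefficients\<close>

context beta_form
begin

definition w :: real where "w = \<bar>z\<bar>"

lemma w_ge: "w \<ge> 2"
  unfolding w_def by (rule z_abs)

lemma w_pos: "w > 0"
  using w_ge by simp

lemma abs_z_power: "\<bar>z ^ k\<bar> = w ^ k"
  by (simp add: w_def power_abs)

lemma inv_w_power_le: "1 / w ^ k \<le> (1 / 2) ^ k"
  unfolding power_divide power_one using w_ge by (intro divide_left_mono power_mono) auto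

text \<open>Because |z| \<ge> 2, the larger of the two even powers is at least four times the
  smaller and dominates the difference. Once the difference is extracted, the linear coefficient
  left is at most 2 in absolute value, the range of
  \<open>trunc_norm_inverse_linear_le\<close>.\<close>

lemma trunc_norm_inverse_difference:
  assumes "i \<noteq> j"
  shows "trunc_norm K (inverse (fps_of_poly [:z ^ (2 * j) - z ^ (2 * i), z ^ (2 * j):])) \<le> 4 / w ^ (2 * max i j)"
proof -
  define a where "a = z ^ (2 * j) - z ^ (2 * i)"
  have four: "4 * w ^ (2 * k) \<le> w ^ (2 * l)" if "k < l" for k l
  proof -
    have "2 ^ 2 * w ^ (2 * k) \<le> w ^ 2 * w ^ (2 * k)" using w_ge by (intro mult_right_mono power_mono) auto
    also have "\<dots> = w ^ (2 * (k + 1))" by (simp add: power_add[symmetric])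
    also have "\<dots> \<le> w ^ (2 * l)" using that w_ge by (intro power_increasing) auto
    finally show ?thesis by simp
  qed
  have wp: "w ^ k > 0" for k using w_pos by simp
  have a: "\<bar>a\<bar> \<ge> w ^ (2 * max i j) / 2"
  proof (cases "i < j")
    case True
    have "w ^ (2 * j) - w ^ (2 * i) \<le> \<bar>a\<bar>" unfolding a_def abs_z_power[symmetric] by (rule abs_triangle_ineq2)
    thus ?thesis using four[OF True] True wp[of "2 * i"] by (simp add: max_def)
  next
    case False
    hence ji: "j < i" using assms by simp
    have "w ^ (2 * i) - w ^ (2 * j) \<le> \<bar>z ^ (2 * i) - z ^ (2 * j)\<bar>" unfolding abs_z_power[symmetric] by (rule abs_triangle_ineq2)
    also have "\<dots> = \<bar>a\<bar>" unfolding a_def by (rule abs_minus_commute)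
    finally show ?thesis using four[OF ji] ji wp[of "2 * j"] by (simp add: max_def)
  qed
  hence a0: "\<bar>a\<bar> > 0" using wp[of "2 * max i j"] by linarith
  have "fps_of_poly [:a, z ^ (2 * j):] = fps_of_poly [:a * 1, a * (z ^ (2 * j) / a):]" using a0 by simp
  also have "\<dots> = fps_const a * fps_of_poly [:1, z ^ (2 * j) / a:]" by (rule fps_of_poly_linear_scale)
  finally have eq: "inverse (fps_of_poly [:a, z ^ (2 * j):]) = fps_const (1 / a) * inverse (fps_of_poly [:1, z ^ (2 * j) / a:])"
    by (simp only: fps_inverse_const_mult)
  have "\<bar>z ^ (2 * j) / a\<bar> \<le> 2"
  proof -
    have "w ^ (2 * j) \<le> w ^ (2 * max i j)" using w_ge by (intro power_increasing) auto
    hence "w ^ (2 * j) \<le> 2 * \<bar>a\<bar>" using a by linarith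
    thus ?thesis using a0 by (simp add: abs_z_power divide_le_eq)
  qed
  hence "trunc_norm K (inverse (fps_of_poly [:1, z ^ (2 * j) / a:])) \<le> 2" by (rule trunc_norm_inverse_linear_le)
  moreover have "trunc_norm K (fps_const (1 / a)) \<le> 2 / w ^ (2 * max i j)"
  proof -
    have "trunc_norm K (fps_const (1 / a)) \<le> 1 / \<bar>a\<bar>" using trunc_norm_const_le[of K "1 / a"] by simp
    also have "\<dots> \<le> 1 / (w ^ (2 * max i j) / 2)" using a a0 wp by (intro divide_left_mono) auto
    finally show ?thesis by simp
  qed
  ultimately have "trunc_norm K (fps_const (1 / a)) * trunc_norm K (inverse (fps_of_poly [:1, z ^ (2 * j) / a:])) \<le> 2 / w ^ (2 * max i j) * 2"
    using wp by (intro mult_mono trunc_norm_nonneg) auto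
  hence "trunc_norm K (inverse (fps_of_poly [:a, z ^ (2 * j):])) \<le> 2 / w ^ (2 * max i j) * 2"
    unfolding eq using trunc_norm_mult order.trans by blast
  thus ?thesis by (simp add: a_def)
qed

lemma sum_max_eq: "j \<le> n \<Longrightarrow> 2 * (\<Sum>i\<in>{..n} - {j}. max i j) = n * (n + 1) + j * j - j"
proof -
  assume j: "j \<le> n"
  have "2 * (\<Sum>i\<le>k. max i j) = k * (k + 1) + j * (j + 1)" if "j \<le> k" for k
    using that
  proof (induction k rule: dec_induct)
    case base
    have "(\<Sum>i\<le>j. max i j) = (\<Sum>i\<le>j. j)" by (intro sum.cong) auto
    thus ?case by simp
  next
    case (step k)
    thus ?case by simp
  qed
  from this[OF j] have "2 * (\<Sum>i\<le>n. max i j) = n * (n + 1) + j * (j + 1)" .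
  moreover have "(\<Sum>i\<le>n. max i j) = j + (\<Sum>i\<in>{..n} - {j}. max i j)" using j by (subst sum.remove[of _ j]) auto
  ultimately show ?thesis by (simp add: algebra_simps)
qed

text \<open>A bound, uniform in the pole index j, for the exponent of w in \<open>c j s\<close>
  apart from \<open>\<kappa>\<close>: that exponent is quadratic in j with leading coefficient -A
  and centre near j = m.\<close>

definition c_exp :: real where
  "c_exp = (8 * real r ^ 2 + 8 * real r - 3 * real A) * real m ^ 2 + 4 * real m"

definition M :: real where
  "M = 4 ^ A * \<bar>\<kappa>\<bar> * (2 ^ e * 3 * 3 ^ (r * n) * 3 ^ (r * n) * (4 ^ n) ^ A) * w powr c_exp"

lemma sum_odd_numbers: "(\<Sum>i<k. 2 * i + 1) = k * k" for k :: nat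
  by (induction k) auto

text \<open>As \<open>trunc_norm\<close> is submultiplicative, each factor of \<open>g_raw\<close>
  may be replaced by a constant times its largest power of w. The constants multiply to an
  exponential in n, which is negligible when logarithms are compared with n^2.\<close>

lemma c_bound:
  assumes j: "j \<le> n" and s: "s \<in> {1..A}"
  shows "\<bar>c j s\<bar> \<le> M"
proof -
  have w1: "w \<ge> 1" using w_ge by simp
  have wp: "w ^ k > 0" for k using w_pos by simp
  have t1: "trunc_norm A (fps_of_poly [:1, 1:]) \<le> 2" using trunc_norm_linear_le[of A 1 1] by simp
  have t2: "trunc_norm A (fps_of_poly [:z ^ (2 * j) - z ^ n, z ^ (2 * j):]) \<le> 3 * w ^ (2 * n)"
  proof -
    have "\<bar>z ^ (2 * j) - z ^ n\<bar> + \<bar>z ^ (2 * j)\<bar> \<le> w ^ (2 * j) + w ^ n + w ^ (2 * j)"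
      unfolding abs_z_power[symmetric] by (intro add_mono abs_triangle_ineq4) auto
    also have "\<dots> \<le> w ^ (2 * n) + w ^ (2 * n) + w ^ (2 * n)" using j w1 by (intro add_mono power_increasing) auto
    finally show ?thesis using trunc_norm_linear_le[of A "z ^ (2 * j) - z ^ n" "z ^ (2 * j)"] by linarith
  qed
  have t3: "trunc_norm A (fps_of_poly [:z ^ (2 * j) - z ^ (2 * n + 2 * i + 1), z ^ (2 * j):]) \<le> 3 * w ^ (2 * n + 2 * i + 1)" for i
  proof -
    have "\<bar>z ^ (2 * j) - z ^ (2 * n + 2 * i + 1)\<bar> + \<bar>z ^ (2 * j)\<bar> \<le> w ^ (2 * j) + w ^ (2 * n + 2 * i + 1) + w ^ (2 * j)"
      unfolding abs_z_power[symmetric] by (intro add_mono abs_triangle_ineq4) auto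
    also have "\<dots> \<le> w ^ (2 * n + 2 * i + 1) + w ^ (2 * n + 2 * i + 1) + w ^ (2 * n + 2 * i + 1)"
      using j w1 by (intro add_mono power_increasing) auto
    finally show ?thesis using trunc_norm_linear_le[of A "z ^ (2 * j) - z ^ (2 * n + 2 * i + 1)" "z ^ (2 * j)"] by linarith
  qed
  have t4: "trunc_norm A (fps_of_poly [:z ^ l - 1, z ^ l:]) \<le> 3 * w ^ l" for l
  proof -
    have "\<bar>z ^ l - 1\<bar> \<le> \<bar>z ^ l\<bar> + \<bar>1\<bar>" by (rule abs_triangle_ineq4)
    moreover have "1 \<le> w ^ l" using w1 by (rule one_le_power)
    ultimately have "\<bar>z ^ l - 1\<bar> + \<bar>z ^ l\<bar> \<le> 3 * w ^ l" unfolding abs_z_power by simp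
    thus ?thesis using trunc_norm_linear_le[of A "z ^ l - 1" "z ^ l"] by linarith
  qed
  have tmul: "trunc_norm A (f * h) \<le> x * y" if "trunc_norm A f \<le> x" "trunc_norm A h \<le> y" for f h x y
    using trunc_norm_mult[of A f h] mult_mono[OF that] that trunc_norm_nonneg[of A f] trunc_norm_nonneg[of A h] by linarith
  have t5: "trunc_norm A (inverse (\<Prod>i\<in>{..n} - {j}. fps_of_poly [:z ^ (2 * j) - z ^ (2 * i), z ^ (2 * j):])) \<le> (\<Prod>i\<in>{..n} - {j}. 4 / w ^ (2 * max i j))"
    unfolding inverse_fps_prod by (intro trunc_norm_prod_le trunc_norm_inverse_difference) auto
  have "trunc_norm A (gn j) \<le> \<bar>1 / (z ^ (2 * j)) ^ A\<bar> * (\<bar>\<kappa> * (z ^ (2 * j)) ^ e\<bar> * 2 ^ e * (3 * w ^ (2 * n)) *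
     (\<Prod>i<r * n. 3 * w ^ (2 * n + 2 * i + 1)) * (\<Prod>i<r * n. 3 * w ^ (2 * i + 1 + 2 * j)) *
     (\<Prod>i\<in>{..n} - {j}. 4 / w ^ (2 * max i j)) ^ A)"
    unfolding gn_def g_raw
    by (intro tmul trunc_norm_const_le trunc_norm_power_le trunc_norm_prod_le t1 t2 t3 t4 t5)
  also have "\<dots> = \<bar>\<kappa>\<bar> * (2 ^ e * 3 * 3 ^ (r * n) * 3 ^ (r * n) * (4 ^ n) ^ A) *
     (w ^ (2 * j * e + 2 * n + (\<Sum>i<r * n. 2 * n + 2 * i + 1) + (\<Sum>i<r * n. 2 * i + 1 + 2 * j)) /
      w ^ (2 * j * A + (\<Sum>i\<in>{..n} - {j}. 2 * max i j) * A))"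
  proof -
    have 1: "\<bar>1 / (z ^ (2 * j)) ^ A\<bar> = 1 / w ^ (2 * j * A)"
      unfolding power_mult[symmetric] abs_divide abs_z_power by simp
    have 2: "\<bar>\<kappa> * (z ^ (2 * j)) ^ e\<bar> = \<bar>\<kappa>\<bar> * w ^ (2 * j * e)"
      unfolding power_mult[symmetric] abs_mult abs_z_power by simp
    have 3: "(\<Prod>i<r * n. 3 * w ^ f i) = 3 ^ (r * n) * w ^ (\<Sum>i<r * n. f i)" for f
      by (simp add: prod.distrib power_sum)
    have 4: "(\<Prod>i\<in>{..n} - {j}. 4 / w ^ (2 * max i j)) = 4 ^ n / w ^ (\<Sum>i\<in>{..n} - {j}. 2 * max i j)"
      using j by (simp add: prod_dividef power_sum)
    show ?thesis unfolding 1 2 3[of "\<lambda>i. 2 * n + 2 * i + 1"] 3[of "\<lambda>i. 2 * i + 1 + 2 * j"] 4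
      unfolding power_divide power_add power_mult[of w "\<Sum>i\<in>{..n} - {j}. 2 * max i j" A]
      by (simp add: divide_inverse ac_simps)
  qed
  also have "w ^ (2 * j * e + 2 * n + (\<Sum>i<r * n. 2 * n + 2 * i + 1) + (\<Sum>i<r * n. 2 * i + 1 + 2 * j)) /
      w ^ (2 * j * A + (\<Sum>i\<in>{..n} - {j}. 2 * max i j) * A) =
      w powr (real (2 * j * e + 2 * n + (\<Sum>i<r * n. 2 * n + 2 * i + 1) + (\<Sum>i<r * n. 2 * i + 1 + 2 * j)) -
        real (2 * j * A + (\<Sum>i\<in>{..n} - {j}. 2 * max i j) * A))"
    unfolding powr_diff using w_pos by (simp only: powr_realpow)
  also have "\<dots> \<le> w powr c_exp"
  proof (rule powr_mono[OF _ w1])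
    have s1: "(\<Sum>i<r * n. 2 * n + 2 * i + 1) = r * n * (2 * n) + r * n * (r * n)"
    proof -
      have "(\<Sum>i<r * n. 2 * n + 2 * i + 1) = (\<Sum>i<r * n. 2 * n) + (\<Sum>i<r * n. 2 * i + 1)"
        by (simp only: sum.distrib[symmetric] add.assoc)
      thus ?thesis unfolding sum_odd_numbers by simp
    qed
    have s2: "(\<Sum>i<r * n. 2 * i + 1 + 2 * j) = r * n * (r * n) + r * n * (2 * j)"
      using sum_odd_numbers[of "r * n"] by (simp only: sum.distrib sum_constant card_lessThan) simp
    have s3: "real (\<Sum>i\<in>{..n} - {j}. 2 * max i j) = real n * (real n + 1) + real j * real j - real j"
    proof -
      have "(\<Sum>i\<in>{..n} - {j}. 2 * max i j) + j = n * (n + 1) + j * j"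
        using sum_max_eq[OF j] by (simp add: sum_distrib_left[symmetric] trans_le_add2)
      hence "real ((\<Sum>i\<in>{..n} - {j}. 2 * max i j) + j) = real (n * (n + 1) + j * j)" by (rule arg_cong)
      thus ?thesis by (simp only: of_nat_add of_nat_mult of_nat_1)
    qed
    have te: "real j * (2 * real e + 2 * real r * real n) = real j * (real A * (real n + 1) - 1)"
    proof -
      have "real (2 * e + 2 * r * n + 1) = real (A * (n + 1))" unfolding two_e ..
      hence "2 * real e + 2 * real r * real n = real A * (real n + 1) - 1" by (simp add: algebra_simps)
      thus ?thesis by (simp only:)
    qed
    have "real (2 * j * e + 2 * n + (\<Sum>i<r * n. 2 * n + 2 * i + 1) + (\<Sum>i<r * n. 2 * i + 1 + 2 * j)) -
        real (2 * j * A + (\<Sum>i\<in>{..n} - {j}. 2 * max i j) * A) =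
        real j * (2 * real e + 2 * real r * real n) + 2 * real n + 2 * real r * real n ^ 2 + 2 * real r ^ 2 * real n ^ 2
        - 2 * real j * real A - (real n * (real n + 1) + real j * real j - real j) * real A"
      unfolding s1 s2 of_nat_add of_nat_mult s3 by (simp add: algebra_simps power2_eq_square)
    \<comment> \<open>Completing the square in j, as in \<open>exponent_balance\<close>; every term
      besides \<open>c_exp\<close> is non-positive.\<close>
    also have "\<dots> = c_exp - real A * (real m - real j) ^ 2 - real j - 2 * real A * real m"
      unfolding te unfolding c_exp_def n_def by (simp add: algebra_simps power2_eq_square)
    also have "\<dots> \<le> c_exp"
    proof -
      have "real A * (real m - real j) ^ 2 \<ge> 0" "2 * real A * real m \<ge> 0" "real j \<ge> 0" by simp_all
      thus ?thesis by linarith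
    qed
    finally show "real (2 * j * e + 2 * n + (\<Sum>i<r * n. 2 * n + 2 * i + 1) + (\<Sum>i<r * n. 2 * i + 1 + 2 * j)) -
        real (2 * j * A + (\<Sum>i\<in>{..n} - {j}. 2 * max i j) * A) \<le> c_exp" .
  qed
  finally have tg: "trunc_norm A (gn j) \<le> \<bar>\<kappa>\<bar> * (2 ^ e * 3 * 3 ^ (r * n) * 3 ^ (r * n) * (4 ^ n) ^ A) * w powr c_exp"
    by (simp add: mult_left_mono)
  have "\<bar>c j s\<bar> \<le> 4 ^ (A - s) * trunc_norm A (gn j)" unfolding c_def using s by (intro coeff_le_trunc_norm) auto
  also have "\<dots> \<le> 4 ^ A * (\<bar>\<kappa>\<bar> * (2 ^ e * 3 * 3 ^ (r * n) * 3 ^ (r * n) * (4 ^ n) ^ A) * w powr c_exp)"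
    using tg by (intro mult_mono trunc_norm_nonneg power_increasing) auto
  also have "\<dots> = M" unfolding M_def by (simp only: mult.assoc)
  finally show ?thesis .
qed

section \<open>The sum and its first non-vanishing term\<close>

lemma R_zero: "i < r * n \<Longrightarrow> R (z ^ (2 * n + 2 * i + 1)) = 0"
  unfolding R_def poly_N by (simp add: prod_zero_iff) (auto intro!: bexI[of _ i])

text \<open>Divided by |X|^e, this is the size of R at X = z^l once every factor is replaced by its
  dominant power.\<close>

definition V :: real where "V = \<bar>\<kappa>\<bar> * w ^ ((r * n) * (r * n))"

text \<open>Extracting the dominant power from each factor of R leaves \<open>f0\<close> to
  \<open>f3\<close>, which are built from terms 1 - x. For i \<ge> r n the x are so small, mostly
  bounded by geometric progressions of ratio 1 / 4, that their absolute values sum to at most 1 / 2;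
  hence each of the four lies between 1 / 2 and 2 in absolute value.\<close>

lemma R_size:
  assumes i: "i \<ge> r * n"
  defines "l \<equiv> 2 * n + 2 * i + 1"
  shows "V / w ^ (l * e) / 2 ^ (A + 3) \<le> \<bar>R (z ^ l)\<bar>" "\<bar>R (z ^ l)\<bar> \<le> 2 ^ (A + 3) * (V / w ^ (l * e))"
proof -
  define X where "X = z ^ l"
  have X: "\<bar>X\<bar> = w ^ l" "X \<noteq> 0" using z_nz by (auto simp: X_def abs_z_power)
  have wp: "w ^ k > 0" for k using w_pos by simp
  have rn: "r * n \<ge> 1" using r m by (simp add: n_def)
  define f0 where "f0 = 1 - z ^ n / X"
  define f1 where "f1 = (\<Prod>k<r * n. 1 - z ^ (2 * n + 2 * k + 1) / X)"
  define f2 where "f2 = (\<Prod>k<r * n. 1 - 1 / (z ^ (2 * k + 1) * X))"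
  define f3 where "f3 = (\<Prod>k\<le>n. 1 - z ^ (2 * k) / X)"
  have quot: "\<bar>z ^ a / X\<bar> \<le> (1 / 2) ^ b" if "a + b = l" for a b
  proof -
    have "\<bar>z ^ a / X\<bar> = w ^ a / w ^ (a + b)" unfolding abs_divide abs_z_power X that ..
    also have "\<dots> = 1 / w ^ b" using w_pos by (simp add: power_add)
    also have "\<dots> \<le> (1 / 2) ^ b" by (rule inv_w_power_le)
    finally show ?thesis .
  qed
  have sq: "(1 / 2) ^ (2 * k) = (1 / 4 :: real) ^ k" for k by (simp add: power_mult power2_eq_square)
  have f0: "1 / 2 \<le> \<bar>f0\<bar>" "\<bar>f0\<bar> \<le> 2"
  proof -
    have "\<bar>z ^ n / X\<bar> \<le> (1 / 2) ^ (n + 2 * i + 1)" by (rule quot) (simp add: l_def)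
    also have "\<dots> \<le> (1 / 2) ^ 1" by (intro power_decreasing) auto
    finally have "\<bar>z ^ n / X\<bar> \<le> 1 / 2" by simp
    thus "1 / 2 \<le> \<bar>f0\<bar>" "\<bar>f0\<bar> \<le> 2" unfolding f0_def by linarith+
  qed
  have f1: "1 / 2 \<le> \<bar>f1\<bar>" "\<bar>f1\<bar> \<le> 2"
  proof -
    have "(\<Sum>k<r * n. \<bar>z ^ (2 * n + 2 * k + 1) / X\<bar>) \<le> (\<Sum>k<r * n. (1 / 4) ^ (r * n - k))"
    proof (rule sum_mono)
      fix k assume k: "k \<in> {..<r * n}"
      have "\<bar>z ^ (2 * n + 2 * k + 1) / X\<bar> \<le> (1 / 2) ^ (2 * (i - k))"
        using k i by (intro quot) (simp add: l_def)
      also have "\<dots> \<le> (1 / 4) ^ (r * n - k)" unfolding sq using i by (intro power_decreasing) auto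
      finally show "\<bar>z ^ (2 * n + 2 * k + 1) / X\<bar> \<le> (1 / 4) ^ (r * n - k)" .
    qed
    also have "\<dots> \<le> 1 / 2" using sum_quarter_powers[of "r * n"] by linarith
    finally show "1 / 2 \<le> \<bar>f1\<bar>" "\<bar>f1\<bar> \<le> 2" unfolding f1_def by (intro prod_one_minus_bounds; simp)+
  qed
  have f2: "1 / 2 \<le> \<bar>f2\<bar>" "\<bar>f2\<bar> \<le> 2"
  proof -
    have "(\<Sum>k<r * n. \<bar>1 / (z ^ (2 * k + 1) * X)\<bar>) \<le> (\<Sum>k<r * n. 1 / 4 * (1 / 4) ^ k)"
    proof (rule sum_mono)
      fix k
      have "\<bar>1 / (z ^ (2 * k + 1) * X)\<bar> = 1 / w ^ (2 * k + 1 + l)"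
        unfolding abs_divide abs_mult abs_z_power X power_add by simp
      also have "\<dots> \<le> (1 / 2) ^ (2 * k + 1 + l)" by (rule inv_w_power_le)
      also have "\<dots> \<le> (1 / 2) ^ (2 * (k + 1))" by (intro power_decreasing) (auto simp: l_def)
      also have "\<dots> = 1 / 4 * (1 / 4) ^ k" unfolding sq by simp
      finally show "\<bar>1 / (z ^ (2 * k + 1) * X)\<bar> \<le> 1 / 4 * (1 / 4) ^ k" .
    qed
    also have "\<dots> \<le> 1 / 2" using sum_quarter_powers'[of "r * n"] unfolding sum_distrib_left[symmetric] by linarith
    finally show "1 / 2 \<le> \<bar>f2\<bar>" "\<bar>f2\<bar> \<le> 2" unfolding f2_def by (intro prod_one_minus_bounds; simp)+
  qed
  have f3: "1 / 2 \<le> \<bar>f3\<bar>" "\<bar>f3\<bar> \<le> 2"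
  proof -
    have "(\<Sum>k\<in>{..n}. \<bar>z ^ (2 * k) / X\<bar>) \<le> (\<Sum>k\<in>{..<Suc n}. (1 / 4) ^ (Suc n - k))"
      unfolding lessThan_Suc_atMost
    proof (rule sum_mono)
      fix k assume k: "k \<in> {..n}"
      have "\<bar>z ^ (2 * k) / X\<bar> \<le> (1 / 2) ^ (2 * (n - k) + 2 * i + 1)" using k by (intro quot) (simp add: l_def)
      also have "\<dots> \<le> (1 / 2) ^ (2 * (Suc n - k))"
      \<comment> \<open>At k = n the exponent 2 i + 1 has to reach 2, so i \<ge> 1 is wanted; it
        follows from r n \<ge> 1.\<close>
      proof (rule power_decreasing)
        have "Suc n - k = (n - k) + 1" using k by auto
        moreover have "i \<ge> 1" using i rn by linarith
        ultimately show "2 * (Suc n - k) \<le> 2 * (n - k) + 2 * i + 1" by simp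
      qed auto
      finally show "\<bar>z ^ (2 * k) / X\<bar> \<le> (1 / 4) ^ (Suc n - k)" unfolding sq .
    qed
    also have "\<dots> \<le> 1 / 2" using sum_quarter_powers[of "Suc n"] by linarith
    finally show "1 / 2 \<le> \<bar>f3\<bar>" "\<bar>f3\<bar> \<le> 2" unfolding f3_def by (intro prod_one_minus_bounds; simp)+
  qed
  have n0: "X - z ^ n = X * f0" unfolding f0_def using X by (simp add: field_simps)
  have n1: "(\<Prod>k<r * n. X - z ^ (2 * n + 2 * k + 1)) = X ^ (r * n) * f1"
  proof -
    have "(\<Prod>k<r * n. X - z ^ (2 * n + 2 * k + 1)) = (\<Prod>k<r * n. X * (1 - z ^ (2 * n + 2 * k + 1) / X))"
      using X by (intro prod.cong refl) (simp add: field_simps)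
    thus ?thesis unfolding f1_def prod.distrib by simp
  qed
  have n2: "(\<Prod>k<r * n. z ^ (2 * k + 1) * X - 1) = z ^ (r * n * (r * n)) * X ^ (r * n) * f2"
  proof -
    have "(\<Prod>k<r * n. z ^ (2 * k + 1) * X - 1) = (\<Prod>k<r * n. z ^ (2 * k + 1) * X * (1 - 1 / (z ^ (2 * k + 1) * X)))"
      using X z_nz by (intro prod.cong refl) (simp add: right_diff_distrib)
    also have "\<dots> = z ^ (\<Sum>k<r * n. 2 * k + 1) * X ^ (r * n) * f2" unfolding f2_def prod.distrib power_sum by simp
    finally show ?thesis unfolding sum_odd_numbers .
  qed
  have n3: "(\<Prod>k\<le>n. X - z ^ (2 * k)) = X ^ (n + 1) * f3"
  proof -
    have "(\<Prod>k\<le>n. X - z ^ (2 * k)) = (\<Prod>k\<le>n. X * (1 - z ^ (2 * k) / X))"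
      using X by (intro prod.cong refl) (simp add: field_simps)
    thus ?thesis unfolding f3_def prod.distrib by simp
  qed
  have "R X = (\<kappa> * z ^ (r * n * (r * n))) * (X ^ (e + 1 + 2 * r * n) / X ^ (A * (n + 1))) * (f0 * f1 * f2 / f3 ^ A)"
    unfolding R_def poly_N n0 n1 n2 n3 power_mult_distrib power_mult[symmetric]
  proof -
    have "e + 1 + 2 * r * n = e + 1 + (r * n + r * n)" by simp
    hence e1: "X ^ (e + 1 + 2 * r * n) = X ^ e * X * (X ^ (r * n) * X ^ (r * n))"
      by (simp only: power_add power_one_right)
    have e2: "X ^ (A * (n + 1)) = X ^ ((n + 1) * A)" by (simp only: mult.commute)
    show "\<kappa> * (X ^ e * (X * f0) * (X ^ (r * n) * f1) * (z ^ (r * n * (r * n)) * X ^ (r * n) * f2)) / (X ^ ((n + 1) * A) * f3 ^ A) =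
      \<kappa> * z ^ (r * n * (r * n)) * (X ^ (e + 1 + 2 * r * n) / X ^ (A * (n + 1))) * (f0 * f1 * f2 / f3 ^ A)"
      unfolding e1 e2 by (simp only: divide_inverse inverse_mult_distrib ac_simps)
  qed
  \<comment> \<open>By \<open>two_e\<close> the exponent e + 1 + 2 r n - A (n + 1) equals
    -e.\<close>
  also have "X ^ (e + 1 + 2 * r * n) / X ^ (A * (n + 1)) = 1 / X ^ e"
    using X unfolding two_e[symmetric] by (simp add: power_add mult_2 divide_simps)
  finally have RX: "R X = \<kappa> * z ^ (r * n * (r * n)) * (1 / X ^ e) * (f0 * f1 * f2 / f3 ^ A)" .
  have "\<bar>R X\<bar> = V / w ^ (l * e) * (\<bar>f0\<bar> * \<bar>f1\<bar> * \<bar>f2\<bar> / \<bar>f3\<bar> ^ A)"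
  proof -
    have "\<bar>R X\<bar> = \<bar>\<kappa>\<bar> * \<bar>z ^ (r * n * (r * n))\<bar> * (1 / \<bar>X\<bar> ^ e) * (\<bar>f0\<bar> * \<bar>f1\<bar> * \<bar>f2\<bar> / \<bar>f3\<bar> ^ A)"
      unfolding RX by (simp only: abs_mult abs_divide power_abs abs_one)
    thus ?thesis unfolding abs_z_power X(1) V_def power_mult[symmetric] by simp
  qed
  moreover have "1 / 2 ^ (A + 3) \<le> \<bar>f0\<bar> * \<bar>f1\<bar> * \<bar>f2\<bar> / \<bar>f3\<bar> ^ A"
  proof -
    have "1 / 2 ^ (A + 3) = (1 / 2) * (1 / 2) * (1 / 2) / (2 :: real) ^ A" by (simp add: power_add)
    also have "\<dots> \<le> \<bar>f0\<bar> * \<bar>f1\<bar> * \<bar>f2\<bar> / \<bar>f3\<bar> ^ A"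
      using f0 f1 f2 f3 by (intro frac_le mult_mono power_mono zero_less_power) auto
    finally show ?thesis .
  qed
  moreover have "\<bar>f0\<bar> * \<bar>f1\<bar> * \<bar>f2\<bar> / \<bar>f3\<bar> ^ A \<le> 2 ^ (A + 3)"
  proof -
    have "\<bar>f0\<bar> * \<bar>f1\<bar> * \<bar>f2\<bar> / \<bar>f3\<bar> ^ A \<le> 2 * 2 * 2 / (1 / 2) ^ A"
      using f0 f1 f2 f3 by (intro frac_le mult_mono power_mono zero_less_power) auto
    also have "\<dots> = 2 ^ (A + 3)" by (simp add: power_add power_divide)
    finally show ?thesis .
  qed
  moreover have "V / w ^ (l * e) \<ge> 0" using w_pos unfolding V_def by simp
  ultimately show "V / w ^ (l * e) / 2 ^ (A + 3) \<le> \<bar>R (z ^ l)\<bar>" "\<bar>R (z ^ l)\<bar> \<le> 2 ^ (A + 3) * (V / w ^ (l * e))"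
    unfolding X_def[symmetric]
    using mult_left_mono[of "1 / 2 ^ (A + 3)" "\<bar>f0\<bar> * \<bar>f1\<bar> * \<bar>f2\<bar> / \<bar>f3\<bar> ^ A" "V / w ^ (l * e)"]
      mult_left_mono[of "\<bar>f0\<bar> * \<bar>f1\<bar> * \<bar>f2\<bar> / \<bar>f3\<bar> ^ A" "2 ^ (A + 3)" "V / w ^ (l * e)"]
    by (simp_all add: mult.commute)
qed

definition l0 :: nat where "l0 = 2 * n + 2 * (r * n) + 1"

text \<open>The bounds for the terms after i = r n form a geometric progression of ratio w^(-2 e).
  Since e \<ge> m \<ge> A + 4, this ratio beats the constants of \<open>R_size\<close>, so the term
  i = r n decides the size of the sum.\<close>

lemma S_size:
  assumes big: "m \<ge> A + 4"
  shows "V / w ^ (l0 * e) / 2 ^ (A + 4) \<le> \<bar>S\<bar>" "\<bar>S\<bar> \<le> 2 ^ (A + 4) * (V / w ^ (l0 * e))"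
proof -
  define f where "f i = (-1) ^ i * R (z ^ (2 * n + 2 * i + 1))" for i
  define U where "U = V / w ^ (l0 * e)"
  define C where "C = (2 :: real) ^ (A + 3)"
  define \<rho> where "\<rho> = 1 / w ^ (2 * e)"
  have U: "U \<ge> 0" unfolding U_def V_def using w_pos by simp
  have C: "C \<ge> 1" unfolding C_def by simp
  have e_big: "e \<ge> A + 4" using big e_ge by simp
  have \<rho>: "\<rho> \<ge> 0" unfolding \<rho>_def using w_pos by simp
  \<comment> \<open>Precisely what makes the tail bound 2 C U \<rho> at most half of U / C, the
    lower bound for the first non-zero term.\<close>
  have \<rho>C: "4 * C * C * \<rho> \<le> 1"
  proof -
    have "2 ^ (A + 4) = 2 * C" unfolding C_def power_add by simp
    moreover have "(2 :: real) ^ (2 * (A + 4)) = (2 ^ (A + 4)) ^ 2" by (simp only: power_mult[symmetric] mult.commute)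
    ultimately have "4 * C * C = 2 ^ (2 * (A + 4))" by (simp add: power2_eq_square)
    also have "\<dots> \<le> 2 ^ (2 * e)" using e_big by (intro power_increasing) auto
    also have "\<dots> \<le> w ^ (2 * e)" using w_ge by (intro power_mono) auto
    finally show ?thesis unfolding \<rho>_def using w_pos by (simp add: divide_le_eq)
  qed
  have \<rho>_half: "\<rho> \<le> 1 / 2"
  proof -
    have "4 * 1 * 1 * \<rho> \<le> 4 * C * C * \<rho>" using C \<rho> by (intro mult_right_mono mult_mono) auto
    thus ?thesis using \<rho>C by linarith
  qed
  have "(\<lambda>i. 2 * fact (A - 1) * f i) sums (Bconst + (\<Sum>t=1..A. Bcoef t * beta_real q t))"
    unfolding f_def by (rule series_sums)
  hence "summable (\<lambda>i. 2 * fact (A - 1) * f i)" by (rule sums_summable)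
  hence summ: "summable f" by (subst (asm) summable_cmult_iff) auto
  have "S = (\<Sum>i. f (i + Suc (r * n))) + (\<Sum>i<Suc (r * n). f i)"
    unfolding S_def f_def[symmetric] by (rule suminf_split_initial_segment[OF summ])
  also have "(\<Sum>i<Suc (r * n). f i) = f (r * n)"
  proof -
    have "(\<Sum>i<r * n. f i) = 0" 
    proof (intro sum.neutral ballI)
      fix i assume "i \<in> {..<r * n}"
      hence "R (z ^ (2 * n + 2 * i + 1)) = 0" by (intro R_zero) simp
      thus "f i = 0" by (simp only: f_def mult_zero_right)
    qed
    thus ?thesis by simp
  qed
  finally have S: "S = (\<Sum>i. f (i + Suc (r * n))) + f (r * n)" .
  have tail: "\<bar>f (i + Suc (r * n))\<bar> \<le> C * U * \<rho> * \<rho> ^ i" for i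
  proof -
    have "\<bar>f (i + Suc (r * n))\<bar> = \<bar>R (z ^ (2 * n + 2 * (i + Suc (r * n)) + 1))\<bar>"
      by (simp only: f_def abs_mult power_abs abs_minus_cancel abs_one power_one mult_1_left)
    also have "\<dots> \<le> C * (V / w ^ ((2 * n + 2 * (i + Suc (r * n)) + 1) * e))"
      unfolding C_def by (rule R_size(2)) simp
    also have "w ^ ((2 * n + 2 * (i + Suc (r * n)) + 1) * e) = w ^ (l0 * e) * w ^ (2 * e) * (w ^ (2 * e)) ^ i"
      unfolding power_mult[symmetric] power_add[symmetric] l0_def by (simp add: algebra_simps)
    finally show ?thesis by (simp add: U_def \<rho>_def power_divide)
  qed
  have geo: "summable (\<lambda>i. C * U * \<rho> * \<rho> ^ i)" using \<rho> \<rho>_half by (intro summable_mult summable_geometric) auto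
  have "\<bar>\<Sum>i. f (i + Suc (r * n))\<bar> \<le> (\<Sum>i. C * U * \<rho> * \<rho> ^ i)"
  proof -
    have abs: "summable (\<lambda>i. \<bar>f (i + Suc (r * n))\<bar>)"
      by (rule summable_comparison_test'[OF geo]) (use tail in auto)
    have "\<bar>\<Sum>i. f (i + Suc (r * n))\<bar> \<le> (\<Sum>i. \<bar>f (i + Suc (r * n))\<bar>)" by (rule summable_rabs[OF abs])
    also have "\<dots> \<le> (\<Sum>i. C * U * \<rho> * \<rho> ^ i)" by (rule suminf_le[OF tail abs geo])
    finally show ?thesis .
  qed
  also have "\<dots> = C * U * \<rho> * (1 / (1 - \<rho>))"
    using \<rho> \<rho>_half by (subst suminf_mult[OF summable_geometric]) (auto simp: suminf_geometric)
  also have "\<dots> \<le> C * U * \<rho> * 2"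
  proof (intro mult_left_mono)
    have "1 / 2 \<le> 1 - \<rho>" using \<rho>_half by simp
    hence "1 / (1 - \<rho>) \<le> 1 / (1 / 2)" by (intro divide_left_mono) auto
    thus "1 / (1 - \<rho>) \<le> 2" by simp
  qed (use C U \<rho> in auto)
  also have "\<dots> \<le> U / (2 * C)"
  proof -
    have "U * (4 * C * C * \<rho>) \<le> U * 1" by (intro mult_left_mono \<rho>C U)
    thus ?thesis using C by (simp add: le_divide_eq algebra_simps)
  qed
  finally have tail': "\<bar>\<Sum>i. f (i + Suc (r * n))\<bar> \<le> U / (2 * C)" .
  have f0: "\<bar>f (r * n)\<bar> = \<bar>R (z ^ l0)\<bar>"
    by (simp only: f_def l0_def abs_mult power_abs abs_minus_cancel abs_one power_one mult_1_left)
  have first: "U / C \<le> \<bar>f (r * n)\<bar>" "\<bar>f (r * n)\<bar> \<le> C * U"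
    unfolding f0 U_def C_def l0_def by (rule R_size[OF order.refl])+
  have "U / C = U / (2 * C) + U / (2 * C)" using C by (simp add: field_simps)
  hence lo: "U / (2 * C) \<le> \<bar>S\<bar>" using S tail' first(1) by linarith
  have "U / (2 * C) \<le> U / 1" using C U by (intro divide_left_mono) auto
  also have "\<dots> \<le> C * U" using C U by (simp add: mult_le_cancel_right1)
  finally have up: "\<bar>S\<bar> \<le> 2 * C * U" using S tail' first(2) by linarith
  have "2 * C = 2 ^ (A + 4)" unfolding C_def power_add by simp
  thus "V / w ^ (l0 * e) / 2 ^ (A + 4) \<le> \<bar>S\<bar>" "\<bar>S\<bar> \<le> 2 ^ (A + 4) * (V / w ^ (l0 * e))"
    using lo up by (simp_all only: U_def)
qed

end

section \<open>The dimension estimate\<close>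

lemma quadratic_limit_subseq:
  assumes "(\<lambda>N. f N / real N ^ 2) \<longlonglongrightarrow> s" "k > 0"
  shows "(\<lambda>m. f (k * m) / real m ^ 2) \<longlonglongrightarrow> real k ^ 2 * s"
proof -
  have "filterlim (\<lambda>m. k * m) at_top sequentially"
    using assms(2) by (intro filterlim_subseq) (auto simp: strict_mono_def)
  from filterlim_compose[OF assms(1) this]
  have "(\<lambda>m. real k ^ 2 * (f (k * m) / real (k * m) ^ 2)) \<longlonglongrightarrow> real k ^ 2 * s" by (rule tendsto_mult_left)
  moreover have "real k ^ 2 * (f (k * m) / real (k * m) ^ 2) = f (k * m) / real m ^ 2" for m
    using assms(2) by (simp add: power_mult_distrib)
  ultimately show ?thesis by (simp only:)
qed

lemma tendsto_bounded_div_square: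
  fixes f :: "nat \<Rightarrow> real"
  assumes "\<forall>\<^sub>F m in sequentially. \<bar>f m\<bar> \<le> C * real m"
  shows "(\<lambda>m. f m / real m ^ 2) \<longlonglongrightarrow> 0"
proof (rule Lim_null_comparison)
  show "\<forall>\<^sub>F m in sequentially. norm (f m / real m ^ 2) \<le> C / real m"
    using assms eventually_gt_at_top[of 0]
  proof eventually_elim
    case (elim m)
    have "\<bar>f m\<bar> / real m ^ 2 \<le> C * real m / real m ^ 2" using elim by (intro divide_right_mono) auto
    thus ?case using elim by (simp add: power2_eq_square)
  qed
  show "(\<lambda>m. C / real m) \<longlonglongrightarrow> 0" by (rule lim_const_over_n)
qed

context beta_form
begin

lemma ln_P_bound: "\<bar>ln \<bar>P\<bar> - real (n * (n + 1)) * ln w\<bar> \<le> real n * ln 2"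
proof -
  have rp: "real (abs_pm1 p (2 * i)) > 0" if "i \<ge> 1" for i using abs_pm1_pos[OF p, of "2 * i"] that by simp
  have "\<bar>P\<bar> = (\<Prod>i=1..n. real (abs_pm1 p (2 * i)))"
    unfolding P_def abs_prod by (intro prod.cong refl abs_a) simp
  moreover have "ln (\<Prod>i=1..n. real (abs_pm1 p (2 * i))) = (\<Sum>i=1..n. ln (real (abs_pm1 p (2 * i))))"
    by (rule ln_prod) (use rp in auto)
  ultimately have "ln \<bar>P\<bar> = (\<Sum>i=1..n. ln (real (abs_pm1 p (2 * i))))" by (simp only:)
  moreover have "real (n * (n + 1)) * ln w = (\<Sum>i=1..n. real (2 * i) * ln w)"
  proof -
    have "k * (k + 1) = (\<Sum>i=1..k. 2 * i)" for k :: nat by (induction k) auto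
    thus ?thesis by (simp only: of_nat_sum sum_distrib_right)
  qed
  ultimately have "\<bar>ln \<bar>P\<bar> - real (n * (n + 1)) * ln w\<bar> = \<bar>\<Sum>i=1..n. ln (real (abs_pm1 p (2 * i))) - real (2 * i) * ln w\<bar>"
    by (simp only: sum_subtractf)
  also have "\<dots> \<le> (\<Sum>i=1..n. \<bar>ln (real (abs_pm1 p (2 * i))) - real (2 * i) * ln w\<bar>)" by (rule sum_abs)
  also have "\<dots> \<le> (\<Sum>i=1..n. ln 2)"
    unfolding w_def z_def by (intro sum_mono ln_abs_pm1_bounds[OF p]) auto
  also have "\<dots> = real n * ln 2" by simp
  finally show ?thesis .
qed

lemma kappa_nz: "\<kappa> \<noteq> 0"
  unfolding \<kappa>_def using P_nz z_nz Y_pos by simp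

lemma ln_kappa: "ln \<bar>\<kappa>\<bar> = real A * ln \<bar>P\<bar> + real A * real m ^ 2 * ln w - 2 * real r * ln Y"
proof -
  have "\<bar>\<kappa>\<bar> = \<bar>P\<bar> ^ A * w ^ (A * m ^ 2) / Y ^ (2 * r)"
    unfolding \<kappa>_def abs_divide abs_mult abs_z_power using Y_pos by (simp add: power_abs)
  also have "ln \<dots> = ln (\<bar>P\<bar> ^ A) + ln (w ^ (A * m ^ 2)) - ln (Y ^ (2 * r))"
    using P_nz w_pos Y_pos by (subst ln_div) (auto simp: ln_mult)
  also have "\<dots> = real A * ln \<bar>P\<bar> + real (A * m ^ 2) * ln w - real (2 * r) * ln Y"
    by (simp only: ln_realpow)
  finally show ?thesis by simp
qed

lemma M_pos: "M > 0"
  unfolding M_def using kappa_nz w_pos by simp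

lemma ln_M: "ln M = real A * ln 4 + ln \<bar>\<kappa>\<bar> + (real e * ln 2 + ln 3 + 2 * real (r * n) * ln 3 + real A * real n * ln 4) + c_exp * ln w"
proof -
  have p3: "(2 :: real) ^ e * 3 * 3 ^ (r * n) * 3 ^ (r * n) * (4 ^ n) ^ A > 0" by simp
  have "ln M = ln ((4 :: real) ^ A) + ln \<bar>\<kappa>\<bar> + ln (2 ^ e * 3 * 3 ^ (r * n) * 3 ^ (r * n) * (4 ^ n) ^ A) + ln (w powr c_exp)"
    unfolding M_def using kappa_nz w_pos p3 by (subst ln_mult_pos, simp, simp)+ simp
  also have "ln ((2 :: real) ^ e * 3 * 3 ^ (r * n) * 3 ^ (r * n) * (4 ^ n) ^ A) =
      ln (2 ^ e) + ln 3 + ln (3 ^ (r * n)) + ln (3 ^ (r * n)) + ln ((4 ^ n) ^ A)"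
    by (subst ln_mult_pos, simp, simp)+ simp
  finally show ?thesis using w_pos by (simp add: ln_realpow ln_powr)
qed

lemma V_pos: "V > 0"
  unfolding V_def using kappa_nz w_pos by simp

lemma ln_V: "ln V = ln \<bar>\<kappa>\<bar> + real (r * n) ^ 2 * ln w"
  unfolding V_def using kappa_nz w_pos by (simp add: ln_mult_pos ln_realpow power2_eq_square)

lemma ln_G: "ln G = real (A - 1) * ln (real (Dall p (2 * n))) + ln (real (Dodd p (2 * n)))"
  unfolding G_def D_def using Dall_pos[OF p] Dodd_pos[OF p] by (simp add: ln_mult_pos ln_realpow)

lemma S_nz: "m \<ge> A + 4 \<Longrightarrow> S \<noteq> 0"
proof -
  assume "m \<ge> A + 4"
  moreover have "V / w ^ (l0 * e) / 2 ^ (A + 4) > 0" using V_pos w_pos by simp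
  ultimately show ?thesis using S_size(1) by force
qed

lemma ln_S_bound: "m \<ge> A + 4 \<Longrightarrow> \<bar>ln \<bar>S\<bar> - (ln V - real (l0 * e) * ln w)\<bar> \<le> real (A + 4) * ln 2"
proof -
  assume big: "m \<ge> A + 4"
  define U where "U = V / w ^ (l0 * e)"
  have U: "U > 0" unfolding U_def using V_pos w_pos by simp
  have lnU: "ln U = ln V - real (l0 * e) * ln w"
    unfolding U_def using V_pos w_pos by (simp add: ln_div ln_realpow)
  have S0: "\<bar>S\<bar> > 0" using S_nz[OF big] by simp
  have C: "ln ((2 :: real) ^ (A + 4)) = real (A + 4) * ln 2" by (rule ln_realpow)
  have "ln (U / 2 ^ (A + 4)) \<le> ln \<bar>S\<bar>" using S_size(1)[OF big] U S0 unfolding U_def[symmetric]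
    by (subst ln_le_cancel_iff) auto
  moreover have "ln (U / 2 ^ (A + 4)) = ln U - real (A + 4) * ln 2" using U by (simp add: ln_div C)
  moreover have "ln \<bar>S\<bar> \<le> ln (2 ^ (A + 4) * U)" using S_size(2)[OF big] U S0 unfolding U_def[symmetric]
    by (subst ln_le_cancel_iff) auto
  moreover have "ln (2 ^ (A + 4) * U) = real (A + 4) * ln 2 + ln U" using U by (simp only: ln_mult_pos C zero_less_power zero_less_numeral)
  ultimately show ?thesis unfolding lnU[symmetric] by linarith
qed

lemma real_e: "2 * real e = real A * (2 * real m + 1) - 4 * real r * real m - 1"
proof -
  have "real (2 * e + 2 * r * n + 1) = real (A * (n + 1))" unfolding two_e ..
  thus ?thesis by (simp add: n_def algebra_simps)
qed

lemma integer_form: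
  obtains B0 :: int and B :: "nat \<Rightarrow> int"
  where "of_int B0 + (\<Sum>t | even t \<and> 2 \<le> t \<and> t \<le> A - 1. of_int (B t) * beta_real q t) = 2 * fact (A - 1) * G * S"
    and "\<And>t. t \<in> {1..A} \<Longrightarrow> \<bar>of_int (B t)\<bar> \<le> G * (real (n + 1) * M * stirling_bound A)"
proof -
  have "\<forall>t. \<exists>b::int. G * Bcoef t = of_int b" using G_Bcoef_Ints by (auto elim!: Ints_cases)
  then obtain B :: "nat \<Rightarrow> int" where B: "\<And>t. G * Bcoef t = of_int (B t)" by metis
  obtain B0 :: int where B0: "G * Bconst = of_int B0" using G_Bconst_Ints by (auto elim!: Ints_cases)
  show ?thesis
  proof (rule that)
    have "2 * fact (A - 1) * G * S = G * (2 * fact (A - 1) * S)" by (simp only: ac_simps)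
    also have "\<dots> = G * Bconst + (\<Sum>t | even t \<and> 2 \<le> t \<and> t \<le> A - 1. G * Bcoef t * beta_real q t)"
      unfolding linear_form_eq distrib_left sum_distrib_left by (simp only: mult.assoc)
    finally show "of_int B0 + (\<Sum>t | even t \<and> 2 \<le> t \<and> t \<le> A - 1. of_int (B t) * beta_real q t) = 2 * fact (A - 1) * G * S"
      unfolding B B0 by (rule sym)
    fix t assume t: "t \<in> {1..A}"
    have "\<bar>of_int (B t)\<bar> = G * \<bar>Bcoef t\<bar>" unfolding B[symmetric] abs_mult using G_pos by simp
    also have "\<dots> \<le> G * (real (n + 1) * M * stirling_bound A)"
      using G_pos by (intro mult_left_mono Bcoef_bound c_bound t) auto
    finally show "\<bar>of_int (B t)\<bar> \<le> G * (real (n + 1) * M * stirling_bound A)" .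
  qed
qed

end

section \<open>Growth rates as m tends to infinity\<close>

context
  fixes p :: int and A r :: nat
  assumes p: "\<bar>p\<bar> \<ge> 2" and A: "odd A" and r: "1 \<le> r" "2 * r < A"
begin

lemma beta_formI: "m \<ge> 1 \<Longrightarrow> beta_form p A r m"
  using p A r by unfold_locales

abbreviation (input) "K \<equiv> ln \<bar>real_of_int p\<bar>"

lemma ln_w: "ln (beta_form.w p) = K"
  using beta_form.w_def[OF beta_formI[of 1]] beta_form.z_def[OF beta_formI[of 1]] by simp

lemma ln_P_limit: "(\<lambda>m. ln \<bar>beta_form.P p m\<bar> / real m ^ 2) \<longlonglongrightarrow> 4 * K"
proof -
  have "(\<lambda>m. (ln \<bar>beta_form.P p m\<bar> - real (2 * m * (2 * m + 1)) * K) / real m ^ 2) \<longlonglongrightarrow> 0"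
  proof (rule tendsto_bounded_div_square[where C = "2 * ln 2"], use eventually_ge_at_top[of 1] in eventually_elim)
    case (elim m)
    show ?case using beta_form.ln_P_bound[OF beta_formI[OF elim]] unfolding beta_form.n_def[OF beta_formI[OF elim]] ln_w
      by (simp add: ac_simps)
  qed
  moreover have "(\<lambda>m::nat. real (2 * m * (2 * m + 1)) * K / real m ^ 2) \<longlonglongrightarrow> 4 * K" by real_asymp
  ultimately have "(\<lambda>m. (ln \<bar>beta_form.P p m\<bar> - real (2 * m * (2 * m + 1)) * K) / real m ^ 2 +
    real (2 * m * (2 * m + 1)) * K / real m ^ 2) \<longlonglongrightarrow> 0 + 4 * K" by (rule tendsto_add)
  thus ?thesis by (simp add: add_divide_distrib[symmetric])
qed

text \<open>P^A contributes 4 A because n^2 = 4 m^2, the factor z^(A m^2) contributes A, and Y^(2 r)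
  takes away 2 r times 4 / 3.\<close>

lemma ln_kappa_limit: "(\<lambda>m. ln \<bar>beta_form.\<kappa> p A r m\<bar> / real m ^ 2) \<longlonglongrightarrow> (5 * real A - 8 * real r / 3) * K"
proof -
  have Y: "(\<lambda>m. ln (real (Yodd p (2 * m))) / real m ^ 2) \<longlonglongrightarrow> real 2 ^ 2 * (K / 3)"
    by (rule quadratic_limit_subseq[OF ln_Yodd_asymp[OF p]]) simp
  have "(\<lambda>m. real A * (ln \<bar>beta_form.P p m\<bar> / real m ^ 2) + real A * K - 2 * real r * (ln (real (Yodd p (2 * m))) / real m ^ 2))
     \<longlonglongrightarrow> real A * (4 * K) + real A * K - 2 * real r * (real 2 ^ 2 * (K / 3))"
    by (intro tendsto_intros ln_P_limit Y)
  moreover have "real A * (4 * K) + real A * K - 2 * real r * (real 2 ^ 2 * (K / 3)) = (5 * real A - 8 * real r / 3) * K"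
    by (simp add: algebra_simps)
  ultimately have lim: "(\<lambda>m. real A * (ln \<bar>beta_form.P p m\<bar> / real m ^ 2) + real A * K - 2 * real r * (ln (real (Yodd p (2 * m))) / real m ^ 2))
     \<longlonglongrightarrow> (5 * real A - 8 * real r / 3) * K" by (simp only:)
  show ?thesis
  proof (rule Lim_transform_eventually[OF lim], use eventually_ge_at_top[of 1] in eventually_elim)
    case (elim m)
    note bf = beta_formI[OF elim]
    show ?case unfolding beta_form.ln_kappa[OF bf] ln_w beta_form.Y_def[OF bf] beta_form.n_def[OF bf]
      using elim by (simp add: diff_divide_distrib add_divide_distrib)
  qed
qed

text \<open>The index 2 n = 4 m brings a factor 16: the A - 1 factors \<open>D\<close> contribute 48
  / pi^2 each and the odd one 32 / pi^2.\<close>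

lemma ln_G_limit: "(\<lambda>m. ln (beta_form.G p A m) / real m ^ 2) \<longlonglongrightarrow> (48 * real A - 16) / pi ^ 2 * K"
proof -
  have D1: "(\<lambda>m. ln (real (Dall p (4 * m))) / real m ^ 2) \<longlonglongrightarrow> real 4 ^ 2 * (3 / pi ^ 2 * K)"
    unfolding Dall_def by (rule quadratic_limit_subseq[OF ln_prod_prim_part_all_asymp[OF p]]) simp
  have D2: "(\<lambda>m. ln (real (Dodd p (4 * m))) / real m ^ 2) \<longlonglongrightarrow> real 4 ^ 2 * (2 / pi ^ 2 * K)"
    unfolding Dodd_def by (rule quadratic_limit_subseq[OF ln_prod_prim_part_odd_asymp[OF p]]) simp
  have "(\<lambda>m. real (A - 1) * (ln (real (Dall p (4 * m))) / real m ^ 2) + ln (real (Dodd p (4 * m))) / real m ^ 2)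
     \<longlonglongrightarrow> real (A - 1) * (real 4 ^ 2 * (3 / pi ^ 2 * K)) + real 4 ^ 2 * (2 / pi ^ 2 * K)"
    by (intro tendsto_intros D1 D2)
  moreover have "real (A - 1) * (real 4 ^ 2 * (3 / pi ^ 2 * K)) + real 4 ^ 2 * (2 / pi ^ 2 * K) = (48 * real A - 16) / pi ^ 2 * K"
  proof -
    have "real (A - 1) = real A - 1" using r by (simp add: of_nat_diff)
    thus ?thesis by (simp add: algebra_simps add_divide_distrib diff_divide_distrib)
  qed
  ultimately have lim: "(\<lambda>m. real (A - 1) * (ln (real (Dall p (4 * m))) / real m ^ 2) + ln (real (Dodd p (4 * m))) / real m ^ 2)
     \<longlonglongrightarrow> (48 * real A - 16) / pi ^ 2 * K" by (simp only:)
  show ?thesis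
  proof (rule Lim_transform_eventually[OF lim], use eventually_ge_at_top[of 1] in eventually_elim)
    case (elim m)
    note bf = beta_formI[OF elim]
    have "2 * (2 * m) = 4 * m" by simp
    thus ?case unfolding beta_form.ln_G[OF bf] beta_form.n_def[OF bf] by (simp add: add_divide_distrib)
  qed
qed

text \<open>Only \<open>\<kappa>\<close> and the power of w count at this scale; the remaining
  factors are at most exponential in m.\<close>

lemma ln_M_limit: "(\<lambda>m. ln (beta_form.M p A r m) / real m ^ 2) \<longlonglongrightarrow> (2 * real A + 8 * real r ^ 2 + 16 * real r / 3) * K"
proof -
  define E where "E m = (real A * (2 * real m + 1) - 4 * real r * real m - 1) / 2" for m :: nat
  have 1: "(\<lambda>m. (real A * ln 4 + (E m * ln 2 + ln 3 + 2 * (real r * (2 * real m)) * ln 3 + real A * (2 * real m) * ln 4)) / real m ^ 2) \<longlonglongrightarrow> 0"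
    unfolding E_def by real_asymp
  have 2: "(\<lambda>m. ((8 * real r ^ 2 + 8 * real r - 3 * real A) * real m ^ 2 + 4 * real m) * K / real m ^ 2) \<longlonglongrightarrow> (8 * real r ^ 2 + 8 * real r - 3 * real A) * K"
    by real_asymp
  have "(\<lambda>m. (real A * ln 4 + (E m * ln 2 + ln 3 + 2 * (real r * (2 * real m)) * ln 3 + real A * (2 * real m) * ln 4)) / real m ^ 2 +
      ln \<bar>beta_form.\<kappa> p A r m\<bar> / real m ^ 2 + ((8 * real r ^ 2 + 8 * real r - 3 * real A) * real m ^ 2 + 4 * real m) * K / real m ^ 2)
     \<longlonglongrightarrow> 0 + (5 * real A - 8 * real r / 3) * K + (8 * real r ^ 2 + 8 * real r - 3 * real A) * K"
    by (intro tendsto_add 1 2 ln_kappa_limit)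
  moreover have "0 + (5 * real A - 8 * real r / 3) * K + (8 * real r ^ 2 + 8 * real r - 3 * real A) * K = (2 * real A + 8 * real r ^ 2 + 16 * real r / 3) * K"
    by (simp add: algebra_simps)
  ultimately have lim: "(\<lambda>m. (real A * ln 4 + (E m * ln 2 + ln 3 + 2 * (real r * (2 * real m)) * ln 3 + real A * (2 * real m) * ln 4)) / real m ^ 2 +
      ln \<bar>beta_form.\<kappa> p A r m\<bar> / real m ^ 2 + ((8 * real r ^ 2 + 8 * real r - 3 * real A) * real m ^ 2 + 4 * real m) * K / real m ^ 2)
     \<longlonglongrightarrow> (2 * real A + 8 * real r ^ 2 + 16 * real r / 3) * K" by (simp only:)
  show ?thesis
  proof (rule Lim_transform_eventually[OF lim], use eventually_ge_at_top[of 1] in eventually_elim)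
    case (elim m)
    note bf = beta_formI[OF elim]
    have E: "real (beta_form.e A r m) = E m" using beta_form.real_e[OF bf] by (simp add: E_def)
    show ?case unfolding beta_form.ln_M[OF bf] E ln_w beta_form.n_def[OF bf] beta_form.c_exp_def[OF bf]
      by (simp only: add_divide_distrib[symmetric] of_nat_mult of_nat_numeral ac_simps)
  qed
qed

text \<open>Besides \<open>\<kappa>\<close>, the first non-zero term carries the power (r n)^2 - l0
  e of w, where l0 is about (4 + 4 r) m and e about (A - 2 r) m.\<close>

lemma ln_S_limit: "(\<lambda>m. ln \<bar>beta_form.S p A r m\<bar> / real m ^ 2) \<longlonglongrightarrow> (real A - 4 * real r * real A + 12 * real r ^ 2 + 16 * real r / 3) * K"
proof -
  define E where "E m = (real A * (2 * real m + 1) - 4 * real r * real m - 1) / 2" for m :: nat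
  define F where "F m = ln \<bar>beta_form.\<kappa> p A r m\<bar> + (real r * (2 * real m)) ^ 2 * K - (4 * real m + 4 * real r * real m + 1) * E m * K" for m :: nat
  have 1: "(\<lambda>m. (ln \<bar>beta_form.S p A r m\<bar> - F m) / real m ^ 2) \<longlonglongrightarrow> 0"
  proof (rule tendsto_bounded_div_square[where C = "real (A + 4) * ln 2"], use eventually_ge_at_top[of "A + 4"] in eventually_elim)
    case (elim m)
    hence "1 \<le> m" by simp
    note bf = beta_formI[OF this]
    have E: "real (beta_form.e A r m) = E m" using beta_form.real_e[OF bf] by (simp add: E_def)
    have l0: "real (beta_form.l0 r m) = 4 * real m + 4 * real r * real m + 1"
      unfolding beta_form.l0_def[OF bf] beta_form.n_def[OF bf] by simp
    have "\<bar>ln \<bar>beta_form.S p A r m\<bar> - F m\<bar> \<le> real (A + 4) * ln 2"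
      using beta_form.ln_S_bound[OF bf elim]
      unfolding beta_form.ln_V[OF bf] of_nat_mult[of "beta_form.l0 r m"] l0 E ln_w F_def beta_form.n_def[OF bf]
      by (simp only: of_nat_mult of_nat_numeral)
    also have "\<dots> \<le> real (A + 4) * ln 2 * real m"
    proof -
      have "real (A + 4) * ln 2 * 1 \<le> real (A + 4) * ln 2 * real m" using \<open>1 \<le> m\<close> by (intro mult_left_mono) auto
      thus ?thesis by simp
    qed
    finally show ?case .
  qed
  have 2: "(\<lambda>m. ((real r * (2 * real m)) ^ 2 * K - (4 * real m + 4 * real r * real m + 1) * E m * K) / real m ^ 2) \<longlonglongrightarrow>
     4 * real r ^ 2 * K - (4 + 4 * real r) * (real A - 2 * real r) * K"
  proof -
    have lim: "(\<lambda>m::nat. 4 * real r ^ 2 * K - (4 + 4 * real r + 1 / real m) * ((real A * (2 + 1 / real m) - 4 * real r - 1 / real m) / 2) * K) \<longlonglongrightarrow>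
      4 * real r ^ 2 * K - (4 + 4 * real r + 0) * ((real A * (2 + 0) - 4 * real r - 0) / 2) * K"
      by (intro tendsto_intros lim_1_over_n) simp
    have eq: "4 * real r ^ 2 * K - (4 + 4 * real r + 0) * ((real A * (2 + 0) - 4 * real r - 0) / 2) * K =
       4 * real r ^ 2 * K - (4 + 4 * real r) * (real A - 2 * real r) * K" by (simp add: field_simps)
    show ?thesis
    proof (rule Lim_transform_eventually[OF lim[unfolded eq]], use eventually_gt_at_top[of 0] in eventually_elim)
      case (elim m)
      thus ?case unfolding E_def by (simp add: field_simps power2_eq_square)
    qed
  qed
  have "(\<lambda>m. (ln \<bar>beta_form.S p A r m\<bar> - F m) / real m ^ 2 + ln \<bar>beta_form.\<kappa> p A r m\<bar> / real m ^ 2 +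
     ((real r * (2 * real m)) ^ 2 * K - (4 * real m + 4 * real r * real m + 1) * E m * K) / real m ^ 2) \<longlonglongrightarrow>
     0 + (5 * real A - 8 * real r / 3) * K + (4 * real r ^ 2 * K - (4 + 4 * real r) * (real A - 2 * real r) * K)"
    by (intro tendsto_add 1 2 ln_kappa_limit)
  moreover have "0 + (5 * real A - 8 * real r / 3) * K + (4 * real r ^ 2 * K - (4 + 4 * real r) * (real A - 2 * real r) * K) =
     (real A - 4 * real r * real A + 12 * real r ^ 2 + 16 * real r / 3) * K"
    by (simp add: algebra_simps power2_eq_square)
  moreover have "(ln \<bar>beta_form.S p A r m\<bar> - F m) / real m ^ 2 + ln \<bar>beta_form.\<kappa> p A r m\<bar> / real m ^ 2 +
     ((real r * (2 * real m)) ^ 2 * K - (4 * real m + 4 * real r * real m + 1) * E m * K) / real m ^ 2 = ln \<bar>beta_form.S p A r m\<bar> / real m ^ 2" for m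
    unfolding F_def add_divide_distrib[symmetric] by simp
  ultimately show ?thesis by (simp only:)
qed

text \<open>The assumption says that the cleared forms tend to 0: the rate \<alpha> sets the decay
  of S against the growth of G. The rate \<beta> adds the growth of G and of M, so the terms in pi
  cancel in \<alpha> + \<beta>, the numerator of \<open>f_r\<close>.\<close>

lemma dim_ge_f_r:
  assumes pos: "4 * real r * real A - real A - 12 * real r ^ 2 - 16 * real r / 3 - (48 * real A - 16) / pi ^ 2 > 0"
  shows "f_r r A \<le> real (Q.dim (Q.span ({1} \<union> (\<lambda>t. complex_of_real (beta_real (1 / real_of_int p) t)) ` {t. even t \<and> 2 \<le> t \<and> t \<le> A - 1})))"
proof -
  define T where "T = {t::nat. even t \<and> 2 \<le> t \<and> t \<le> A - 1}"
  define \<alpha> where "\<alpha> = 4 * real r * real A - real A - 12 * real r ^ 2 - 16 * real r / 3 - (48 * real A - 16) / pi ^ 2"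
  define \<beta> where "\<beta> = (48 * real A - 16) / pi ^ 2 + (2 * real A + 8 * real r ^ 2 + 16 * real r / 3)"
  have K: "K > 0" using p by (intro ln_gt_zero) linarith
  have A1: "real A \<ge> 1" using r by simp
  have \<beta>: "\<beta> > 0"
  proof -
    have "(48 * real A - 16) / pi ^ 2 \<ge> 0" using A1 by (intro divide_nonneg_nonneg) auto
    moreover have "2 * real A + 8 * real r ^ 2 + 16 * real r / 3 > 0" using A1 by (intro add_pos_nonneg) auto
    ultimately show ?thesis unfolding \<beta>_def by linarith
  qed
  define x where "x t = beta_real (1 / real_of_int p) t" for t
  define \<Lambda> where "\<Lambda> m = 2 * fact (A - 1) * beta_form.G p A m * beta_form.S p A r m" for m
  \<comment> \<open>The criterion asks for positivity at every index while the construction starts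
    at m = 1, so the value at 0 is a filler. Adding 1 to \<open>stirling_bound A\<close> makes
    positivity immediate.\<close>
  define H where "H m = (if m = 0 then 1 else beta_form.G p A m * (real (2 * m + 1) * beta_form.M p A r m * (stirling_bound A + 1)))" for m
  have sb: "stirling_bound A \<ge> 0" unfolding stirling_bound_def by (intro mult_nonneg_nonneg sum_nonneg) auto
  have "\<exists>Bz B. of_int Bz + (\<Sum>t\<in>T. of_int (B t) * x t) = \<Lambda> m \<and> (\<forall>t\<in>T. \<bar>of_int (B t)\<bar> \<le> H m)"
    if m: "m \<ge> 1" for m
  proof -
    note bf = beta_formI[OF m]
    have q: "beta_form.q p = 1 / real_of_int p" using beta_form.q_def[OF bf] beta_form.z_def[OF bf] by simp
    obtain B0 :: int and B :: "nat \<Rightarrow> int" where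
      1: "of_int B0 + (\<Sum>t\<in>T. of_int (B t) * x t) = \<Lambda> m" and
      2: "\<And>t. t \<in> {1..A} \<Longrightarrow> \<bar>of_int (B t)\<bar> \<le> beta_form.G p A m * (real (2 * m + 1) * beta_form.M p A r m * stirling_bound A)"
    proof -
      show thesis
        by (rule beta_form.integer_form[OF bf, unfolded q beta_form.n_def[OF bf]],
            rule that[unfolded T_def x_def \<Lambda>_def])
    qed
    have "\<bar>of_int (B t)\<bar> \<le> H m" if t: "t \<in> T" for t
    proof -
      have "\<bar>real_of_int (B t)\<bar> \<le> beta_form.G p A m * (real (2 * m + 1) * beta_form.M p A r m * stirling_bound A)"
        using t by (intro 2) (auto simp: T_def)
      also have "\<dots> \<le> H m"
        unfolding H_def using m beta_form.G_pos[OF bf] beta_form.M_pos[OF bf] by (auto intro!: mult_left_mono)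
      finally show ?thesis .
    qed
    thus ?thesis using 1 by blast
  qed
  hence "\<forall>m. \<exists>Bz B. m \<ge> 1 \<longrightarrow> of_int Bz + (\<Sum>t\<in>T. of_int (B t) * x t) = \<Lambda> m \<and> (\<forall>t\<in>T. \<bar>of_int (B t)\<bar> \<le> H m)" by blast
  then obtain Bz :: "nat \<Rightarrow> int" and B :: "nat \<Rightarrow> nat \<Rightarrow> int" where
    form: "\<And>m. m \<ge> 1 \<Longrightarrow> of_int (Bz m) + (\<Sum>t\<in>T. of_int (B m t) * x t) = \<Lambda> m" and
    bound: "\<And>m. m \<ge> 1 \<Longrightarrow> \<forall>t\<in>T. \<bar>of_int (B m t)\<bar> \<le> H m"
    by metis
  have "1 + \<alpha> * K / (\<beta> * K) \<le> real (Q.dim (Q.span ({1} \<union> (\<lambda>t. complex_of_real (x t)) ` T)))"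
  proof (rule dim_lower_bound[where B = B and Bz = Bz and H = H])
    show "finite T" unfolding T_def by simp
    show "\<alpha> * K > 0" using pos K unfolding \<alpha>_def by (intro mult_pos_pos)
    show "\<beta> * K > 0" using \<beta> K by simp
    show "\<forall>\<^sub>F m in sequentially. of_int (Bz m) + (\<Sum>t\<in>T. of_int (B m t) * x t) \<noteq> 0"
      using eventually_ge_at_top[of "A + 4"]
    proof eventually_elim
      case (elim m)
      hence m: "m \<ge> 1" by simp
      note bf = beta_formI[OF m]
      show ?case unfolding form[OF m] \<Lambda>_def using beta_form.S_nz[OF bf elim] beta_form.G_pos[OF bf] by simp
    qed
    have "(\<lambda>m. ln (2 * fact (A - 1)) / real m ^ 2 + ln (beta_form.G p A m) / real m ^ 2 + ln \<bar>beta_form.S p A r m\<bar> / real m ^ 2) \<longlonglongrightarrow>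
       0 + (48 * real A - 16) / pi ^ 2 * K + (real A - 4 * real r * real A + 12 * real r ^ 2 + 16 * real r / 3) * K"
      by (intro tendsto_add ln_G_limit ln_S_limit) real_asymp
    moreover have "0 + (48 * real A - 16) / pi ^ 2 * K + (real A - 4 * real r * real A + 12 * real r ^ 2 + 16 * real r / 3) * K = - (\<alpha> * K)"
      unfolding \<alpha>_def by (simp add: algebra_simps)
    ultimately have lim: "(\<lambda>m. ln (2 * fact (A - 1)) / real m ^ 2 + ln (beta_form.G p A m) / real m ^ 2 + ln \<bar>beta_form.S p A r m\<bar> / real m ^ 2) \<longlonglongrightarrow> - (\<alpha> * K)"
      by (simp only:)
    show "(\<lambda>m. ln \<bar>of_int (Bz m) + (\<Sum>t\<in>T. of_int (B m t) * x t)\<bar> / real m ^ 2) \<longlonglongrightarrow> - (\<alpha> * K)"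
    proof (rule Lim_transform_eventually[OF lim], use eventually_ge_at_top[of "A + 4"] in eventually_elim)
      case (elim m)
      hence m: "m \<ge> 1" by simp
      note bf = beta_formI[OF m]
      have "\<bar>\<Lambda> m\<bar> = 2 * fact (A - 1) * beta_form.G p A m * \<bar>beta_form.S p A r m\<bar>"
        unfolding \<Lambda>_def abs_mult using beta_form.G_pos[OF bf] by simp
      hence "ln \<bar>\<Lambda> m\<bar> = ln (2 * fact (A - 1)) + ln (beta_form.G p A m) + ln \<bar>beta_form.S p A r m\<bar>"
        using beta_form.S_nz[OF bf elim] beta_form.G_pos[OF bf] by (simp add: ln_mult_pos)
      thus ?case unfolding form[OF m] by (simp only: add_divide_distrib)
    qed
    show "H m > 0" for m
    proof (cases "m = 0")
      case False
      hence "m \<ge> 1" by simp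
      note bf = beta_formI[OF this]
      show ?thesis unfolding H_def using False beta_form.G_pos[OF bf] beta_form.M_pos[OF bf] sb
        by (auto intro!: mult_pos_pos add_nonneg_pos)
    qed (simp add: H_def)
    have "(\<lambda>m. ln (beta_form.G p A m) / real m ^ 2 + ln (2 * real m + 1) / real m ^ 2 + ln (beta_form.M p A r m) / real m ^ 2 + ln (stirling_bound A + 1) / real m ^ 2) \<longlonglongrightarrow>
       (48 * real A - 16) / pi ^ 2 * K + 0 + (2 * real A + 8 * real r ^ 2 + 16 * real r / 3) * K + 0"
    proof (intro tendsto_add ln_G_limit ln_M_limit)
      show "(\<lambda>m::nat. ln (2 * real m + 1) / real m ^ 2) \<longlonglongrightarrow> 0" by real_asymp
      show "(\<lambda>m::nat. ln (stirling_bound A + 1) / real m ^ 2) \<longlonglongrightarrow> 0" by real_asymp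
    qed
    moreover have "(48 * real A - 16) / pi ^ 2 * K + 0 + (2 * real A + 8 * real r ^ 2 + 16 * real r / 3) * K + 0 = \<beta> * K"
      unfolding \<beta>_def by (simp only: add_0_right distrib_right)
    ultimately have lim: "(\<lambda>m. ln (beta_form.G p A m) / real m ^ 2 + ln (2 * real m + 1) / real m ^ 2 + ln (beta_form.M p A r m) / real m ^ 2 + ln (stirling_bound A + 1) / real m ^ 2) \<longlonglongrightarrow> \<beta> * K"
      by (simp only:)
    show "(\<lambda>m. ln (H m) / real m ^ 2) \<longlonglongrightarrow> \<beta> * K"
    proof (rule Lim_transform_eventually[OF lim], use eventually_ge_at_top[of 1] in eventually_elim)
      case (elim m)
      note bf = beta_formI[OF elim]
      have "ln (H m) = ln (beta_form.G p A m) + ln (real (2 * m + 1)) + ln (beta_form.M p A r m) + ln (stirling_bound A + 1)"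
      proof -
        have "H m = beta_form.G p A m * (real (2 * m + 1) * beta_form.M p A r m * (stirling_bound A + 1))"
          using elim by (simp add: H_def)
        moreover have "real (2 * m + 1) > 0" "stirling_bound A + 1 > 0" using sb by simp_all
        ultimately show ?thesis using beta_form.G_pos[OF bf] beta_form.M_pos[OF bf]
          by (simp only: ln_mult_pos mult_pos_pos)
      qed
      thus ?case by (simp add: add_divide_distrib)
    qed
    show "\<forall>\<^sub>F m in sequentially. \<forall>t\<in>T. \<bar>of_int (B m t)\<bar> \<le> H m"
      using eventually_ge_at_top[of 1] by eventually_elim (rule bound)
  qed
  also have "1 + \<alpha> * K / (\<beta> * K) = (\<alpha> + \<beta>) / \<beta>" using K \<beta> by (simp add: add_divide_distrib)
  also have "\<dots> = f_r r A"
  proof -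
    have 1: "\<alpha> + \<beta> = 4 * real r * real A + real A - 4 * real r ^ 2" unfolding \<alpha>_def \<beta>_def by simp
    have 2: "\<beta> = (48 / pi ^ 2 + 2) * real A + 8 * real r ^ 2 - 16 / pi ^ 2 + 16 * real r / 3"
      unfolding \<beta>_def by (simp add: diff_divide_distrib algebra_simps)
    show ?thesis unfolding 1 unfolding 2 f_r_def ..
  qed
  finally show ?thesis by (simp only: x_def T_def)
qed

text \<open>The assumption is equivalent to the numerator of \<open>f_r\<close> not exceeding its
  positive denominator. For such r the trivial bound 1 on the dimension suffices.\<close>

lemma f_r_le_1:
  assumes "4 * real r * real A - real A - 12 * real r ^ 2 - 16 * real r / 3 - (48 * real A - 16) / pi ^ 2 \<le> 0"
  shows "f_r r A \<le> 1"
proof -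
  have "(48 / pi ^ 2 + 2) * real A + 8 * real r ^ 2 - 16 / pi ^ 2 + 16 * real r / 3 > 0"
  proof -
    have "(48 / pi ^ 2 + 2) * real A + 8 * real r ^ 2 \<ge> 0" by (intro add_nonneg_nonneg mult_nonneg_nonneg) auto
    thus ?thesis using f_r_denominator_gt[OF r(1), of A] by linarith
  qed
  moreover have "4 * real r * real A + real A - 4 * real r ^ 2 \<le> (48 / pi ^ 2 + 2) * real A + 8 * real r ^ 2 - 16 / pi ^ 2 + 16 * real r / 3"
    using assms by (simp add: diff_divide_distrib algebra_simps)
  ultimately show ?thesis unfolding f_r_def by (subst divide_le_eq_1_pos)
qed

end

lemma dim_span_ge_1:
  assumes "finite S" "1 \<in> S"
  shows "1 \<le> Q.dim (Q.span S)"
proof -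
  obtain Bs where Bs: "1 \<in> Bs" "Bs \<subseteq> S" "Q.dim (Q.span S) = card Bs"
    using basis_containing_one[OF assms(2)] by metis
  moreover have "card Bs > 0" using Bs assms(1) finite_subset by (auto simp: card_gt_0_iff)
  ultimately show ?thesis by simp
qed

theorem theorem1p1:
  "(\<forall>(q::complex) (A::nat).
      q \<noteq> 0 \<and> 1 / q \<in> \<int> - {-1, 1} \<and> A \<ge> 3 \<and> odd A \<longrightarrow>
      real (Q.dim (Q.span ({1} \<union> {beta_q q s | s. even s \<and> 2 \<le> s \<and> s \<le> A - 1}))) \<ge> f_max A)
   \<and> f_max \<sim>[at_top] (\<lambda>A. pi / (2 * sqrt (pi ^ 2 + 24)) * sqrt (real A))"
proof (intro conjI allI impI f_max_asymp_equiv)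
  fix q :: complex and A :: nat
  assume H: "q \<noteq> 0 \<and> 1 / q \<in> \<int> - {-1, 1} \<and> A \<ge> 3 \<and> odd A"
  hence A: "A \<ge> 3" "odd A" by auto
  obtain p :: int where p: "1 / q = of_int p" using H by (auto elim!: Ints_cases)
  have "p \<noteq> 0" "p \<noteq> 1" "p \<noteq> -1" using p H by auto
  hence p2: "\<bar>p\<bar> \<ge> 2" by linarith
  have q: "q = complex_of_real (1 / real_of_int p)" using arg_cong[OF p, of "\<lambda>x. 1 / x"] by simp
  have "\<bar>real_of_int p\<bar> \<ge> 2" using p2 by linarith
  hence "\<bar>1 / real_of_int p\<bar> < 1" by (simp add: divide_less_eq)
  hence \<beta>: "beta_q q s = complex_of_real (beta_real (1 / real_of_int p) s)" for s
    unfolding q beta_real_def by (rule beta_q_of_real)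
  define T where "T = {t::nat. even t \<and> 2 \<le> t \<and> t \<le> A - 1}"
  have set_eq: "{beta_q q s | s. even s \<and> 2 \<le> s \<and> s \<le> A - 1} =
     (\<lambda>t. complex_of_real (beta_real (1 / real_of_int p) t)) ` T"
    unfolding \<beta> T_def by auto
  define d where "d = Q.dim (Q.span ({1} \<union> (\<lambda>t. complex_of_real (beta_real (1 / real_of_int p) t)) ` T))"
  have d1: "1 \<le> d" unfolding d_def by (rule dim_span_ge_1) (auto simp: T_def)
  have "f_max A \<le> real d"
    unfolding f_max_def
  proof (rule Max.boundedI[OF f_max_set(1) f_max_set(2)[OF A(1)]])
    fix a assume "a \<in> {f_r r A | r. 1 \<le> r \<and> real r < real A / 2}"
    then obtain r where r: "a = f_r r A" "1 \<le> r" "real r < real A / 2" by auto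
    hence r2: "2 * r < A" by simp
    show "a \<le> real d"
    proof (cases "4 * real r * real A - real A - 12 * real r ^ 2 - 16 * real r / 3 - (48 * real A - 16) / pi ^ 2 > 0")
      case True
      thus ?thesis using dim_ge_f_r[OF p2 A(2) r(2) r2] unfolding r(1) d_def T_def by blast
    next
      case False
      hence "f_r r A \<le> 1" using f_r_le_1[OF p2 A(2) r(2) r2] by linarith
      thus ?thesis using d1 r(1) by simp
    qed
  qed
  thus "f_max A \<le> real (Q.dim (Q.span ({1} \<union> {beta_q q s | s. even s \<and> 2 \<le> s \<and> s \<le> A - 1})))"
    unfolding set_eq d_def .
qed

end
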